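(* For any $\epsilon\in(0,1/8)$, there exists a polynomial-time randomized $(1/8-\epsilon)$-approximation algorithm for the maximum weight matching problem with Lipschitz constant $O(\epsilon^{-1})$.
   Context: Maximum weight matching problem: given an undirected graph $G=(V,E)$ and $w\in\mathbb{R}_{\geq0}^E$, output a matching $M\subseteq E$ maximizing $\sum_{e\in M}w(e)$. A randomized algorithm is an $\alpha$-approximation if the expected weight of its output matching is at least $\alpha$ times the maximum weight of a matching. For edge sets $F,F'$, $d_w((F,w),(F',w'))=\|\sum_{e\in F}w(e)\mathbf{1}_e-\sum_{e\in F'}w'(e)\mathbf{1}_e\|_1$ ($\mathbf{1}_e$ the indicator vector of $e$); $\mathrm{EM}_\mathrm{w}$ of two output distributions is the minimum over couplings of the expected $d_w$. The Lipschitz constant of $\mathcal{A}$ on $G$ is $\sup_{w\neq w'\in\mathbb{R}_{\geq0}^E}\mathrm{EM}_\mathrm{w}((\mathcal{A}(G,w),w),(\mathcal{A}(G,w'),w'))/\|w-w'\|_1$, and the bound $O(\epsilon^{-1})$ holds for every input graph. *)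

theory Defs
  imports "HOL-Probability.Probability" "HOL-Computational_Algebra.Polynomial"
begin

section \<open>Graphs and matchings\<close>

text \<open>A finite simple undirected graph \<open>(n, E)\<close> has vertex set \<open>{..<n}\<close>; an edge is a two-element
  set of vertices. Weight vectors in \<open>\<real>\<^sub>\<ge>\<^sub>0\<^sup>E\<close> are extensional functions, so that they are
  equal iff they agree on \<open>E\<close>.\<close>

type_synonym edge = "nat set"
type_synonym ugraph = "nat \<times> edge set"

definition verts :: "ugraph \<Rightarrow> nat set" where
  "verts G = {..<fst G}"

definition edges :: "ugraph \<Rightarrow> edge set" where
  "edges G = snd G"

definition wf_ugraph :: "ugraph \<Rightarrow> bool" where
  "wf_ugraph G \<longleftrightarrow> (\<forall>e\<in>edges G. e \<subseteq> verts G \<and> card e = 2)"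

definition weightings :: "ugraph \<Rightarrow> (edge \<Rightarrow> real) set" where
  "weightings G = (edges G \<rightarrow>\<^sub>E {0..})"

definition matching :: "ugraph \<Rightarrow> edge set \<Rightarrow> bool" where
  "matching G M \<longleftrightarrow> M \<subseteq> edges G \<and> (\<forall>e\<in>M. \<forall>f\<in>M. e \<noteq> f \<longrightarrow> e \<inter> f = {})"

definition weight :: "(edge \<Rightarrow> real) \<Rightarrow> edge set \<Rightarrow> real" where
  "weight w M = (\<Sum>e\<in>M. w e)"

definition max_matching_weight :: "ugraph \<Rightarrow> (edge \<Rightarrow> real) \<Rightarrow> real" where
  "max_matching_weight G w = Max (weight w ` {M. matching G M})"

section \<open>Approximation ratio and Lipschitz constant\<close>

type_synonym rand_alg = "ugraph \<Rightarrow> (edge \<Rightarrow> real) \<Rightarrow> edge set pmf"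

definition approx_max_weight_matching :: "real \<Rightarrow> rand_alg \<Rightarrow> bool" where
  "approx_max_weight_matching \<alpha> A \<longleftrightarrow>
     (\<forall>G w. wf_ugraph G \<longrightarrow> w \<in> weightings G \<longrightarrow>
        (\<forall>M\<in>set_pmf (A G w). matching G M) \<and>
        measure_pmf.expectation (A G w) (weight w) \<ge> \<alpha> * max_matching_weight G w)"

definition l1_norm :: "ugraph \<Rightarrow> (edge \<Rightarrow> real) \<Rightarrow> real" where
  "l1_norm G x = (\<Sum>e\<in>edges G. \<bar>x e\<bar>)"

definition weighted_indicator :: "edge set \<Rightarrow> (edge \<Rightarrow> real) \<Rightarrow> edge \<Rightarrow> real" where
  "weighted_indicator F w = (\<lambda>g. \<Sum>e\<in>F. w e * indicator {e} g)"

definition dist_w :: "ugraph \<Rightarrow> edge set \<times> (edge \<Rightarrow> real) \<Rightarrow> edge set \<times> (edge \<Rightarrow> real) \<Rightarrow> real" where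
  "dist_w G = (\<lambda>(F, w) (F', w').
     l1_norm G (\<lambda>g. weighted_indicator F w g - weighted_indicator F' w' g))"

definition couplings :: "'a pmf \<Rightarrow> 'b pmf \<Rightarrow> ('a \<times> 'b) pmf set" where
  "couplings p q = {c. map_pmf fst c = p \<and> map_pmf snd c = q}"

text \<open>For finitely supported distributions the infimum below is attained.\<close>

definition EM_w :: "ugraph \<Rightarrow> edge set pmf \<times> (edge \<Rightarrow> real) \<Rightarrow> edge set pmf \<times> (edge \<Rightarrow> real) \<Rightarrow> ennreal" where
  "EM_w G = (\<lambda>(p, w) (q, w').
     INF c\<in>couplings p q. \<integral>\<^sup>+ (F, F'). ennreal (dist_w G (F, w) (F', w')) \<partial>measure_pmf c)"

definition lipschitz_constant :: "rand_alg \<Rightarrow> ugraph \<Rightarrow> ennreal" where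
  "lipschitz_constant A G =
     (SUP (w, w')\<in>{(w, w'). w \<in> weightings G \<and> w' \<in> weightings G \<and> w \<noteq> w'}.
        EM_w G (A G w, w) (A G w', w') / ennreal (l1_norm G (\<lambda>e. w e - w' e)))"

section \<open>Polynomial time: a randomized real RAM\<close>

text \<open>Weights are arbitrary reals, so the machine model is the real RAM: exact field operations
  and comparisons on reals at unit cost, no rounding and no conversion of reals to integers. It is
  extended by an instruction drawing a fresh uniform sample from \<open>[0,1]\<close>. A program uses
  finitely many integer arrays and real arrays, named by numerals in the program text and indexed
  by integer expressions (a scalar is an array used at index \<open>0\<close> only). Integer arithmetic is
  restricted to sums and truncated differences, so that bit lengths grow by at most a constant per
  step and unit cost is legitimate; real constants are integers, so no information can be hidden in
  them.\<close>

datatype iexp =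
    IConst nat
  | IGet nat iexp
  | IAdd iexp iexp
  | ISub iexp iexp

datatype rexp =
    RConst int
  | RGet nat iexp
  | RAdd rexp rexp
  | RSub rexp rexp
  | RMul rexp rexp
  | RDiv rexp rexp

datatype bexp =
    ILess iexp iexp
  | RLess rexp rexp
  | BNot bexp
  | BAnd bexp bexp

datatype com =
    Skip
  | ISet nat iexp iexp
  | RSet nat iexp rexp
  | Sample nat iexp
  | Seq com com
  | Cond bexp com com
  | While bexp com

text \<open>Randomness is modelled by a tape of independent uniform samples; \<open>drawn\<close> counts the
  samples consumed so far.\<close>

record state =
  ints :: "nat \<Rightarrow> nat \<Rightarrow> nat"
  reals :: "nat \<Rightarrow> nat \<Rightarrow> real"
  drawn :: nat

fun ival :: "iexp \<Rightarrow> state \<Rightarrow> nat" where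
  "ival (IConst k) s = k"
| "ival (IGet a i) s = ints s a (ival i s)"
| "ival (IAdd i j) s = ival i s + ival j s"
| "ival (ISub i j) s = ival i s - ival j s"

fun rval :: "rexp \<Rightarrow> state \<Rightarrow> real" where
  "rval (RConst k) s = of_int k"
| "rval (RGet a i) s = reals s a (ival i s)"
| "rval (RAdd x y) s = rval x s + rval y s"
| "rval (RSub x y) s = rval x s - rval y s"
| "rval (RMul x y) s = rval x s * rval y s"
| "rval (RDiv x y) s = rval x s / rval y s"

fun bval :: "bexp \<Rightarrow> state \<Rightarrow> bool" where
  "bval (ILess i j) s \<longleftrightarrow> ival i s < ival j s"
| "bval (RLess x y) s \<longleftrightarrow> rval x s < rval y s"
| "bval (BNot b) s \<longleftrightarrow> \<not> bval b s"
| "bval (BAnd b c) s \<longleftrightarrow> bval b s \<and> bval c s"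

definition iupd :: "nat \<Rightarrow> nat \<Rightarrow> nat \<Rightarrow> state \<Rightarrow> state" where
  "iupd a i x s = s\<lparr>ints := (ints s)(a := (ints s a)(i := x))\<rparr>"

definition rupd :: "nat \<Rightarrow> nat \<Rightarrow> real \<Rightarrow> state \<Rightarrow> state" where
  "rupd a i x s = s\<lparr>reals := (reals s)(a := (reals s a)(i := x))\<rparr>"

text \<open>\<open>exec \<omega> c s t s'\<close>: on tape \<open>\<omega>\<close>, command \<open>c\<close> started in \<open>s\<close> halts in \<open>s'\<close> after \<open>t\<close>
  steps. Each assignment and each test costs one step; the expressions in it have constant size,
  since the program does not depend on the input.\<close>

inductive exec :: "(nat \<Rightarrow> real) \<Rightarrow> com \<Rightarrow> state \<Rightarrow> nat \<Rightarrow> state \<Rightarrow> bool" for \<omega> where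
  Skip: "exec \<omega> Skip s 1 s"
| ISet: "exec \<omega> (ISet a i e) s 1 (iupd a (ival i s) (ival e s) s)"
| RSet: "exec \<omega> (RSet a i e) s 1 (rupd a (ival i s) (rval e s) s)"
| Sample: "exec \<omega> (Sample a i) s 1
             ((rupd a (ival i s) (\<omega> (drawn s)) s)\<lparr>drawn := Suc (drawn s)\<rparr>)"
| Seq: "exec \<omega> c s t s' \<Longrightarrow> exec \<omega> d s' u s'' \<Longrightarrow> exec \<omega> (Seq c d) s (t + u) s''"
| CondTrue: "bval b s \<Longrightarrow> exec \<omega> c s t s' \<Longrightarrow> exec \<omega> (Cond b c d) s (Suc t) s'"
| CondFalse: "\<not> bval b s \<Longrightarrow> exec \<omega> d s t s' \<Longrightarrow> exec \<omega> (Cond b c d) s (Suc t) s'"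
| WhileFalse: "\<not> bval b s \<Longrightarrow> exec \<omega> (While b c) s 1 s"
| WhileTrue: "bval b s \<Longrightarrow> exec \<omega> c s t s' \<Longrightarrow> exec \<omega> (While b c) s' u s'' \<Longrightarrow>
                exec \<omega> (While b c) s (Suc (t + u)) s''"

inductive_cases Skip_elim: "exec \<omega> Skip s t s'"
inductive_cases ISet_elim: "exec \<omega> (ISet a i e) s t s'"
inductive_cases RSet_elim: "exec \<omega> (RSet a i e) s t s'"
inductive_cases Sample_elim: "exec \<omega> (Sample a i) s t s'"
inductive_cases Seq_elim: "exec \<omega> (Seq c d) s t s'"
inductive_cases Cond_elim: "exec \<omega> (Cond b c d) s t s'"
inductive_cases While_elim: "exec \<omega> (While b c) s t s'"

lemma exec_deterministic:
  "exec \<omega> c s t s' \<Longrightarrow> exec \<omega> c s u s'' \<Longrightarrow> u = t \<and> s'' = s'"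
proof (induction arbitrary: u s'' rule: exec.induct)
  case Skip
  then show ?case by (auto elim: Skip_elim)
next
  case ISet
  then show ?case by (auto elim: ISet_elim)
next
  case RSet
  then show ?case by (auto elim: RSet_elim)
next
  case Sample
  then show ?case by (auto elim: Sample_elim)
next
  case (Seq c s t s' d v r)
  from Seq.prems show ?case by (rule Seq_elim) (use Seq.IH in blast)
next
  case CondTrue
  from CondTrue.prems show ?case by (rule Cond_elim) (use CondTrue.IH CondTrue.hyps in blast)+
next
  case CondFalse
  from CondFalse.prems show ?case by (rule Cond_elim) (use CondFalse.IH CondFalse.hyps in blast)+
next
  case WhileFalse
  from WhileFalse.prems show ?case by (rule While_elim) (use WhileFalse.hyps in auto)
next
  case WhileTrue
  from WhileTrue.prems show ?case by (rule While_elim) (use WhileTrue.IH WhileTrue.hyps in blast)+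
qed

text \<open>Input: integer array 0 holds \<open>n\<close> at index 0, integer array 1 the adjacency matrix and real
  array 0 the weight matrix, both in row-major order; everything else is zero. Output: the upper
  triangle of an \<open>n \<times> n\<close> matrix in integer array 2.\<close>

definition init_state :: "ugraph \<Rightarrow> (edge \<Rightarrow> real) \<Rightarrow> state" where
  "init_state G w =
    (let n = fst G; cell = (\<lambda>k. {k div n, k mod n}); present = (\<lambda>k. k < n * n \<and> cell k \<in> edges G)
     in \<lparr>ints = (\<lambda>a k. if a = 0 \<and> k = 0 then n else if a = 1 \<and> present k then 1 else 0),
         reals = (\<lambda>a k. if a = 0 \<and> present k then w (cell k) else 0),
         drawn = 0\<rparr>)"

definition output_edges :: "ugraph \<Rightarrow> state \<Rightarrow> edge set" where
  "output_edges G s = {{u, v} | u v. u < v \<and> v < fst G \<and> ints s 2 (u * fst G + v) \<noteq> 0}"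

definition tape :: "(nat \<Rightarrow> real) measure" where
  "tape = (\<Pi>\<^sub>M i\<in>UNIV. uniform_measure lborel {0..1})"

text \<open>A single program realizes \<open>A\<close> on all inputs, with a worst-case running time, over all tapes
  with entries in \<open>[0,1]\<close> and all weights, that is polynomial in the number of vertices.\<close>

definition polytime_randomized :: "rand_alg \<Rightarrow> bool" where
  "polytime_randomized A \<longleftrightarrow>
     (\<exists>P (p :: nat poly). \<forall>G w. wf_ugraph G \<longrightarrow> w \<in> weightings G \<longrightarrow>
        (\<exists>X. X \<in> measurable tape (count_space UNIV) \<and>
             measure_pmf (A G w) = distr tape (count_space UNIV) X \<and>
             (\<forall>\<omega>. (\<forall>i. \<omega> i \<in> {0..1}) \<longrightarrow>
                (\<exists>t s. exec \<omega> P (init_state G w) t s \<and> t \<le> poly p (fst G) \<and>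
                       X \<omega> = output_edges G s))))"

end

theory Submission imports Defs begin

text \<open>Let \<open>S\<close> be the total weight, \<open>q = 1/9\<close>, and \<open>c\<close> uniform in \<open>[q, 1]\<close>. The thresholds
  \<open>c S, c S q, c S q\<^sup>2, \<dots>\<close> cut the edges into weight classes. In each class run random-order
  greedy matching on the whole class, and then discard every chosen edge that meets a chosen edge of
  a heavier class.

  Discarding keeps a fraction \<open>1 - 2 (q + q\<^sup>2 + \<dots>) = 3/4\<close> of the rounded weight, a maximal matching
  is half optimal in each class, and rounding down to the threshold below keeps at least a third of
  each weight in expectation, whence the ratio \<open>1/8\<close>. The loss \<open>\<epsilon>\<close> comes from cutting off after
  \<open>O(n)\<close> classes, which makes the running time independent of the weights.

  For the Lipschitz bound both runs use the same random tape. An edge changes its class with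
  probability inversely proportional to its relative weight, because the thresholds scale with
  \<open>S\<close>; a change of class alters in expectation at most one edge of the greedy matching of a class;
  and one such edge affects discarded weight proportional to its own. No cascade arises, because
  the greedy matchings of the different classes do not interact.\<close>

section \<open>Greedy independent sets\<close>

definition is_greedy :: "'a set \<Rightarrow> ('a \<Rightarrow> 'a \<Rightarrow> bool) \<Rightarrow> ('a \<Rightarrow> 'b::linorder) \<Rightarrow> 'a set \<Rightarrow> bool" where
  "is_greedy V R \<pi> M \<longleftrightarrow>
     M \<subseteq> V \<and> (\<forall>e\<in>V. e \<in> M \<longleftrightarrow> \<not> (\<exists>f\<in>M. R f e \<and> \<pi> f < \<pi> e))"

definition greedy :: "'a set \<Rightarrow> ('a \<Rightarrow> 'a \<Rightarrow> bool) \<Rightarrow> ('a \<Rightarrow> 'b::linorder) \<Rightarrow> 'a set" where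
  "greedy V R \<pi> = (THE M. is_greedy V R \<pi> M)"

lemma is_greedy_mem_iff:
  assumes "is_greedy V R \<pi> M"
  shows "e \<in> M \<longleftrightarrow> e \<in> V \<and> \<not> (\<exists>f\<in>M. f \<in> V \<and> R f e \<and> \<pi> f < \<pi> e)"
  using assms by (auto simp: is_greedy_def)

lemma is_greedy_agree:
  fixes \<pi> :: "'a \<Rightarrow> 'b::linorder" and \<pi>' :: "'a \<Rightarrow> 'c::linorder"
  assumes fin: "finite V" and M: "is_greedy V R \<pi> M" and M': "is_greedy V' R' \<pi>' M'"
    and V: "\<And>f. P f \<Longrightarrow> f \<in> V \<longleftrightarrow> f \<in> V'"
    and pred: "\<And>f g. P f \<Longrightarrow>
      g \<in> V \<and> R g f \<and> \<pi> g < \<pi> f \<longleftrightarrow> g \<in> V' \<and> R' g f \<and> \<pi>' g < \<pi>' f"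
    and closed: "\<And>f g. P f \<Longrightarrow> g \<in> V \<Longrightarrow> R g f \<Longrightarrow> \<pi> g < \<pi> f \<Longrightarrow> P g"
    and "P e"
  shows "e \<in> M \<longleftrightarrow> e \<in> M'"
  using \<open>P e\<close>
proof (induction "card {f \<in> V. \<pi> f < \<pi> e}" arbitrary: e rule: less_induct)
  case (less e)
  have "f \<in> M \<longleftrightarrow> f \<in> M'" if f: "f \<in> V" "R f e" "\<pi> f < \<pi> e" for f
  proof (rule less.hyps)
    have "{g \<in> V. \<pi> g < \<pi> f} \<subset> {g \<in> V. \<pi> g < \<pi> e}" using f by force
    then show "card {g \<in> V. \<pi> g < \<pi> f} < card {g \<in> V. \<pi> g < \<pi> e}"
      using fin by (intro psubset_card_mono) auto
  qed (rule closed[OF less.prems f])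
  then have "(\<exists>f\<in>M. f \<in> V \<and> R f e \<and> \<pi> f < \<pi> e) \<longleftrightarrow> (\<exists>f\<in>M'. f \<in> V' \<and> R' f e \<and> \<pi>' f < \<pi>' e)"
    using pred[OF less.prems] by blast
  then show ?case
    using is_greedy_mem_iff[OF M, of e] is_greedy_mem_iff[OF M', of e] V[OF less.prems] by simp
qed

lemma is_greedy_unique:
  assumes "finite V" "is_greedy V R \<pi> M" "is_greedy V R \<pi> M'"
  shows "M = M'"
  using is_greedy_agree[OF assms, where P = "\<lambda>_. True"] by blast

lemma is_greedy_insert:
  assumes M: "is_greedy V R \<pi> M" and x: "x \<notin> V" and last: "\<And>f. f \<in> V \<Longrightarrow> \<pi> f \<le> \<pi> x"
  shows "is_greedy (insert x V) R \<pi> (if \<exists>f\<in>M. R f x \<and> \<pi> f < \<pi> x then M else insert x M)"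
proof -
  have "\<not> \<pi> x < \<pi> e" "M \<subseteq> V" if "e \<in> V" for e
    using last[OF that] M by (auto simp: is_greedy_def)
  then show ?thesis using M x unfolding is_greedy_def by auto
qed

lemma is_greedy_exists:
  assumes "finite V"
  shows "\<exists>M. is_greedy V R \<pi> M"
  using assms
proof (induction V rule: finite_ranking_induct[where f = \<pi>])
  case empty
  then show ?case by (auto simp: is_greedy_def)
next
  case (insert x V)
  then obtain M where M: "is_greedy V R \<pi> M" by blast
  show ?case
  proof (cases "x \<in> V")
    case True
    then show ?thesis using M by (auto simp: insert_absorb)
  next
    case False
    then show ?thesis using is_greedy_insert[OF M] insert.hyps(2) by blast
  qed
qed

lemma is_greedy_greedy: "finite V \<Longrightarrow> is_greedy V R \<pi> (greedy V R \<pi>)"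
  unfolding greedy_def
  by (rule theI') (use is_greedy_exists is_greedy_unique in blast)

lemma greedy_eqI: "finite V \<Longrightarrow> is_greedy V R \<pi> M \<Longrightarrow> greedy V R \<pi> = M"
  using is_greedy_greedy is_greedy_unique by blast

lemma greedy_subset: "finite V \<Longrightarrow> greedy V R \<pi> \<subseteq> V"
  using is_greedy_greedy[of V R \<pi>] by (auto simp: is_greedy_def)

lemma greedy_mem_iff:
  "finite V \<Longrightarrow> e \<in> V \<Longrightarrow>
     e \<in> greedy V R \<pi> \<longleftrightarrow> \<not> (\<exists>f\<in>greedy V R \<pi>. R f e \<and> \<pi> f < \<pi> e)"
  using is_greedy_greedy[of V R \<pi>] by (auto simp: is_greedy_def)

lemma greedy_independent:
  assumes "finite V" "inj_on \<pi> V" "symp R" "irreflp R"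
    and mem: "e \<in> greedy V R \<pi>" "f \<in> greedy V R \<pi>"
  shows "\<not> R e f"
proof
  assume "R e f"
  then have "R f e" "e \<noteq> f" using assms by (auto dest: sympD irreflpD)
  moreover have "e \<in> V" "f \<in> V" using mem greedy_subset[OF \<open>finite V\<close>] by auto
  ultimately have "\<pi> e < \<pi> f \<or> \<pi> f < \<pi> e"
    using \<open>inj_on \<pi> V\<close> by (metis inj_onD linorder_neqE)
  then show False
    using greedy_mem_iff[OF \<open>finite V\<close> \<open>e \<in> V\<close>, of R \<pi>]
      greedy_mem_iff[OF \<open>finite V\<close> \<open>f \<in> V\<close>, of R \<pi>]
      mem \<open>R e f\<close> \<open>R f e\<close> by blast
qed

lemma greedy_cong:
  assumes "finite V" "\<And>e f. e \<in> V \<Longrightarrow> f \<in> V \<Longrightarrow> R e f \<longleftrightarrow> R' e f"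
    and "\<And>e f. e \<in> V \<Longrightarrow> f \<in> V \<Longrightarrow> \<pi> e < \<pi> f \<longleftrightarrow> \<pi>' e < \<pi>' f"
  shows "greedy V R \<pi> = greedy V R' \<pi>'"
proof (rule greedy_eqI[OF assms(1)])
  show "is_greedy V R \<pi> (greedy V R' \<pi>')"
    using is_greedy_greedy[OF assms(1), of R' \<pi>'] assms(2,3)
    unfolding is_greedy_def by blast
qed

section \<open>Influence of one vertex on the greedy set\<close>

definition influence :: "'a set \<Rightarrow> ('a \<Rightarrow> 'a \<Rightarrow> bool) \<Rightarrow> ('a \<Rightarrow> 'b::linorder) \<Rightarrow> 'a \<Rightarrow> nat" where
  "influence V R \<pi> e = card (sym_diff (greedy V R \<pi>) (greedy (V - {e}) R \<pi>))"

definition forced :: "'a set \<Rightarrow> ('a \<Rightarrow> 'a \<Rightarrow> bool) \<Rightarrow> ('a \<Rightarrow> 'b::linorder) \<Rightarrow> 'a \<Rightarrow> 'a set" where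
  "forced V R \<pi> e = insert e (greedy {f \<in> V - {e}. \<not> R e f} R \<pi>)"

text \<open>The vertices whose membership depends on whether \<open>e\<close> is absent or processed first.\<close>

definition affected :: "'a set \<Rightarrow> ('a \<Rightarrow> 'a \<Rightarrow> bool) \<Rightarrow> ('a \<Rightarrow> 'b::linorder) \<Rightarrow> 'a \<Rightarrow> 'a set" where
  "affected V R \<pi> e = sym_diff (forced V R \<pi> e) (greedy (V - {e}) R \<pi>)"

lemma affected_subset: "finite V \<Longrightarrow> e \<in> V \<Longrightarrow> affected V R \<pi> e \<subseteq> V"
  using greedy_subset[of "V - {e}" R \<pi>] greedy_subset[of "{f \<in> V - {e}. \<not> R e f}" R \<pi>]
  by (auto simp: affected_def forced_def)

lemma greedy_eq_forced:
  assumes "finite V" "inj_on \<pi> V" "symp R" "irreflp R" "e \<in> greedy V R \<pi>"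
  shows "greedy V R \<pi> = forced V R \<pi> e"
proof -
  let ?M = "greedy V R \<pi>" and ?V = "{f \<in> V - {e}. \<not> R e f}"
  have "is_greedy ?V R \<pi> (?M - {e})"
    using greedy_subset[OF assms(1), of R \<pi>] greedy_mem_iff[OF assms(1), of _ R \<pi>]
      greedy_independent[OF assms]
    unfolding is_greedy_def by (auto; blast)
  then have "greedy ?V R \<pi> = ?M - {e}" using assms(1) by (intro greedy_eqI) auto
  then show ?thesis using assms(5) by (auto simp: forced_def)
qed

lemma greedy_remove_nonmember:
  assumes "finite V" "e \<notin> greedy V R \<pi>"
  shows "greedy (V - {e}) R \<pi> = greedy V R \<pi>"
proof (rule greedy_eqI)
  show "is_greedy (V - {e}) R \<pi> (greedy V R \<pi>)"
    using assms(2) is_greedy_greedy[OF assms(1), of R \<pi>] by (auto simp: is_greedy_def)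
qed (use assms(1) in simp)

lemma greedy_member_precedes_affected:
  assumes "finite V" "inj_on \<pi> V" "symp R" "irreflp R"
    and e: "e \<in> greedy V R \<pi>" and f: "f \<in> affected V R \<pi> e"
  shows "\<not> \<pi> f < \<pi> e"
proof
  assume "\<pi> f < \<pi> e"
  then have "f \<in> greedy V R \<pi> \<longleftrightarrow> f \<in> greedy (V - {e}) R \<pi>"
    by (intro is_greedy_agree[OF assms(1) is_greedy_greedy is_greedy_greedy,
          where P = "\<lambda>f. \<pi> f < \<pi> e"]) (use assms(1) in auto)
  then show False
    using f greedy_eq_forced[OF assms(1-4) e] by (auto simp: affected_def)
qed

lemma influence_le_card_affected:
  assumes "finite V" "inj_on \<pi> V" "symp R" "irreflp R"
  shows "influence V R \<pi> e \<le>
    (if {f \<in> affected V R \<pi> e. \<pi> f < \<pi> e} = {} then card (affected V R \<pi> e) else 0)"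
proof (cases "e \<in> greedy V R \<pi>")
  case True
  have "{f \<in> affected V R \<pi> e. \<pi> f < \<pi> e} = {}"
    using greedy_member_precedes_affected[OF assms True] by blast
  moreover have "influence V R \<pi> e = card (affected V R \<pi> e)"
    using greedy_eq_forced[OF assms True] by (simp add: influence_def affected_def)
  ultimately show ?thesis by simp
next
  case False
  then show ?thesis by (simp add: influence_def greedy_remove_nonmember[OF assms(1)])
qed

definition advances :: "'a set \<Rightarrow> 'a set \<Rightarrow> ('a \<Rightarrow> 'b::linorder) \<Rightarrow> ('a \<Rightarrow> 'b) \<Rightarrow> bool" where
  "advances V T \<pi> \<pi>' \<longleftrightarrow>
     (\<forall>f\<in>V. \<pi>' f \<le> \<pi> f) \<and> (\<forall>f\<in>V - T. \<pi>' f = \<pi> f) \<and>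
     (\<forall>f\<in>V \<inter> T. \<forall>g\<in>V \<inter> T. \<pi> f < \<pi> g \<longrightarrow> \<pi>' f < \<pi>' g)"

lemma advances_mono: "advances V T \<pi> \<pi>' \<Longrightarrow> W \<subseteq> V \<Longrightarrow> advances W T \<pi> \<pi>'"
  unfolding advances_def by blast

lemma greedy_advance:
  assumes V: "finite V" "inj_on \<pi> V" and R: "symp R" "irreflp R" and adv: "advances V T \<pi> \<pi>'"
    and closed: "\<And>f g. f \<in> V - greedy V R \<pi> \<Longrightarrow> f \<in> T \<Longrightarrow> g \<in> greedy V R \<pi> \<Longrightarrow> R g f \<Longrightarrow> g \<in> T"
  shows "greedy V R \<pi>' = greedy V R \<pi>"
proof (rule greedy_eqI[OF V(1)])
  let ?M = "greedy V R \<pi>"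
  have sub: "?M \<subseteq> V" by (rule greedy_subset[OF V(1)])
  show "is_greedy V R \<pi>' ?M"
    unfolding is_greedy_def
  proof (intro conjI ballI sub)
    fix e assume e: "e \<in> V"
    show "e \<in> ?M \<longleftrightarrow> \<not> (\<exists>f\<in>?M. R f e \<and> \<pi>' f < \<pi>' e)"
    proof (cases "e \<in> ?M")
      case True
      then show ?thesis using greedy_independent[OF V R] by blast
    next
      case False
      then obtain f where f: "f \<in> ?M" "R f e" "\<pi> f < \<pi> e"
        using greedy_mem_iff[OF V(1) e] by blast
      have "\<pi>' f < \<pi>' e"
      proof (cases "e \<in> T")
        case True
        then have "f \<in> T" using closed e f False by blast
        then show ?thesis using adv True e f sub by (auto simp: advances_def)
      next
        case False
        then have "\<pi>' f \<le> \<pi> f" "\<pi>' e = \<pi> e" using adv e f sub by (auto simp: advances_def)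
        then show ?thesis using f by simp
      qed
      then show ?thesis using f False by blast
    qed
  qed
qed

lemma forced_independent:
  assumes "finite V" "inj_on \<pi> V" "symp R" "irreflp R" "f \<in> forced V R \<pi> e" "g \<in> forced V R \<pi> e"
  shows "\<not> R f g"
proof -
  let ?W = "{f \<in> V - {e}. \<not> R e f}"
  have W: "finite ?W" "inj_on \<pi> ?W" using assms by (auto intro: inj_on_subset)
  have "\<not> R e h \<and> \<not> R h e" if "h \<in> forced V R \<pi> e" for h
    using that greedy_subset[OF W(1), of R \<pi>] assms(3,4)
    by (auto simp: forced_def dest: sympD irreflpD)
  then show ?thesis
    using greedy_independent[OF W assms(3,4)] assms(5,6) unfolding forced_def by blast
qed

text \<open>In each of the two greedy sets that define \<open>affected\<close>, a vertex that blocks an affected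
  vertex is itself affected. Hence affected vertices stay blocked when they all move forward.\<close>

lemma affected_advance:
  assumes V: "finite V" "inj_on \<pi> V" and R: "symp R" "irreflp R"
    and adv: "advances (V - {e}) (affected V R \<pi> e) \<pi> \<pi>'"
  shows "affected V R \<pi>' e = affected V R \<pi> e"
proof -
  let ?T = "affected V R \<pi> e" and ?N = "greedy (V - {e}) R \<pi>" and ?F = "forced V R \<pi> e"
  let ?W = "{f \<in> V - {e}. \<not> R e f}"
  have V': "finite (V - {e})" "inj_on \<pi> (V - {e})" and W: "finite ?W" "inj_on \<pi> ?W"
    using V by (auto intro: inj_on_subset)
  have adv_W: "advances ?W ?T \<pi> \<pi>'" by (rule advances_mono[OF adv]) auto
  have T_iff: "f \<in> ?T \<longleftrightarrow> (f \<in> ?F) \<noteq> (f \<in> ?N)" for f by (auto simp: affected_def)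
  have "greedy (V - {e}) R \<pi>' = ?N"
  proof (rule greedy_advance[OF V' R adv])
    show "g \<in> ?T" if "f \<in> V - {e} - ?N" "f \<in> ?T" "g \<in> ?N" "R g f" for f g
      using that forced_independent[OF V R] T_iff by blast
  qed
  moreover have "greedy ?W R \<pi>' = greedy ?W R \<pi>"
  proof (rule greedy_advance[OF W R adv_W])
    fix f g assume fg: "f \<in> ?W - greedy ?W R \<pi>" "f \<in> ?T" "g \<in> greedy ?W R \<pi>" "R g f"
    have "f \<notin> ?F" "g \<in> ?F" using fg by (auto simp: forced_def)
    then show "g \<in> ?T" using fg greedy_independent[OF V' R] T_iff by blast
  qed
  ultimately show ?thesis by (simp add: affected_def forced_def)
qed

definition successor_in :: "'a set \<Rightarrow> ('a \<Rightarrow> 'b::linorder) \<Rightarrow> 'a \<Rightarrow> 'a \<Rightarrow> bool" where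
  "successor_in X \<pi> e t \<longleftrightarrow> t \<in> X \<and> \<pi> e < \<pi> t \<and> (\<forall>f\<in>X. \<pi> e < \<pi> f \<longrightarrow> \<pi> t \<le> \<pi> f)"

lemma ex_successor_in:
  assumes X: "finite X" "inj_on \<pi> (insert e X)" and rank: "Suc (card {f \<in> X. \<pi> f < \<pi> e}) < card X"
  shows "\<exists>t. successor_in X \<pi> e t"
proof -
  let ?U = "{f \<in> X. \<pi> e < \<pi> f}"
  have "?U \<noteq> {}"
  proof
    assume "?U = {}"
    then have "\<pi> f < \<pi> e \<or> f = e" if "f \<in> X" for f
      using that X(2) by (auto dest: inj_onD simp: not_less_iff_gr_or_eq)
    then have "card X \<le> card (insert e {f \<in> X. \<pi> f < \<pi> e})" using X(1) by (intro card_mono) auto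
    also have "\<dots> \<le> Suc (card {f \<in> X. \<pi> f < \<pi> e})" by (rule card_insert_le_m1) auto
    finally show False using rank by simp
  qed
  then obtain t where "is_arg_min \<pi> (\<lambda>x. x \<in> ?U) t"
    using ex_is_arg_min_if_finite[of ?U \<pi>] X(1) by auto
  then show ?thesis by (intro exI[of _ t]) (auto simp: is_arg_min_def successor_in_def not_less)
qed

lemma affected_swap_successor:
  assumes V: "finite V" "inj_on \<pi> V" and R: "symp R" "irreflp R" and e: "e \<in> V"
    and t: "successor_in (affected V R \<pi> e) \<pi> e t"
  defines "\<pi>' \<equiv> \<pi> \<circ> Transposition.transpose e t"
  shows "affected V R \<pi>' e = affected V R \<pi> e"
    and "{f \<in> affected V R \<pi> e. \<pi>' f < \<pi>' e} = insert t {f \<in> affected V R \<pi> e. \<pi> f < \<pi> e}"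
    and "f \<in> affected V R \<pi> e \<Longrightarrow> \<pi>' f < \<pi>' e \<Longrightarrow> \<pi>' f \<le> \<pi>' t"
proof -
  let ?T = "affected V R \<pi> e"
  have TV: "?T \<subseteq> V" by (rule affected_subset[OF V(1) e])
  have et: "\<pi> e < \<pi> t" and tT: "t \<in> ?T" and first: "\<And>f. f \<in> ?T \<Longrightarrow> \<pi> e < \<pi> f \<Longrightarrow> \<pi> t \<le> \<pi> f"
    using t by (auto simp: successor_in_def)
  have \<pi>': "\<pi>' e = \<pi> t" "\<pi>' t = \<pi> e" "\<And>f. f \<noteq> e \<Longrightarrow> f \<noteq> t \<Longrightarrow> \<pi>' f = \<pi> f"
    by (auto simp: \<pi>'_def)
  have between: "\<pi> f < \<pi> e \<or> \<pi> t < \<pi> f" if "f \<in> ?T" "f \<noteq> e" "f \<noteq> t" for f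
  proof -
    have "\<pi> f \<noteq> \<pi> e" "\<pi> f \<noteq> \<pi> t" using that V(2) TV e tT by (auto dest: inj_onD)
    then show ?thesis using first[OF that(1)] by force
  qed
  have "advances (V - {e}) ?T \<pi> \<pi>'"
    unfolding advances_def
  proof (intro conjI ballI impI)
    show "\<pi>' f \<le> \<pi> f" if "f \<in> V - {e}" for f using that \<pi>' et by (cases "f = t") auto
    show "\<pi>' f = \<pi> f" if "f \<in> V - {e} - ?T" for f using that \<pi>'(3) tT by blast
    show "\<pi>' f < \<pi>' g" if "f \<in> (V - {e}) \<inter> ?T" "g \<in> (V - {e}) \<inter> ?T" "\<pi> f < \<pi> g" for f g
      using that \<pi>' et between[of f] between[of g] by (cases "f = t"; cases "g = t") auto
  qed
  then show "affected V R \<pi>' e = ?T" by (rule affected_advance[OF V R])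
  have before: "\<pi>' f < \<pi>' e \<longleftrightarrow> f = t \<or> \<pi> f < \<pi> e" if "f \<in> ?T" for f
    using that \<pi>' et between[of f] by (cases "f = e"; cases "f = t") auto
  then show "{f \<in> ?T. \<pi>' f < \<pi>' e} = insert t {f \<in> ?T. \<pi> f < \<pi> e}" using tT by auto
  show "\<pi>' f \<le> \<pi>' t" if "f \<in> ?T" "\<pi>' f < \<pi>' e"
    using that before[of f] \<pi>' et by (cases "f = e"; cases "f = t") auto
qed

definition orders_with_rank ::
    "'a set \<Rightarrow> ('a \<Rightarrow> 'a \<Rightarrow> bool) \<Rightarrow> ('a \<Rightarrow> 'b::linorder) \<Rightarrow> 'a \<Rightarrow> 'a set \<Rightarrow> nat \<Rightarrow> ('a \<Rightarrow> 'a) set" where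
  "orders_with_rank V R \<pi> e X i = {\<sigma>. \<sigma> permutes V \<and> affected V R (\<pi> \<circ> \<sigma>) e = X \<and>
     card {f \<in> X. (\<pi> \<circ> \<sigma>) f < (\<pi> \<circ> \<sigma>) e} = i}"

lemma finite_orders_with_rank: "finite V \<Longrightarrow> finite (orders_with_rank V R \<pi> e X i)"
  unfolding orders_with_rank_def
  by (rule finite_subset[OF _ finite_permutations]) auto

lemma inj_on_comp_permutes: "inj_on \<pi> V \<Longrightarrow> \<sigma> permutes V \<Longrightarrow> inj_on (\<pi> \<circ> \<sigma>) V"
  by (simp add: comp_inj_on permutes_image permutes_inj_on)

lemma orders_with_rank_swap_successor:
  assumes V: "finite V" "inj_on \<pi> V" and R: "symp R" "irreflp R" and e: "e \<in> V" and X: "X \<subseteq> V"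
    and \<sigma>: "\<sigma> \<in> orders_with_rank V R \<pi> e X i" and t: "successor_in X (\<pi> \<circ> \<sigma>) e t"
  defines "\<rho> \<equiv> \<sigma> \<circ> Transposition.transpose e t"
  shows "\<rho> \<in> orders_with_rank V R \<pi> e X (Suc i)"
    and "(\<pi> \<circ> \<rho>) t < (\<pi> \<circ> \<rho>) e"
    and "f \<in> X \<Longrightarrow> (\<pi> \<circ> \<rho>) f < (\<pi> \<circ> \<rho>) e \<Longrightarrow> (\<pi> \<circ> \<rho>) f \<le> (\<pi> \<circ> \<rho>) t"
proof -
  have perm: "\<sigma> permutes V" and aff: "affected V R (\<pi> \<circ> \<sigma>) e = X"
    and rank: "card {f \<in> X. (\<pi> \<circ> \<sigma>) f < (\<pi> \<circ> \<sigma>) e} = i"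
    using \<sigma> by (auto simp: orders_with_rank_def)
  have \<rho>_eq: "\<pi> \<circ> \<rho> = (\<pi> \<circ> \<sigma>) \<circ> Transposition.transpose e t" by (simp add: \<rho>_def comp_assoc)
  note swap = affected_swap_successor[OF V(1) inj_on_comp_permutes[OF V(2) perm] R e,
      unfolded aff, OF t, folded \<rho>_eq]
  have tX: "t \<in> X" and "t \<notin> {f \<in> X. (\<pi> \<circ> \<sigma>) f < (\<pi> \<circ> \<sigma>) e}"
    using t by (auto simp: successor_in_def)
  moreover have "finite X" using X V(1) by (rule finite_subset)
  ultimately have "card {f \<in> X. (\<pi> \<circ> \<rho>) f < (\<pi> \<circ> \<rho>) e} = Suc i"
    using swap(2) rank by simp
  moreover have "\<rho> permutes V"
    unfolding \<rho>_def using tX X e perm by (intro permutes_compose permutes_swap_id) auto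
  ultimately show "\<rho> \<in> orders_with_rank V R \<pi> e X (Suc i)"
    using swap(1) by (simp add: orders_with_rank_def)
  show "(\<pi> \<circ> \<rho>) t < (\<pi> \<circ> \<rho>) e" using swap(2) tX by blast
  show "f \<in> X \<Longrightarrow> (\<pi> \<circ> \<rho>) f < (\<pi> \<circ> \<rho>) e \<Longrightarrow> (\<pi> \<circ> \<rho>) f \<le> (\<pi> \<circ> \<rho>) t" by (rule swap(3))
qed

text \<open>Swapping \<open>e\<close> with its successor in \<open>X\<close> is injective, because afterwards that vertex is
  the predecessor of \<open>e\<close> in \<open>X\<close>.\<close>

lemma card_orders_with_rank_Suc:
  assumes V: "finite V" "inj_on \<pi> V" and R: "symp R" "irreflp R" and e: "e \<in> V"
    and X: "X \<subseteq> V" and i: "Suc i < card X"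
  shows "card (orders_with_rank V R \<pi> e X i) \<le> card (orders_with_rank V R \<pi> e X (Suc i))"
proof -
  define succ where "succ \<sigma> = (SOME t. successor_in X (\<pi> \<circ> \<sigma>) e t)" for \<sigma>
  define swap where "swap \<sigma> = \<sigma> \<circ> Transposition.transpose e (succ \<sigma>)" for \<sigma>
  have finX: "finite X" using X V(1) by (rule finite_subset)
  have succ: "successor_in X (\<pi> \<circ> \<sigma>) e (succ \<sigma>)" if "\<sigma> \<in> orders_with_rank V R \<pi> e X i" for \<sigma>
    unfolding succ_def
  proof (rule someI_ex, rule ex_successor_in[OF finX])
    show "inj_on (\<pi> \<circ> \<sigma>) (insert e X)"
      by (rule inj_on_subset[OF inj_on_comp_permutes[OF V(2)]])
        (use that e X in \<open>auto simp: orders_with_rank_def\<close>)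
    show "Suc (card {f \<in> X. (\<pi> \<circ> \<sigma>) f < (\<pi> \<circ> \<sigma>) e}) < card X"
      using that i by (simp add: orders_with_rank_def)
  qed
  note swap = orders_with_rank_swap_successor[OF V R e X _ succ, folded swap_def]
  have "inj_on swap (orders_with_rank V R \<pi> e X i)"
  proof (rule inj_onI)
    fix \<sigma> \<rho> assume mem: "\<sigma> \<in> orders_with_rank V R \<pi> e X i" "\<rho> \<in> orders_with_rank V R \<pi> e X i"
      and eq: "swap \<sigma> = swap \<rho>"
    have in_X: "succ \<sigma> \<in> X" "succ \<rho> \<in> X" using mem succ by (auto simp: successor_in_def)
    have "(\<pi> \<circ> swap \<sigma>) (succ \<sigma>) = (\<pi> \<circ> swap \<sigma>) (succ \<rho>)"
      using swap(2,3)[OF mem(1) mem(1)] swap(2,3)[OF mem(2) mem(2)] in_X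
      unfolding eq by (meson order_antisym)
    moreover have "inj_on (\<pi> \<circ> swap \<sigma>) V"
      using inj_on_comp_permutes[OF V(2)] swap(1)[OF mem(1) mem(1)]
      by (auto simp: orders_with_rank_def)
    ultimately have same: "succ \<sigma> = succ \<rho>" using in_X X by (meson inj_onD subsetD)
    have "\<sigma> = swap \<sigma> \<circ> Transposition.transpose e (succ \<sigma>)" by (simp add: swap_def comp_assoc)
    also have "\<dots> = \<rho>" unfolding eq same by (simp add: swap_def comp_assoc)
    finally show "\<sigma> = \<rho>" .
  qed
  then show ?thesis
    by (rule card_inj_on_le) (use swap(1) finite_orders_with_rank[OF V(1)] in auto)
qed

lemma card_orders_with_rank_0:
  assumes V: "finite V" "inj_on \<pi> V" and R: "symp R" "irreflp R" and e: "e \<in> V" and X: "X \<subseteq> V"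
  shows "card X * card (orders_with_rank V R \<pi> e X 0) \<le>
    card {\<sigma>. \<sigma> permutes V \<and> affected V R (\<pi> \<circ> \<sigma>) e = X}"
proof -
  let ?A = "orders_with_rank V R \<pi> e X"
  have "card (?A 0) \<le> card (?A i)" if "i < card X" for i
    using that
  proof (induction i)
    case (Suc i)
    then show ?case using card_orders_with_rank_Suc[OF V R e X Suc.prems] by simp
  qed simp
  then have "card X * card (?A 0) \<le> (\<Sum>i<card X. card (?A i))"
    using sum_mono[of "{..<card X}" "\<lambda>_. card (?A 0)" "\<lambda>i. card (?A i)"] by simp
  also have "\<dots> = card (\<Union>i<card X. ?A i)"
    by (rule card_UN_disjoint[symmetric])
      (use finite_orders_with_rank[OF V(1)] in \<open>auto simp: orders_with_rank_def\<close>)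
  also have "\<dots> \<le> card {\<sigma>. \<sigma> permutes V \<and> affected V R (\<pi> \<circ> \<sigma>) e = X}"
    by (rule card_mono)
      (use finite_permutations[OF V(1)] in
        \<open>auto simp: orders_with_rank_def intro: rev_finite_subset\<close>)
  finally show ?thesis .
qed

text \<open>\<open>e\<close> matters only if it precedes all affected vertices, and among the orders with a given
  affected set the rank of \<open>e\<close> in that set is at least as likely to be \<open>i + 1\<close> as \<open>i\<close>.\<close>

lemma sum_influence_permutations_le:
  assumes V: "finite V" "inj_on \<pi> V" and R: "symp R" "irreflp R" and e: "e \<in> V"
  shows "(\<Sum>\<sigma> | \<sigma> permutes V. influence V R (\<pi> \<circ> \<sigma>) e) \<le> fact (card V)"
proof -
  let ?aff = "\<lambda>\<sigma>. affected V R (\<pi> \<circ> \<sigma>) e"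
  let ?first = "\<lambda>\<sigma>. {f \<in> ?aff \<sigma>. (\<pi> \<circ> \<sigma>) f < (\<pi> \<circ> \<sigma>) e} = {}"
  let ?S = "\<lambda>X. {\<sigma>. \<sigma> permutes V \<and> ?aff \<sigma> = X}"
  have fin: "finite {\<sigma>. \<sigma> permutes V}" by (rule finite_permutations[OF V(1)])
  have aff_V: "?aff \<sigma> \<subseteq> V" for \<sigma> by (rule affected_subset[OF V(1) e])
  have class_sum: "(\<Sum>\<sigma>\<in>?S X. if ?first \<sigma> then card (?aff \<sigma>) else 0) \<le> card (?S X)"
    if "X \<subseteq> V" for X
  proof -
    let ?first_in_X = "\<lambda>\<sigma>. {f \<in> X. (\<pi> \<circ> \<sigma>) f < (\<pi> \<circ> \<sigma>) e} = {}"
    have "finite (?S X)" by (rule finite_subset[OF _ fin]) auto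
    then have "(\<Sum>\<sigma>\<in>?S X. if ?first_in_X \<sigma> then card X else 0) =
        card X * card {\<sigma> \<in> ?S X. ?first_in_X \<sigma>}"
      by (simp flip: sum.inter_filter)
    moreover have "(\<Sum>\<sigma>\<in>?S X. if ?first \<sigma> then card (?aff \<sigma>) else 0) =
        (\<Sum>\<sigma>\<in>?S X. if ?first_in_X \<sigma> then card X else 0)"
      by (intro sum.cong) auto
    moreover have "orders_with_rank V R \<pi> e X 0 = {\<sigma> \<in> ?S X. ?first_in_X \<sigma>}"
      using finite_subset[OF that V(1)] by (auto simp: orders_with_rank_def)
    ultimately have "(\<Sum>\<sigma>\<in>?S X. if ?first \<sigma> then card (?aff \<sigma>) else 0) =
        card X * card (orders_with_rank V R \<pi> e X 0)"
      by simp
    then show ?thesis using card_orders_with_rank_0[OF V R e that] by simp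
  qed
  have "(\<Sum>\<sigma> | \<sigma> permutes V. influence V R (\<pi> \<circ> \<sigma>) e) \<le>
      (\<Sum>\<sigma> | \<sigma> permutes V. if ?first \<sigma> then card (?aff \<sigma>) else 0)"
    by (intro sum_mono influence_le_card_affected inj_on_comp_permutes V R) auto
  also have "\<dots> = (\<Sum>X\<in>Pow V. \<Sum>\<sigma>\<in>?S X. if ?first \<sigma> then card (?aff \<sigma>) else 0)"
    using aff_V V(1) fin by (subst sum.group[symmetric, where g = ?aff and T = "Pow V"]) auto
  also have "\<dots> \<le> (\<Sum>X\<in>Pow V. card (?S X))" by (intro sum_mono class_sum) auto
  also have "\<dots> = (\<Sum>X\<in>Pow V. \<Sum>\<sigma>\<in>?S X. 1)" by simp
  also have "\<dots> = card {\<sigma>. \<sigma> permutes V}"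
    using aff_V V(1) fin sum.group[of "{\<sigma>. \<sigma> permutes V}" "Pow V" ?aff "\<lambda>_. 1 :: nat"] by auto
  also have "\<dots> = fact (card V)" by (rule card_permutations[OF refl V(1)])
  finally show ?thesis .
qed

section \<open>The random tape\<close>

abbreviation unif :: "real measure" where
  "unif \<equiv> uniform_measure lborel {0..1}"

lemma prob_space_unif: "prob_space unif"
  by (rule prob_space_uniform_measure) auto

interpretation unif: prob_space unif
  by (rule prob_space_unif)

interpretation tape: prob_space tape
  unfolding tape_def by (rule prob_space_PiM) (rule prob_space_unif)

lemma space_tape [simp]: "space tape = UNIV"
  by (simp add: tape_def space_PiM)

lemma measurable_tape_component: "(\<lambda>\<omega>. \<omega> i) \<in> borel_measurable tape"
proof -
  have "(\<lambda>\<omega>. \<omega> i) \<in> measurable (\<Pi>\<^sub>M i\<in>UNIV. unif) unif"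
    by (rule measurable_component_singleton) simp
  then show ?thesis by (simp add: tape_def cong: measurable_cong_sets)
qed

lemma measurable_tape_compose: "f \<in> measurable borel N \<Longrightarrow> (\<lambda>\<omega>. f (\<omega> i)) \<in> measurable tape N"
  by (rule measurable_compose[OF measurable_tape_component])

lemma distr_tape_component: "distr tape borel (\<lambda>\<omega>. \<omega> i) = unif"
proof -
  have "distr tape borel (\<lambda>\<omega>. \<omega> i) = distr (\<Pi>\<^sub>M i\<in>UNIV. unif) unif (\<lambda>\<omega>. \<omega> i)"
    unfolding tape_def by (rule distr_cong) auto
  also have "\<dots> = unif" by (rule distr_PiM_component) (auto intro: prob_space_unif)
  finally show ?thesis .
qed

lemma nn_integral_tape_component:
  assumes "f \<in> borel_measurable borel"
  shows "(\<integral>\<^sup>+\<omega>. f (\<omega> i) \<partial>tape) = (\<integral>\<^sup>+u. f u \<partial>unif)"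
  by (simp add: assms measurable_tape_component nn_integral_distr flip: distr_tape_component[of i])

lemma nn_integral_unif:
  "f \<in> borel_measurable borel \<Longrightarrow> (\<integral>\<^sup>+u. f u \<partial>unif) = (\<integral>\<^sup>+u. f u * indicator {0..1} u \<partial>lborel)"
  by (subst nn_integral_uniform_measure) (auto simp: divide_ennreal_def)

lemma AE_unif_mem: "AE u in unif. u \<in> {0..1}"
  by (rule AE_uniform_measureI) (simp, rule AE_I2, simp)

lemma AE_unif_neq: "AE u in unif. u \<noteq> x"
  using AE_lborel_singleton[of x] by (auto intro!: AE_uniform_measureI)

lemma AE_tape_mem: "AE \<omega> in tape. \<omega> i \<in> {0..1}"
  unfolding tape_def
  by (rule AE_PiM_component[where P = "\<lambda>u. u \<in> {0..1}"])
    (rule prob_space_unif, simp, rule AE_unif_mem)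

lemma indep_vars_tape: "tape.indep_vars (\<lambda>_. unif) (\<lambda>i \<omega>. \<omega> i) UNIV"
proof (subst tape.indep_vars_iff_distr_eq_PiM)
  show "tape.random_variable unif (\<lambda>\<omega>. \<omega> i)" for i
    using measurable_tape_component by (simp cong: measurable_cong_sets)
  have "distr tape unif (\<lambda>\<omega>. \<omega> i) = unif" for i
    using distr_tape_component[of i] by (simp cong: distr_cong)
  then show "distr tape (\<Pi>\<^sub>M i\<in>UNIV. unif) (\<lambda>\<omega>. \<lambda>i\<in>UNIV. \<omega> i) =
      (\<Pi>\<^sub>M i\<in>UNIV. distr tape unif (\<lambda>\<omega>. \<omega> i))"
    by (simp add: tape_def restrict_UNIV)
qed simp

lemma AE_tape_neq:
  assumes "i \<noteq> j"
  shows "AE \<omega> in tape. \<omega> i \<noteq> \<omega> j"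
proof -
  have "tape.indep_var (\<Pi>\<^sub>M k\<in>{i}. unif) (\<lambda>\<omega>. restrict \<omega> {i})
      (\<Pi>\<^sub>M k\<in>{j}. unif) (\<lambda>\<omega>. restrict \<omega> {j})"
    using assms by (intro tape.indep_var_restrict[OF indep_vars_tape]) auto
  then have "tape.indep_var unif ((\<lambda>x. x i) \<circ> (\<lambda>\<omega>. restrict \<omega> {i}))
      unif ((\<lambda>x. x j) \<circ> (\<lambda>\<omega>. restrict \<omega> {j}))"
    by (rule tape.indep_var_compose) (auto intro: measurable_component_singleton)
  then have "distr tape (unif \<Otimes>\<^sub>M unif) (\<lambda>\<omega>. (\<omega> i, \<omega> j)) =
      distr tape unif (\<lambda>\<omega>. \<omega> i) \<Otimes>\<^sub>M distr tape unif (\<lambda>\<omega>. \<omega> j)"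
    unfolding tape.indep_var_distribution_eq by (simp add: comp_def)
  also have "\<dots> = unif \<Otimes>\<^sub>M unif"
    using distr_tape_component by (simp cong: distr_cong)
  finally have joint: "distr tape (unif \<Otimes>\<^sub>M unif) (\<lambda>\<omega>. (\<omega> i, \<omega> j)) = unif \<Otimes>\<^sub>M unif" .
  interpret pair_sigma_finite unif unif ..
  have "AE z in unif \<Otimes>\<^sub>M unif. fst z \<noteq> snd z"
  proof (rule AE_pair_measure)
    show "{z \<in> space (unif \<Otimes>\<^sub>M unif). fst z \<noteq> snd z} \<in> sets (unif \<Otimes>\<^sub>M unif)"
      by measurable
    show "AE x in unif. AE y in unif. fst (x, y) \<noteq> snd (x, y)"
      using AE_unif_neq by (simp add: eq_commute)
  qed
  then have "AE z in distr tape (unif \<Otimes>\<^sub>M unif) (\<lambda>\<omega>. (\<omega> i, \<omega> j)). fst z \<noteq> snd z"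
    unfolding joint .
  moreover have "(\<lambda>\<omega>. (\<omega> i, \<omega> j)) \<in> measurable tape (unif \<Otimes>\<^sub>M unif)"
    using measurable_Pair[OF measurable_tape_component measurable_tape_component, of i j]
    by (simp cong: measurable_cong_sets)
  ultimately show ?thesis by (auto dest: AE_distrD)
qed

lemma distr_tape_reindex:
  assumes "inj f"
  shows "distr tape tape (\<lambda>\<omega>. \<omega> \<circ> f) = tape"
proof -
  have "distr (\<Pi>\<^sub>M i\<in>UNIV. unif) (\<Pi>\<^sub>M i\<in>UNIV. unif) (\<lambda>\<omega>. \<lambda>n\<in>UNIV. \<omega> (f n)) = (\<Pi>\<^sub>M i\<in>UNIV. unif)"
    using assms by (intro distr_PiM_reindex) (auto intro: prob_space_unif)
  then show ?thesis by (simp add: tape_def restrict_UNIV comp_def)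
qed

lemma measurable_tape_reindex: "(\<lambda>\<omega>. \<omega> \<circ> f) \<in> measurable tape tape"
proof -
  have "(\<lambda>\<omega>. \<lambda>n\<in>UNIV. \<omega> (f n)) \<in> measurable (\<Pi>\<^sub>M i\<in>UNIV. unif) (\<Pi>\<^sub>M i\<in>UNIV. unif)"
    by (rule measurable_restrict) (rule measurable_component_singleton, simp)
  then show ?thesis by (simp add: tape_def restrict_UNIV comp_def)
qed

lemma nn_integral_tape_reindex:
  assumes "inj f" "F \<in> borel_measurable tape"
  shows "(\<integral>\<^sup>+\<omega>. F (\<omega> \<circ> f) \<partial>tape) = (\<integral>\<^sup>+\<omega>. F \<omega> \<partial>tape)"
  using nn_integral_distr[OF measurable_tape_reindex[of f], of F] assms
  by (simp add: distr_tape_reindex)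

section \<open>Expected influence in random order\<close>

text \<open>Entry \<open>0\<close> of the tape is reserved for the thresholds of the weight classes.\<close>

definition key :: "('a \<Rightarrow> nat) \<Rightarrow> (nat \<Rightarrow> real) \<Rightarrow> 'a \<Rightarrow> real" where
  "key idx \<omega> e = \<omega> (Suc (idx e))"

lemma AE_inj_on_key:
  assumes "finite V" "inj_on idx V"
  shows "AE \<omega> in tape. inj_on (key idx \<omega>) V"
proof -
  have "AE \<omega> in tape. \<forall>x\<in>V. \<forall>y\<in>V. x \<noteq> y \<longrightarrow> key idx \<omega> x \<noteq> key idx \<omega> y"
    unfolding key_def using assms
    by (intro AE_finite_allI AE_impI AE_tape_neq) (auto dest: inj_onD)
  then show ?thesis by (rule AE_mp) (auto simp: inj_on_def)
qed

lemma ex_reindex_key_permutation: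
  assumes idx: "inj_on idx V" and \<sigma>: "\<sigma> permutes V"
  shows "\<exists>\<tau>. inj \<tau> \<and> \<tau> 0 = 0 \<and> (\<forall>\<omega>. \<forall>e\<in>V. key idx (\<omega> \<circ> \<tau>) e = key idx \<omega> (\<sigma> e))"
proof -
  define \<tau> where "\<tau> = map_permutation V (Suc \<circ> idx) \<sigma>"
  have inj: "inj_on (Suc \<circ> idx) V" using idx by (simp add: comp_inj_on)
  have perm: "\<tau> permutes (Suc \<circ> idx) ` V"
    unfolding \<tau>_def by (rule map_permutation_permutes[OF inj_on_imp_bij_betw[OF inj] \<sigma>])
  have "\<tau> (Suc (idx e)) = Suc (idx (\<sigma> e))" if "e \<in> V" for e
    unfolding \<tau>_def using map_permutation_apply[OF inj that, of \<sigma>] by simp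
  moreover have "\<tau> 0 = 0" by (rule permutes_not_in[OF perm]) auto
  ultimately show ?thesis using permutes_inj[OF perm] by (auto simp: key_def)
qed

lemma
  fixes \<Phi> :: "real \<Rightarrow> ('a \<Rightarrow> real) \<Rightarrow> ennreal"
  assumes idx: "inj_on idx V" and \<sigma>: "\<sigma> permutes V"
    and local: "\<And>u \<pi> \<pi>'. (\<And>e. e \<in> V \<Longrightarrow> \<pi> e = \<pi>' e) \<Longrightarrow> \<Phi> u \<pi> = \<Phi> u \<pi>'"
    and meas: "(\<lambda>\<omega>. \<Phi> (\<omega> 0) (key idx \<omega>)) \<in> borel_measurable tape"
  shows measurable_permuted_key: "(\<lambda>\<omega>. \<Phi> (\<omega> 0) (key idx \<omega> \<circ> \<sigma>)) \<in> borel_measurable tape"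
    and nn_integral_permuted_key:
      "(\<integral>\<^sup>+\<omega>. \<Phi> (\<omega> 0) (key idx \<omega> \<circ> \<sigma>) \<partial>tape) = (\<integral>\<^sup>+\<omega>. \<Phi> (\<omega> 0) (key idx \<omega>) \<partial>tape)"
proof -
  obtain \<tau> where \<tau>: "inj \<tau>" "\<tau> 0 = 0" "\<And>\<omega> e. e \<in> V \<Longrightarrow> key idx (\<omega> \<circ> \<tau>) e = key idx \<omega> (\<sigma> e)"
    using ex_reindex_key_permutation[OF idx \<sigma>] by blast
  have eq: "\<Phi> (\<omega> 0) (key idx \<omega> \<circ> \<sigma>) = \<Phi> ((\<omega> \<circ> \<tau>) 0) (key idx (\<omega> \<circ> \<tau>))" for \<omega>
    using local[of "key idx \<omega> \<circ> \<sigma>" "key idx (\<omega> \<circ> \<tau>)"] \<tau>(2,3) by simp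
  show "(\<lambda>\<omega>. \<Phi> (\<omega> 0) (key idx \<omega> \<circ> \<sigma>)) \<in> borel_measurable tape"
    unfolding eq by (rule measurable_compose[OF measurable_tape_reindex meas])
  show "(\<integral>\<^sup>+\<omega>. \<Phi> (\<omega> 0) (key idx \<omega> \<circ> \<sigma>) \<partial>tape) = (\<integral>\<^sup>+\<omega>. \<Phi> (\<omega> 0) (key idx \<omega>) \<partial>tape)"
    unfolding eq by (rule nn_integral_tape_reindex[OF \<tau>(1) meas])
qed

lemma influence_cong:
  assumes "finite V" "\<And>e f. e \<in> V \<Longrightarrow> f \<in> V \<Longrightarrow> R e f \<longleftrightarrow> R' e f"
    and "\<And>e f. e \<in> V \<Longrightarrow> f \<in> V \<Longrightarrow> \<pi> e < \<pi> f \<longleftrightarrow> \<pi>' e < \<pi>' f"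
  shows "influence V R \<pi> e = influence V R' \<pi>' e"
proof -
  have "greedy W R \<pi> = greedy W R' \<pi>'" if "W \<subseteq> V" for W
    by (rule greedy_cong) (use that assms in \<open>blast intro: finite_subset\<close>)+
  from this[of V] this[of "V - {e}"] show ?thesis by (simp add: influence_def)
qed

lemma expected_influence_le:
  fixes R :: "real \<Rightarrow> 'a \<Rightarrow> 'a \<Rightarrow> bool" and h :: "real \<Rightarrow> ennreal"
  assumes V: "finite V" "inj_on idx V" and e: "e \<in> V"
    and R: "\<And>u. symp (R u)" "\<And>u. irreflp (R u)" and h: "h \<in> borel_measurable borel"
    and meas: "(\<lambda>\<omega>. influence V (R (\<omega> 0)) (key idx \<omega>) e) \<in> measurable tape (count_space UNIV)"
  shows "(\<integral>\<^sup>+\<omega>. h (\<omega> 0) * of_nat (influence V (R (\<omega> 0)) (key idx \<omega>) e) \<partial>tape) \<le>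
    (\<integral>\<^sup>+\<omega>. h (\<omega> 0) \<partial>tape)"
    (is "?I \<le> _")
proof -
  define \<Phi> where "\<Phi> u \<pi> = h u * of_nat (influence V (R u) \<pi> e)" for u and \<pi> :: "'a \<Rightarrow> real"
  let ?Perm = "{\<sigma>. \<sigma> permutes V}"
  have mh: "(\<lambda>\<omega>. h (\<omega> 0)) \<in> borel_measurable tape" by (rule measurable_tape_compose[OF h])
  have local: "\<Phi> u \<pi> = \<Phi> u \<pi>'" if "\<And>e. e \<in> V \<Longrightarrow> \<pi> e = \<pi>' e" for u \<pi> \<pi>'
    using influence_cong[OF V(1), of "R u" "R u" \<pi> \<pi>' e] that by (simp add: \<Phi>_def)
  have "(\<lambda>\<omega>. of_nat (influence V (R (\<omega> 0)) (key idx \<omega>) e)) \<in> borel_measurable tape"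
    by (rule measurable_compose[OF meas]) simp
  then have m\<Phi>: "(\<lambda>\<omega>. \<Phi> (\<omega> 0) (key idx \<omega>)) \<in> borel_measurable tape"
    unfolding \<Phi>_def by (rule borel_measurable_times_ennreal[OF mh])
  note exchange = measurable_permuted_key[OF V(2) _ local m\<Phi>]
      nn_integral_permuted_key[OF V(2) _ local m\<Phi>]
  have "of_nat (fact (card V)) * ?I = (\<Sum>\<sigma>\<in>?Perm. \<integral>\<^sup>+\<omega>. \<Phi> (\<omega> 0) (key idx \<omega>) \<partial>tape)"
    using card_permutations[OF refl V(1)] by (simp add: \<Phi>_def)
  also have "\<dots> = (\<Sum>\<sigma>\<in>?Perm. \<integral>\<^sup>+\<omega>. \<Phi> (\<omega> 0) (key idx \<omega> \<circ> \<sigma>) \<partial>tape)"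
    by (intro sum.cong refl exchange(2)[symmetric]) auto
  also have "\<dots> = (\<integral>\<^sup>+\<omega>. (\<Sum>\<sigma>\<in>?Perm. \<Phi> (\<omega> 0) (key idx \<omega> \<circ> \<sigma>)) \<partial>tape)"
    by (intro nn_integral_sum[symmetric] exchange(1)) auto
  also have "\<dots> \<le> (\<integral>\<^sup>+\<omega>. of_nat (fact (card V)) * h (\<omega> 0) \<partial>tape)"
  proof (rule nn_integral_mono_AE, use AE_inj_on_key[OF V] in eventually_elim)
    case (elim \<omega>)
    have "(\<Sum>\<sigma>\<in>?Perm. \<Phi> (\<omega> 0) (key idx \<omega> \<circ> \<sigma>)) =
        h (\<omega> 0) * of_nat (\<Sum>\<sigma>\<in>?Perm. influence V (R (\<omega> 0)) (key idx \<omega> \<circ> \<sigma>) e)"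
      by (simp add: \<Phi>_def sum_distrib_left)
    also have "\<dots> \<le> h (\<omega> 0) * of_nat (fact (card V))"
      by (intro mult_left_mono of_nat_mono sum_influence_permutations_le V e elim R) simp
    finally show ?case by (simp add: mult.commute)
  qed
  also have "\<dots> = of_nat (fact (card V)) * (\<integral>\<^sup>+\<omega>. h (\<omega> 0) \<partial>tape)"
    by (rule nn_integral_cmult[OF mh])
  finally show ?thesis by (simp add: ennreal_mult_le_mult_iff)
qed

section \<open>Measurability of functions of the processing order\<close>

lemma measurable_factor:
  assumes X: "X \<in> measurable M (count_space A)" and Y: "\<And>x y. X x = X y \<Longrightarrow> Y x = Y y"
  shows "Y \<in> measurable M (count_space UNIV)"
proof -
  have "Y (inv X (X x)) = Y x" for x by (rule Y) (simp add: f_inv_into_f)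
  moreover have "(\<lambda>x. Y (inv X (X x))) \<in> measurable M (count_space UNIV)"
    by (rule measurable_compose[OF X]) simp
  ultimately show ?thesis by simp
qed

lemma measurable_order_and_labels:
  fixes \<delta> :: "real \<Rightarrow> 'a \<Rightarrow> 'b::countable"
  assumes V: "finite V" and \<delta>: "\<And>v. v \<in> V \<Longrightarrow> (\<lambda>u. \<delta> u v) \<in> measurable borel (count_space UNIV)"
    and \<Phi>: "\<And>\<pi> \<pi>' d d'. (\<And>x y. x \<in> V \<Longrightarrow> y \<in> V \<Longrightarrow> \<pi> x < \<pi> y \<longleftrightarrow> \<pi>' x < \<pi>' y) \<Longrightarrow>
      (\<And>v. v \<in> V \<Longrightarrow> d v = d' v) \<Longrightarrow> \<Phi> \<pi> d = \<Phi> \<pi>' d'"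
  shows "(\<lambda>\<omega>. \<Phi> (key idx \<omega>) (\<delta> (\<omega> 0))) \<in> measurable tape (count_space UNIV)"
proof -
  let ?A = "Pow (V \<times> V) \<times> (V \<rightarrow>\<^sub>E (UNIV :: 'b set))"
  define X where "X \<omega> = ({(x, y) \<in> V \<times> V. key idx \<omega> x < key idx \<omega> y}, restrict (\<delta> (\<omega> 0)) V)" for \<omega>
  have "countable ?A"
    using V
    by (intro countable_SIGMA countable_PiE countableI_type) (simp_all add: countable_finite)
  moreover have "X -` {(r, d)} \<inter> space tape \<in> sets tape" if "(r, d) \<in> ?A" for r d
  proof -
    have "{(x, y) \<in> V \<times> V. \<pi> x < \<pi> y} = r \<longleftrightarrow>
        (\<forall>x\<in>V. \<forall>y\<in>V. \<pi> x < \<pi> y \<longleftrightarrow> (x, y) \<in> r)" for \<pi> :: "'a \<Rightarrow> real"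
      using that by (fastforce simp: set_eq_iff)
    moreover have "restrict g V = d \<longleftrightarrow> (\<forall>v\<in>V. g v = d v)" for g
      using that by (auto simp: PiE_def intro: extensionalityI)
    ultimately have "X -` {(r, d)} \<inter> space tape = {\<omega> \<in> space tape.
        (\<forall>x\<in>V. \<forall>y\<in>V. \<omega> (Suc (idx x)) < \<omega> (Suc (idx y)) \<longleftrightarrow> (x, y) \<in> r) \<and> (\<forall>v\<in>V. \<delta> (\<omega> 0) v = d v)}"
      by (auto simp: X_def key_def)
    also have "\<dots> \<in> sets tape"
      using V measurable_tape_component[measurable] measurable_tape_compose[OF \<delta>, measurable]
      by measurable
    finally show ?thesis .
  qed
  ultimately have "X \<in> measurable tape (count_space ?A)"
    by (subst measurable_count_space_eq_countable) (auto simp: X_def)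
  then show ?thesis
  proof (rule measurable_factor)
    fix \<omega> \<omega>' assume eq: "X \<omega> = X \<omega>'"
    show "\<Phi> (key idx \<omega>) (\<delta> (\<omega> 0)) = \<Phi> (key idx \<omega>') (\<delta> (\<omega>' 0))"
    proof (rule \<Phi>)
      show "key idx \<omega> x < key idx \<omega> y \<longleftrightarrow> key idx \<omega>' x < key idx \<omega>' y" if "x \<in> V" "y \<in> V" for x y
        using arg_cong[OF eq, of "\<lambda>z. (x, y) \<in> fst z"] that by (simp add: X_def)
      show "\<delta> (\<omega> 0) v = \<delta> (\<omega>' 0) v" if "v \<in> V" for v
        using arg_cong[OF eq, of "\<lambda>z. snd z v"] that by (simp add: X_def)
    qed
  qed
qed

section \<open>Greedy matchings by weight class\<close>

definition conflict :: "('a set \<Rightarrow> nat) \<Rightarrow> 'a set \<Rightarrow> 'a set \<Rightarrow> bool" where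
  "conflict d e f \<longleftrightarrow> e \<noteq> f \<and> e \<inter> f \<noteq> {} \<and> d e = d f"

definition undominated :: "('a set \<Rightarrow> nat) \<Rightarrow> 'a set set \<Rightarrow> 'a set set" where
  "undominated d M = {e \<in> M. \<forall>f\<in>M. e \<inter> f \<noteq> {} \<longrightarrow> \<not> d f < d e}"

definition class_matching :: "'a set set \<Rightarrow> ('a set \<Rightarrow> nat) \<Rightarrow> ('a set \<Rightarrow> real) \<Rightarrow> 'a set set" where
  "class_matching E d \<pi> = undominated d (greedy E (conflict d) \<pi>)"

definition conflict_free :: "('a set \<Rightarrow> nat) \<Rightarrow> 'a set set \<Rightarrow> bool" where
  "conflict_free d M \<longleftrightarrow> (\<forall>e\<in>M. \<forall>f\<in>M. \<not> conflict d e f)"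

definition edge_sizes_le :: "nat \<Rightarrow> 'a set set \<Rightarrow> bool" where
  "edge_sizes_le r E \<longleftrightarrow> (\<forall>e\<in>E. finite e \<and> card e \<le> r)"

lemma edge_sizes_le_subset: "edge_sizes_le r E \<Longrightarrow> F \<subseteq> E \<Longrightarrow> edge_sizes_le r F"
  by (auto simp: edge_sizes_le_def)

lemma symp_conflict: "symp (conflict d)" and irreflp_conflict: "irreflp (conflict d)"
  by (auto simp: conflict_def intro!: sympI irreflpI)

lemma conflict_free_greedy:
  "finite E \<Longrightarrow> inj_on \<pi> E \<Longrightarrow> conflict_free d (greedy E (conflict d) \<pi>)"
  unfolding conflict_free_def
  using greedy_independent[OF _ _ symp_conflict irreflp_conflict] by blast

lemma greedy_conflict_cong:
  assumes "finite E" "W \<subseteq> E" "\<And>x y. x \<in> E \<Longrightarrow> y \<in> E \<Longrightarrow> \<pi> x < \<pi> y \<longleftrightarrow> \<pi>' x < \<pi>' y"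
    and "\<And>e. e \<in> E \<Longrightarrow> d e = d' e"
  shows "greedy W (conflict d) \<pi> = greedy W (conflict d') \<pi>'"
proof (rule greedy_cong)
  show "finite W" using assms(2,1) by (rule finite_subset)
  show "\<pi> e < \<pi> f \<longleftrightarrow> \<pi>' e < \<pi>' f" "conflict d e f = conflict d' e f" if "e \<in> W" "f \<in> W" for e f
    using that assms(2) by (auto simp: conflict_def assms(3,4) subset_iff)
qed

lemma undominated_subset: "undominated d M \<subseteq> M"
  by (auto simp: undominated_def)

lemma undominated_cong: "(\<And>e. e \<in> M \<Longrightarrow> d e = d' e) \<Longrightarrow> undominated d M = undominated d' M"
  by (auto simp: undominated_def)

lemma class_matching_subset: "finite E \<Longrightarrow> class_matching E d \<pi> \<subseteq> E"
  using greedy_subset undominated_subset unfolding class_matching_def by blast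

lemma class_matching_cong:
  assumes "finite E" "\<And>x y. x \<in> E \<Longrightarrow> y \<in> E \<Longrightarrow> \<pi> x < \<pi> y \<longleftrightarrow> \<pi>' x < \<pi>' y"
    and "\<And>e. e \<in> E \<Longrightarrow> d e = d' e"
  shows "class_matching E d \<pi> = class_matching E d' \<pi>'"
proof -
  have "greedy E (conflict d) \<pi> = greedy E (conflict d') \<pi>'"
    by (rule greedy_conflict_cong) (use assms in auto)
  moreover have "undominated d (greedy E (conflict d') \<pi>') =
      undominated d' (greedy E (conflict d') \<pi>')"
    by (rule undominated_cong) (use assms(3) greedy_subset[OF assms(1)] in blast)
  ultimately show ?thesis by (simp add: class_matching_def)
qed

lemma disjoint_class_matching:
  assumes "finite E" "inj_on \<pi> E"
  shows "disjoint (class_matching E d \<pi>)"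
proof (rule disjointI, rule ccontr)
  fix e f
  assume ef: "e \<in> class_matching E d \<pi>" "f \<in> class_matching E d \<pi>" "e \<noteq> f" "e \<inter> f \<noteq> {}"
  then have "\<not> d f < d e" "\<not> d e < d f"
    unfolding class_matching_def undominated_def by blast+
  then have "conflict d e f" using ef by (simp add: conflict_def)
  then show False
    using ef conflict_free_greedy[OF assms, of d]
    by (auto simp: class_matching_def undominated_def conflict_free_def)
qed

lemma sum_UN_le:
  fixes g :: "'a \<Rightarrow> real"
  assumes "finite I" "\<And>i. i \<in> I \<Longrightarrow> finite (A i)" "\<And>x. 0 \<le> g x"
  shows "sum g (\<Union>i\<in>I. A i) \<le> (\<Sum>i\<in>I. sum g (A i))"
  using assms(1,2)
proof (induction I rule: finite_induct)
  case (insert i I)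
  have "sum g (A i \<union> \<Union> (A ` I)) \<le> sum g (A i) + sum g (\<Union> (A ` I))"
    using insert.prems insert.hyps(1) assms(3)
    by (subst sum.union_inter[symmetric]) (auto intro!: sum_nonneg)
  then show ?case using insert by force
qed simp

lemma sum_power_above_le:
  fixes q :: real
  assumes q: "0 < q" "q < 1" and I: "finite I" "\<And>i. i \<in> I \<Longrightarrow> m < i"
  shows "(\<Sum>i\<in>I. q ^ i) \<le> q / (1 - q) * q ^ m"
proof -
  let ?J = "(\<lambda>i. i - Suc m) ` I"
  have inj: "inj_on (\<lambda>i. i - Suc m) I" by (rule inj_on_diff_nat) (simp add: I(2) Suc_leI)
  have "(\<Sum>i\<in>I. q ^ i) = (\<Sum>i\<in>I. q ^ Suc m * q ^ (i - Suc m))"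
    using I(2) by (intro sum.cong refl) (metis Suc_leI le_add_diff_inverse power_add)
  also have "\<dots> = q ^ Suc m * (\<Sum>j\<in>?J. q ^ j)"
    by (simp add: sum.reindex[OF inj] sum_distrib_left)
  also have "(\<Sum>j\<in>?J. q ^ j) \<le> 1 / (1 - q)"
    using q I(1) sum_le_suminf[of "\<lambda>j. q ^ j" ?J] by (simp add: suminf_geometric summable_geometric)
  finally show ?thesis using q by (simp add: mult_ac mult_left_mono)
qed

text \<open>A chosen edge of class \<open>k\<close> stands for the rounded weight \<open>q ^ k\<close>. In each lower class an edge
  \<open>f\<close> with \<open>r\<close> vertices meets at most \<open>r\<close> chosen edges, so the edges that it dominates have total
  rounded weight at most \<open>dominance q r\<close> times its own.\<close>

definition dominance :: "real \<Rightarrow> nat \<Rightarrow> real" where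
  "dominance q r = real r * (q / (1 - q))"

lemma sum_dominated_by_edge_le:
  fixes q :: real
  assumes q: "0 < q" "q < 1" and M: "finite M" "conflict_free d M"
    and f: "finite f" "card f \<le> r"
  shows "(\<Sum>g | g \<in> M \<and> d f < d g \<and> g \<inter> f \<noteq> {}. q ^ d g) \<le> dominance q r * q ^ d f"
proof -
  define A where "A x = {g \<in> M. x \<in> g \<and> d f < d g}" for x
  have A: "(\<Sum>g\<in>A x. q ^ d g) \<le> q / (1 - q) * q ^ d f" for x
  proof -
    have "inj_on d (A x)" using M(2) by (auto simp: inj_on_def A_def conflict_def conflict_free_def)
    then have "(\<Sum>g\<in>A x. q ^ d g) = (\<Sum>i\<in>d ` A x. q ^ i)" by (simp add: sum.reindex)
    also have "\<dots> \<le> q / (1 - q) * q ^ d f"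
      by (rule sum_power_above_le[OF q]) (use M(1) in \<open>auto simp: A_def\<close>)
    finally show ?thesis .
  qed
  have "{g. g \<in> M \<and> d f < d g \<and> g \<inter> f \<noteq> {}} = (\<Union>x\<in>f. A x)" by (auto simp: A_def)
  then have "(\<Sum>g | g \<in> M \<and> d f < d g \<and> g \<inter> f \<noteq> {}. q ^ d g) \<le> (\<Sum>x\<in>f. \<Sum>g\<in>A x. q ^ d g)"
    using sum_UN_le[OF f(1), of A "\<lambda>g. q ^ d g"] M(1) q by (simp add: A_def)
  also have "\<dots> \<le> real (card f) * (q / (1 - q) * q ^ d f)"
    using sum_mono[where K = f, OF A] by simp
  also have "\<dots> \<le> real r * (q / (1 - q) * q ^ d f)"
    using f(2) q by (intro mult_right_mono) auto
  finally show ?thesis by (simp add: dominance_def mult.assoc)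
qed

lemma sum_dominated_le:
  fixes q :: real
  assumes q: "0 < q" "q < 1" and M: "finite M" "conflict_free d M"
    and D: "finite D" "edge_sizes_le r D"
    and X: "X \<subseteq> M" "\<And>g. g \<in> X \<Longrightarrow> \<exists>f\<in>D. g \<inter> f \<noteq> {} \<and> d f < d g"
  shows "(\<Sum>g\<in>X. q ^ d g) \<le> dominance q r * (\<Sum>f\<in>D. q ^ d f)"
proof -
  define B where "B f = {g. g \<in> M \<and> d f < d g \<and> g \<inter> f \<noteq> {}}" for f
  have finB: "finite (B f)" for f using M(1) by (simp add: B_def)
  have "(\<Sum>g\<in>X. q ^ d g) \<le> (\<Sum>g\<in>(\<Union>f\<in>D. B f). q ^ d g)"
    by (rule sum_mono2) (use D(1) finB X q in \<open>fastforce simp: B_def\<close>)+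
  also have "\<dots> \<le> (\<Sum>f\<in>D. \<Sum>g\<in>B f. q ^ d g)" by (rule sum_UN_le) (use D(1) finB q in auto)
  also have "\<dots> \<le> (\<Sum>f\<in>D. dominance q r * q ^ d f)"
    unfolding B_def
    by (intro sum_mono sum_dominated_by_edge_le q M) (use D(2) in \<open>auto simp: edge_sizes_le_def\<close>)
  finally show ?thesis by (simp add: sum_distrib_left)
qed

lemma sum_sym_diff_undominated_le:
  fixes q :: real
  assumes q: "0 < q" "q < 1"
    and M: "finite M" "conflict_free d M" and M': "finite M'" and r: "edge_sizes_le r (M \<union> M')"
  shows "(\<Sum>g\<in>sym_diff (undominated d M) (undominated d M'). q ^ d g) \<le>
    (1 + dominance q r) * (\<Sum>f\<in>sym_diff M M'. q ^ d f)"
proof -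
  define D where "D = sym_diff M M'"
  define X where "X = sym_diff (undominated d M) (undominated d M') - D"
  have fin: "finite D" "finite X" using M(1) M' by (auto simp: D_def X_def undominated_def)
  have "(\<Sum>g\<in>sym_diff (undominated d M) (undominated d M'). q ^ d g) \<le> (\<Sum>g\<in>D \<union> X. q ^ d g)"
    by (rule sum_mono2) (use fin q in \<open>auto simp: X_def\<close>)
  also have "\<dots> = (\<Sum>g\<in>D. q ^ d g) + (\<Sum>g\<in>X. q ^ d g)"
    by (rule sum.union_disjoint) (use fin in \<open>auto simp: X_def\<close>)
  also have "(\<Sum>g\<in>X. q ^ d g) \<le> dominance q r * (\<Sum>f\<in>D. q ^ d f)"
  proof (rule sum_dominated_le[OF q M fin(1)])
    show "X \<subseteq> M" by (auto simp: X_def D_def undominated_def)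
    show "\<exists>f\<in>D. g \<inter> f \<noteq> {} \<and> d f < d g" if "g \<in> X" for g
      using that unfolding X_def D_def undominated_def by blast
    show "edge_sizes_le r D" by (rule edge_sizes_le_subset[OF r]) (auto simp: D_def)
  qed
  finally show ?thesis by (simp add: D_def distrib_right)
qed

section \<open>Stability of the class matching\<close>

lemma influence_confined_to_class:
  assumes "finite E" "f \<in> sym_diff (greedy E (conflict d) \<pi>) (greedy (E - {e}) (conflict d) \<pi>)"
  shows "d f = d e"
proof (rule ccontr)
  assume "d f \<noteq> d e"
  then have "f \<in> greedy E (conflict d) \<pi> \<longleftrightarrow> f \<in> greedy (E - {e}) (conflict d) \<pi>"
    by (intro is_greedy_agree[OF assms(1) is_greedy_greedy is_greedy_greedy,
          where P = "\<lambda>f. d f \<noteq> d e"]) (use assms(1) in \<open>auto simp: conflict_def\<close>)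
  then show False using assms(2) by auto
qed

lemma class_matching_remove_le:
  fixes q :: real
  assumes q: "0 < q" "q < 1" and E: "finite E" "inj_on \<pi> E"
    and r: "edge_sizes_le r E"
  shows "(\<Sum>g\<in>sym_diff (class_matching E d \<pi>) (class_matching (E - {e}) d \<pi>). q ^ d g)
    \<le> (1 + dominance q r) * q ^ d e * real (influence E (conflict d) \<pi> e)"
proof -
  let ?M = "greedy E (conflict d) \<pi>" and ?M' = "greedy (E - {e}) (conflict d) \<pi>"
  have sub: "?M \<subseteq> E" "?M' \<subseteq> E"
    using greedy_subset[OF E(1)] greedy_subset[of "E - {e}"] E(1) by blast+
  have "(\<Sum>g\<in>sym_diff (class_matching E d \<pi>) (class_matching (E - {e}) d \<pi>). q ^ d g) \<le>
      (1 + dominance q r) * (\<Sum>f\<in>sym_diff ?M ?M'. q ^ d f)"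
    unfolding class_matching_def
  proof (rule sum_sym_diff_undominated_le[OF q _ conflict_free_greedy[OF E]])
    show "finite ?M" "finite ?M'" using sub E(1) finite_subset by blast+
    show "edge_sizes_le r (?M \<union> ?M')" by (rule edge_sizes_le_subset[OF r]) (use sub in blast)
  qed
  also have "(\<Sum>f\<in>sym_diff ?M ?M'. q ^ d f) = (\<Sum>f\<in>sym_diff ?M ?M'. q ^ d e)"
    by (rule sum.cong[OF refl]) (simp only: influence_confined_to_class[OF E(1)])
  also have "\<dots> = real (influence E (conflict d) \<pi> e) * q ^ d e" by (simp add: influence_def)
  finally show ?thesis by (simp add: mult_ac)
qed

lemma sum_sym_diff_triangle:
  fixes m :: "'a \<Rightarrow> real"
  assumes "finite A" "finite B" "finite C" "\<And>x. x \<in> A \<union> B \<union> C \<Longrightarrow> 0 \<le> m x"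
  shows "sum m (sym_diff A C) \<le> sum m (sym_diff A B) + sum m (sym_diff B C)"
proof -
  have "sum m (sym_diff A C) \<le> sum m (sym_diff A B \<union> sym_diff B C)"
    using assms by (intro sum_mono2) auto
  also have "\<dots> \<le> sum m (sym_diff A B \<union> sym_diff B C) + sum m (sym_diff A B \<inter> sym_diff B C)"
    using assms by (auto intro!: sum_nonneg)
  also have "\<dots> = sum m (sym_diff A B) + sum m (sym_diff B C)"
    using assms by (intro sum.union_inter) auto
  finally show ?thesis .
qed

lemma class_matching_remove_weight_le:
  fixes q c :: real
  assumes q: "0 < q" "q < 1" and E: "finite E" "inj_on \<pi> E"
    and r: "edge_sizes_le r E"
    and m: "\<And>g. g \<in> E \<Longrightarrow> m g \<le> c * q ^ d g" and c: "0 \<le> c"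
  shows "sum m (sym_diff (class_matching E d \<pi>) (class_matching (E - {e}) d \<pi>)) \<le>
    (1 + dominance q r) * c * q ^ d e * real (influence E (conflict d) \<pi> e)"
proof -
  let ?D = "sym_diff (class_matching E d \<pi>) (class_matching (E - {e}) d \<pi>)"
  have "?D \<subseteq> E"
    using class_matching_subset[OF E(1)] class_matching_subset[of "E - {e}"] E(1) by blast
  then have "sum m ?D \<le> (\<Sum>g\<in>?D. c * q ^ d g)" using m by (intro sum_mono) auto
  also have "\<dots> = c * (\<Sum>g\<in>?D. q ^ d g)" by (simp add: sum_distrib_left)
  also have "\<dots> \<le> c * ((1 + dominance q r) * q ^ d e * real (influence E (conflict d) \<pi> e))"
    by (intro mult_left_mono c class_matching_remove_le q E r)
  finally show ?thesis by (simp add: mult_ac)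
qed

lemma class_matching_reclassify_le:
  fixes q c :: real
  assumes q: "0 < q" "q < 1" and E: "finite E" "inj_on \<pi> E"
    and r: "edge_sizes_le r E"
    and m: "\<And>g. g \<in> E \<Longrightarrow> 0 \<le> m g" "\<And>g. g \<in> E \<Longrightarrow> m g \<le> c * q ^ d g"
      "\<And>g. g \<in> E \<Longrightarrow> m g \<le> c * q ^ d' g"
    and c: "0 \<le> c" and d': "\<And>g. g \<in> E \<Longrightarrow> g \<noteq> e \<Longrightarrow> d' g = d g"
  shows "sum m (sym_diff (class_matching E d \<pi>) (class_matching E d' \<pi>)) \<le>
    (1 + dominance q r) * c * q ^ d e * real (influence E (conflict d) \<pi> e) +
    (1 + dominance q r) * c * q ^ d' e * real (influence E (conflict d') \<pi> e)"
proof -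
  let ?without = "class_matching (E - {e}) d \<pi>"
  have without: "class_matching (E - {e}) d' \<pi> = ?without"
    by (rule class_matching_cong) (use E(1) d' in auto)
  have sub: "class_matching E d \<pi> \<subseteq> E" "class_matching E d' \<pi> \<subseteq> E" "?without \<subseteq> E"
    using class_matching_subset[OF E(1)] class_matching_subset[of "E - {e}"] E(1) by blast+
  have "sum m (sym_diff (class_matching E d \<pi>) (class_matching E d' \<pi>)) \<le>
      sum m (sym_diff (class_matching E d \<pi>) ?without) +
      sum m (sym_diff ?without (class_matching E d' \<pi>))"
    by (rule sum_sym_diff_triangle) (use sub[THEN finite_subset, OF E(1)] sub m(1) in auto)
  also have "sym_diff ?without (class_matching E d' \<pi>) =
      sym_diff (class_matching E d' \<pi>) (class_matching (E - {e}) d' \<pi>)"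
    unfolding without by (rule Un_commute)
  finally show ?thesis
    using class_matching_remove_weight_le[where d = d and m = m and e = e, OF q E r m(2) c]
      class_matching_remove_weight_le[where d = d' and m = m and e = e, OF q E r m(3) c] by simp
qed

section \<open>Weight classes\<close>

text \<open>Class 0 is the heaviest, and class \<open>L\<close> collects all weights below the last threshold.\<close>

definition level :: "real \<Rightarrow> nat \<Rightarrow> real \<Rightarrow> real \<Rightarrow> nat" where
  "level q L t x = (\<Sum>i<L. of_bool (x < t * q ^ i))"

lemma less_level_iff:
  assumes q: "0 < q" "q < 1" and t: "0 \<le> t"
  shows "i < level q L t x \<longleftrightarrow> i < L \<and> x < t * q ^ i"
proof (induction L)
  case (Suc L)
  show ?case
  proof (cases "x < t * q ^ L")
    case True
    have "x < t * q ^ j" if "j \<le> L" for j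
    proof -
      have "t * q ^ L \<le> t * q ^ j" using that q t by (intro mult_left_mono power_decreasing) auto
      then show ?thesis using True by simp
    qed
    then show ?thesis by (auto simp: level_def)
  next
    case False
    then have "level q (Suc L) t x = level q L t x" by (simp add: level_def)
    then show ?thesis using Suc.IH False by (auto simp: less_Suc_eq)
  qed
qed (simp add: level_def)

lemma weight_le_power_level:
  assumes "0 < q" "q < 1" "0 \<le> t" and x: "q * x \<le> t"
  shows "q * x \<le> t * q ^ level q L t x"
proof (cases "level q L t x")
  case (Suc i)
  then have "x < t * q ^ i" using less_level_iff[OF assms(1-3), of i L x] by simp
  then show ?thesis using Suc assms(1) by (simp add: mult.left_commute)
qed (use x in simp)

lemma power_level_le_weight:
  assumes "0 < q" "q < 1" "0 \<le> t" "level q L t x < L"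
  shows "t * q ^ level q L t x \<le> x"
  using less_level_iff[OF assms(1-3), of "level q L t x" L x] assms(4) by simp

lemma level_scale: "0 < s \<Longrightarrow> level q L (t * s) x = level q L t (x / s)"
  by (simp add: level_def field_simps)

text \<open>The largest threshold, relative to the total weight, is uniform in \<open>[q, 1]\<close>.\<close>

definition scale :: "real \<Rightarrow> real \<Rightarrow> real" where
  "scale q u = q + (1 - q) * u"

definition classes :: "real \<Rightarrow> nat \<Rightarrow> 'a set \<Rightarrow> ('a \<Rightarrow> real) \<Rightarrow> real \<Rightarrow> 'a \<Rightarrow> nat" where
  "classes q L E w u e = level q L (scale q u * sum w E) (w e)"

lemma scale_bounds:
  assumes "0 < q" "q < 1" "u \<in> {0..1}"
  shows "q \<le> scale q u" "scale q u \<le> 1"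
proof -
  have "0 \<le> (1 - q) * u" "(1 - q) * u \<le> 1 - q" using assms by (auto simp: mult_left_le)
  then show "q \<le> scale q u" "scale q u \<le> 1" by (auto simp: scale_def)
qed

lemma measurable_scale [measurable]: "scale q \<in> borel_measurable borel"
  unfolding scale_def[abs_def] by measurable

lemma measurable_eq_count_space:
  fixes f g :: "'a \<Rightarrow> 'b::countable"
  assumes "f \<in> measurable M (count_space UNIV)" "g \<in> measurable M (count_space UNIV)"
  shows "Measurable.pred M (\<lambda>x. f x = g x)"
  by (rule measurable_compose_countable[OF _ assms(1)]) (rule measurable_compose[OF assms(2)], simp)

lemma measurable_level [measurable (raw)]:
  assumes [measurable]: "t \<in> borel_measurable M"
  shows "(\<lambda>u. level q L (t u) x) \<in> measurable M (count_space UNIV)"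
  unfolding level_def of_bool_def by measurable

lemma measurable_classes: "(\<lambda>u. classes q L E w u e) \<in> measurable borel (count_space UNIV)"
  unfolding classes_def by measurable

lemma classes_normalize: "0 < sum w E \<Longrightarrow> classes q L E w u e = level q L (scale q u) (w e / sum w E)"
  by (simp add: classes_def level_scale)

definition class_change :: "real \<Rightarrow> nat \<Rightarrow> real \<Rightarrow> real \<Rightarrow> real \<Rightarrow> real" where
  "class_change q L x y u =
     (let i = level q L (scale q u) x; j = level q L (scale q u) y
      in if i = j then 0 else scale q u * (q ^ i + q ^ j))"

lemma measurable_class_change: "class_change q L x y \<in> borel_measurable borel"
proof -
  have [measurable]: "Measurable.pred borel (\<lambda>u. level q L (scale q u) x = level q L (scale q u) y)"
    by (intro measurable_eq_count_space measurable_level measurable_scale)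
  show ?thesis unfolding class_change_def[abs_def] Let_def by measurable
qed

lemma class_change_commute: "class_change q L x y u = class_change q L y x u"
  by (simp add: class_change_def Let_def add.commute)

text \<open>If \<open>x\<close> and \<open>y\<close> are in different classes then some threshold \<open>t\<close> separates them, and the
  cost of either class is \<open>O(t)\<close>. Averaged over \<open>u\<close>, the separating thresholds sweep \<open>(x, y]\<close> with
  density \<open>O(1/t)\<close>.\<close>

lemma class_change_le_separating:
  assumes q: "0 < q" "q < 1" and u: "u \<in> {0..1}" and xy: "x \<le> y"
  shows "class_change q L x y u \<le>
    (1 + q) * (\<Sum>i<L. q ^ i * indicator {x<..y} (scale q u * q ^ i))"
proof (cases "level q L (scale q u) x = level q L (scale q u) y")
  case True
  then show ?thesis using q by (simp add: class_change_def sum_nonneg)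
next
  case False
  let ?t = "scale q u" and ?i = "level q L (scale q u) y" and ?j = "level q L (scale q u) x"
  have t: "0 \<le> ?t" "?t \<le> 1" using scale_bounds[OF q u] q by auto
  note less_iff = less_level_iff[OF q t(1)]
  have "?i \<le> ?j" using less_iff[of ?j L y] less_iff[of ?j L x] xy by linarith
  then have less: "?i < ?j" using False by simp
  have i: "?i < L" "x < ?t * q ^ ?i" "?t * q ^ ?i \<le> y"
    using less less_iff[of ?i L x] less_iff[of ?i L y] by auto
  have "q ^ ?j \<le> q ^ Suc ?i" using less q by (intro power_decreasing) auto
  then have "?t * (q ^ ?j + q ^ ?i) \<le> 1 * (q ^ Suc ?i + q ^ ?i)"
    using t q by (intro mult_mono) auto
  also have "\<dots> = (1 + q) * (q ^ ?i * indicator {x<..y} (?t * q ^ ?i))"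
    using i by (simp add: algebra_simps)
  also have "\<dots> \<le> (1 + q) * (\<Sum>i<L. q ^ i * indicator {x<..y} (?t * q ^ i))"
    using i(1) q by (intro mult_left_mono member_le_sum) auto
  finally show ?thesis using False by (simp add: class_change_def)
qed

lemma nn_integral_separating_threshold_le:
  assumes q: "0 < q" "q < 1"
  shows "(\<integral>\<^sup>+u. ennreal (q ^ i * indicator {x<..y} (scale q u * q ^ i)) \<partial>unif) \<le>
    ennreal (1 / (1 - q)) * emeasure lborel ({x<..y} \<inter> {q ^ Suc i<..q ^ i})"
proof -
  let ?B = "{x<..y} \<inter> {q ^ Suc i<..q ^ i}" and ?f = "\<lambda>u. q ^ Suc i + (1 - q) * q ^ i * u"
  have threshold: "scale q u * q ^ i = ?f u" for u by (simp add: scale_def algebra_simps)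
  have "(\<integral>\<^sup>+u. ennreal (q ^ i * indicator {x<..y} (scale q u * q ^ i)) \<partial>unif) \<le>
      (\<integral>\<^sup>+u. ennreal (q ^ i) * indicator ?B (?f u) \<partial>unif)"
  proof (rule nn_integral_mono_AE, use AE_unif_mem AE_unif_neq[of 0] in eventually_elim)
    case (elim u)
    have "0 < (1 - q) * q ^ i * u" "(1 - q) * q ^ i * u \<le> (1 - q) * q ^ i"
      using elim q by (auto simp: mult_left_le)
    then have "?f u \<in> {q ^ Suc i<..q ^ i}" by (auto simp: algebra_simps)
    then show ?case unfolding threshold by (simp add: indicator_def)
  qed
  also have "\<dots> \<le> (\<integral>\<^sup>+u. ennreal (q ^ i) * indicator ?B (?f u) \<partial>lborel)"
    by (subst nn_integral_unif) (auto intro!: nn_integral_mono simp: indicator_def)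
  also have "\<dots> = ennreal (q ^ i) * (\<integral>\<^sup>+u. indicator ?B (?f u) \<partial>lborel)"
    by (rule nn_integral_cmult) measurable
  also have "ennreal (q ^ i) = ennreal (1 / (1 - q)) * ennreal ((1 - q) * q ^ i)"
    using q by (subst ennreal_mult[symmetric]) auto
  also have "\<dots> * (\<integral>\<^sup>+u. indicator ?B (?f u) \<partial>lborel) =
      ennreal (1 / (1 - q)) * (ennreal ((1 - q) * q ^ i) * (\<integral>\<^sup>+u. indicator ?B (?f u) \<partial>lborel))"
    by (simp add: mult.assoc)
  also have "ennreal ((1 - q) * q ^ i) * (\<integral>\<^sup>+u. indicator ?B (?f u) \<partial>lborel) = emeasure lborel ?B"
    using nn_integral_real_affine[of "indicator ?B" "(1 - q) * q ^ i" "q ^ Suc i"] q by simp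
  finally show ?thesis .
qed

lemma sum_emeasure_power_cells_le:
  fixes q x y :: real
  assumes q: "0 < q" "q < 1"
  shows "(\<Sum>i<L. emeasure lborel ({x<..y} \<inter> {q ^ Suc i<..q ^ i})) \<le> emeasure lborel {x<..y}"
proof -
  let ?B = "\<lambda>i. {x<..y} \<inter> {q ^ Suc i<..q ^ i}"
  have "(\<Sum>i<L. emeasure lborel (?B i)) = emeasure lborel (\<Union>i<L. ?B i)"
  proof (rule sum_emeasure)
    have "?B i \<inter> ?B j = {}" if "i < j" for i j
    proof -
      have "q ^ j \<le> q ^ Suc i" using that q by (intro power_decreasing) auto
      then show ?thesis by auto
    qed
    then show "disjoint_family_on ?B {..<L}"
      unfolding disjoint_family_on_def by (metis Int_commute linorder_neqE_nat)
  qed auto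
  also have "\<dots> \<le> emeasure lborel {x<..y}" by (rule emeasure_mono) auto
  finally show ?thesis .
qed

lemma expected_class_change_le_ordered:
  assumes q: "0 < q" "q < 1" and xy: "x \<le> y"
  shows "(\<integral>\<^sup>+u. ennreal (class_change q L x y u) \<partial>unif) \<le> ennreal ((1 + q) / (1 - q) * (y - x))"
proof -
  define separating where "separating i u = q ^ i * indicator {x<..y} (scale q u * q ^ i)" for i u
  let ?B = "\<lambda>i. {x<..y} \<inter> {q ^ Suc i<..q ^ i}"
  have nonneg: "0 \<le> separating i u" for i u using q by (simp add: separating_def)
  have [measurable]: "separating i \<in> borel_measurable borel" for i
    unfolding separating_def by measurable
  have "(\<integral>\<^sup>+u. ennreal (class_change q L x y u) \<partial>unif) \<le>
      (\<integral>\<^sup>+u. ennreal (1 + q) * (\<Sum>i<L. ennreal (separating i u)) \<partial>unif)"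
  proof (rule nn_integral_mono_AE, use AE_unif_mem in eventually_elim)
    case (elim u)
    have "class_change q L x y u \<le> (1 + q) * (\<Sum>i<L. separating i u)"
      unfolding separating_def by (rule class_change_le_separating[OF q elim xy])
    then have "ennreal (class_change q L x y u) \<le> ennreal ((1 + q) * (\<Sum>i<L. separating i u))"
      by (rule ennreal_leI)
    also have "\<dots> = ennreal (1 + q) * ennreal (\<Sum>i<L. separating i u)"
      by (rule ennreal_mult') (use q in simp)
    finally show ?case by (simp only: sum_ennreal nonneg)
  qed
  also have "\<dots> = ennreal (1 + q) * (\<Sum>i<L. \<integral>\<^sup>+u. ennreal (separating i u) \<partial>unif)"
    by (subst nn_integral_cmult) (simp_all add: nn_integral_sum)
  also have "\<dots> \<le> ennreal (1 + q) * (\<Sum>i<L. ennreal (1 / (1 - q)) * emeasure lborel (?B i))"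
    unfolding separating_def
    by (intro mult_left_mono sum_mono nn_integral_separating_threshold_le q) simp
  also have "\<dots> = ennreal (1 + q) * ennreal (1 / (1 - q)) * (\<Sum>i<L. emeasure lborel (?B i))"
    by (simp only: sum_distrib_left mult.assoc)
  also have "ennreal (1 + q) * ennreal (1 / (1 - q)) = ennreal ((1 + q) * (1 / (1 - q)))"
    by (rule ennreal_mult'[symmetric]) (use q in simp)
  also have "(1 + q) * (1 / (1 - q)) = (1 + q) / (1 - q)" by simp
  also have "ennreal ((1 + q) / (1 - q)) * (\<Sum>i<L. emeasure lborel (?B i)) \<le>
      ennreal ((1 + q) / (1 - q)) * emeasure lborel {x<..y}"
    by (intro mult_left_mono sum_emeasure_power_cells_le q) simp
  also have "\<dots> = ennreal ((1 + q) / (1 - q) * (y - x))"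
    using q xy ennreal_mult[of "(1 + q) / (1 - q)" "y - x"] by simp
  finally show ?thesis .
qed

lemma expected_class_change_le:
  assumes "0 < q" "q < 1"
  shows "(\<integral>\<^sup>+u. ennreal (class_change q L x y u) \<partial>unif) \<le> ennreal ((1 + q) / (1 - q) * \<bar>x - y\<bar>)"
proof (cases "x \<le> y")
  case True
  then show ?thesis using expected_class_change_le_ordered[OF assms True, of L] by simp
next
  case False
  then show ?thesis
    using expected_class_change_le_ordered[OF assms, of y x L]
    by (simp add: class_change_commute[of _ _ x])
qed

definition rounded :: "real \<Rightarrow> nat \<Rightarrow> real \<Rightarrow> real \<Rightarrow> real" where
  "rounded q L t x = (if level q L t x < L then t * q ^ level q L t x else 0)"

lemma measurable_rounded:
  assumes [measurable]: "t \<in> borel_measurable borel"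
  shows "(\<lambda>u. rounded q L (t u) x) \<in> borel_measurable borel"
  unfolding rounded_def by measurable

lemma rounded_nonneg: "0 < q \<Longrightarrow> 0 \<le> t \<Longrightarrow> 0 \<le> rounded q L t x"
  by (simp add: rounded_def)

lemma rounded_le:
  assumes "0 < q" "q < 1" "0 \<le> t" "0 \<le> x"
  shows "rounded q L t x \<le> x"
  using power_level_le_weight[OF assms(1-3), of L x] assms(4) by (simp add: rounded_def)

lemma rounded_scale: "0 < s \<Longrightarrow> rounded q L (t * s) x = s * rounded q L t (x / s)"
  by (simp add: rounded_def level_scale)

lemma threshold_le_rounded:
  assumes q: "0 < q" "q < 1" and t: "0 \<le> t" and k: "k < L" "t * q ^ k \<le> x"
  shows "t * q ^ k \<le> rounded q L t x"
proof -
  have "level q L t x \<le> k" using less_level_iff[OF q t, of k L x] k by auto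
  then show ?thesis
    using k(1) q t by (auto simp: rounded_def intro!: mult_left_mono power_decreasing)
qed

lemma ex_power_interval:
  fixes q x :: real
  assumes "q ^ Suc n \<le> x" "x \<le> 1"
  shows "\<exists>i\<le>n. q ^ Suc i \<le> x \<and> x \<le> q ^ i"
proof -
  define i where "i = (LEAST i. q ^ Suc i \<le> x)"
  have i: "q ^ Suc i \<le> x" "i \<le> n"
    unfolding i_def using assms(1) by (rule LeastI, intro Least_le)
  moreover have "x \<le> q ^ i"
  proof (cases i)
    case (Suc j)
    then have "\<not> q ^ Suc j \<le> x" using not_less_Least[of j "\<lambda>i. q ^ Suc i \<le> x"] by (simp add: i_def)
    then show ?thesis using Suc by simp
  qed (use assms(2) in simp)
  ultimately show ?thesis by blast
qed

lemma nn_integral_scale: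
  assumes "0 < q" "q < 1" "0 \<le> p" "p \<le> 1"
  shows "(\<integral>\<^sup>+u. ennreal (scale q u) * indicator {0..p} u \<partial>unif) =
      ennreal (q * p + (1 - q) * p\<^sup>2 / 2)"
proof -
  have "(\<integral>\<^sup>+u. ennreal (scale q u) * indicator {0..p} u \<partial>unif) =
      (\<integral>\<^sup>+u. ennreal (scale q u) * indicator {0..p} u \<partial>lborel)"
    using assms by (subst nn_integral_unif) (auto intro!: nn_integral_cong simp: indicator_def)
  also have "\<dots> = ennreal ((q * p + (1 - q) * p\<^sup>2 / 2) - (q * 0 + (1 - q) * 0\<^sup>2 / 2))"
  proof (rule nn_integral_FTC_Icc)
    show "((\<lambda>u. q * u + (1 - q) * u\<^sup>2 / 2) has_real_derivative scale q u) (at u)" for u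
      by (auto intro!: derivative_eq_intros simp: scale_def)
  qed (use assms in \<open>auto simp: scale_def\<close>)
  finally show ?thesis by simp
qed

lemma ex_scale_power:
  assumes q: "0 < q" "q < 1" and L: "2 \<le> L" and x: "q ^ (L - 1) \<le> x" "x \<le> 1"
  shows "\<exists>i z. Suc i < L \<and> z \<in> {0..1} \<and> x = q ^ i * scale q z"
proof -
  have "q ^ Suc (L - 2) \<le> x" using x(1) L by (simp add: numeral_2_eq_2 Suc_diff_Suc)
  then obtain i where i: "i \<le> L - 2" "q ^ Suc i \<le> x" "x \<le> q ^ i"
    using ex_power_interval x(2) by blast
  define y where "y = x / q ^ i"
  have y: "q \<le> y" "y \<le> 1" "x = q ^ i * y" using i q by (auto simp: y_def field_simps)
  define z where "z = (y - q) / (1 - q)"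
  have "z \<in> {0..1}" "scale q z = y" using y q by (auto simp: z_def scale_def)
  then show ?thesis using i(1) y(3) L by (intro exI[of _ i] exI[of _ z]) auto
qed

definition two_step_rounding :: "real \<Rightarrow> nat \<Rightarrow> real \<Rightarrow> real \<Rightarrow> real" where
  "two_step_rounding q i z u = scale q u * (if u \<le> z then q ^ i else q ^ Suc i)"

lemma two_step_rounding_le_rounded:
  assumes q: "0 < q" "q < 1" and i: "Suc i < L" and z: "z \<in> {0..1}" and u: "u \<in> {0..1}"
  shows "two_step_rounding q i z u \<le> rounded q L (scale q u) (q ^ i * scale q z)"
proof -
  have t: "0 \<le> scale q u" "scale q u \<le> 1" and qz: "q \<le> scale q z"
    using scale_bounds[OF q u] scale_bounds[OF q z] q by auto
  note bound = threshold_le_rounded[OF q t(1)]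
  show ?thesis
  proof (cases "u \<le> z")
    case True
    then have "scale q u \<le> scale q z" using q by (simp add: scale_def mult_left_mono)
    then have "scale q u * q ^ i \<le> q ^ i * scale q z" using q by (simp add: mult.commute)
    from bound[OF _ this] show ?thesis using True i by (simp add: two_step_rounding_def)
  next
    case False
    have "scale q u * q ^ Suc i \<le> 1 * q ^ Suc i" using t q by (intro mult_right_mono) auto
    also have "\<dots> \<le> q ^ i * scale q z" using q qz by (simp add: mult.commute)
    finally show ?thesis using False bound[OF i] by (simp add: two_step_rounding_def)
  qed
qed

lemma expected_two_step_rounding:
  assumes q: "0 < q" "q < 1" and z: "z \<in> {0..1}"
  shows "(\<integral>\<^sup>+u. ennreal (two_step_rounding q i z u) \<partial>unif) =
      ennreal (q ^ i * (((scale q z)\<^sup>2 + q) / 2))"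
proof -
  let ?gap = "q ^ i - q ^ Suc i"
  have gap: "0 \<le> ?gap" using q by simp
  have "(\<integral>\<^sup>+u. ennreal (two_step_rounding q i z u) \<partial>unif) =
      (\<integral>\<^sup>+u. ennreal (q ^ Suc i) * (ennreal (scale q u) * indicator {0..1} u) +
        ennreal ?gap * (ennreal (scale q u) * indicator {0..z} u) \<partial>unif)"
  proof (rule nn_integral_cong_AE, use AE_unif_mem in eventually_elim)
    case (elim u)
    have "ennreal (q ^ Suc i) + ennreal ?gap = ennreal (q ^ i)"
      using q gap by (simp del: power_Suc flip: ennreal_plus)
    moreover have "ennreal (two_step_rounding q i z u) =
        ennreal (if u \<le> z then q ^ i else q ^ Suc i) * ennreal (scale q u)"
      unfolding two_step_rounding_def mult.commute[of "scale q u"]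
      using scale_bounds[OF q elim] q by (intro ennreal_mult) auto
    ultimately show ?case using elim by (simp add: distrib_right[symmetric] del: power_Suc)
  qed
  also have "\<dots> = ennreal (q ^ Suc i) * ennreal (q * 1 + (1 - q) * 1\<^sup>2 / 2) +
      ennreal ?gap * ennreal (q * z + (1 - q) * z\<^sup>2 / 2)"
    using z nn_integral_scale[OF q] by (simp add: nn_integral_add nn_integral_cmult)
  also have "\<dots> =
      ennreal (q ^ Suc i * (q * 1 + (1 - q) * 1\<^sup>2 / 2) + ?gap * (q * z + (1 - q) * z\<^sup>2 / 2))"
    using q z gap by (simp flip: ennreal_mult ennreal_plus)
  also have "q ^ Suc i * (q * 1 + (1 - q) * 1\<^sup>2 / 2) + ?gap * (q * z + (1 - q) * z\<^sup>2 / 2) =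
      q ^ i * (((scale q z)\<^sup>2 + q) / 2)"
    by (simp add: scale_def field_simps power2_eq_square)
  finally show ?thesis .
qed

text \<open>Write \<open>x = q ^ i * y\<close> with \<open>q \<le> y \<le> 1\<close>. Then \<open>x\<close> is rounded to \<open>c * q ^ i\<close> if the uniform
  \<open>c \<in> [q, 1]\<close> is at most \<open>y\<close> and to \<open>c * q ^ (i + 1)\<close> otherwise. The expectation
  \<open>q ^ i * (y\<^sup>2 + q) / 2\<close> is at least \<open>q ^ i * y * sqrt q\<close>.\<close>

lemma expected_rounded_ge:
  assumes q: "0 < q" "q < 1" and L: "2 \<le> L" and x: "x \<le> 1"
  shows "ennreal (sqrt q * (x - q ^ (L - 1))) \<le> (\<integral>\<^sup>+u. ennreal (rounded q L (scale q u) x) \<partial>unif)"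
proof (cases "q ^ (L - 1) \<le> x")
  case True
  then obtain i z where i: "Suc i < L" and z: "z \<in> {0..1}" and x_eq: "x = q ^ i * scale q z"
    using ex_scale_power[OF q L _ x] by blast
  have "0 \<le> (scale q z - sqrt q)\<^sup>2" by simp
  then have "sqrt q * scale q z \<le> ((scale q z)\<^sup>2 + q) / 2"
    using q by (simp add: power2_diff mult.commute)
  then have "sqrt q * x \<le> q ^ i * (((scale q z)\<^sup>2 + q) / 2)"
    using q by (simp add: x_eq mult.left_commute)
  moreover have "sqrt q * (x - q ^ (L - 1)) \<le> sqrt q * x" using q by (intro mult_left_mono) auto
  ultimately have "ennreal (sqrt q * (x - q ^ (L - 1))) \<le>
      ennreal (q ^ i * (((scale q z)\<^sup>2 + q) / 2))"
    by (intro ennreal_leI) linarith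
  also have "\<dots> = (\<integral>\<^sup>+u. ennreal (two_step_rounding q i z u) \<partial>unif)"
    by (rule expected_two_step_rounding[OF q z, symmetric])
  also have "\<dots> \<le> (\<integral>\<^sup>+u. ennreal (rounded q L (scale q u) x) \<partial>unif)"
    unfolding x_eq
    by (rule nn_integral_mono_AE, use AE_unif_mem in eventually_elim)
      (intro ennreal_leI two_step_rounding_le_rounded q i z)
  finally show ?thesis .
next
  case False
  then have "sqrt q * (x - q ^ (L - 1)) \<le> 0" using q by (simp add: mult_nonneg_nonpos)
  then show ?thesis by (simp add: ennreal_neg)
qed

section \<open>Expected change of the class matching\<close>

lemma measurable_class_matching:
  assumes "finite E" "\<And>e. e \<in> E \<Longrightarrow> (\<lambda>u. \<delta> u e) \<in> measurable borel (count_space UNIV)"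
  shows "(\<lambda>\<omega>. class_matching E (\<delta> (\<omega> 0)) (key idx \<omega>)) \<in> measurable tape (count_space UNIV)"
  by (rule measurable_order_and_labels[where \<Phi> = "\<lambda>\<pi> d. class_matching E d \<pi>" and \<delta> = \<delta>, OF assms])
    (auto intro!: class_matching_cong[OF assms(1)])

lemma measurable_influence:
  assumes "finite E" "\<And>e. e \<in> E \<Longrightarrow> (\<lambda>u. \<delta> u e) \<in> measurable borel (count_space UNIV)"
  shows "(\<lambda>\<omega>. influence E (conflict (\<delta> (\<omega> 0))) (key idx \<omega>) e) \<in> measurable tape (count_space UNIV)"
  by (rule measurable_order_and_labels[where \<delta> = \<delta> and \<Phi> = "\<lambda>\<pi> d. influence E (conflict d) \<pi> e",
        OF assms])
    (auto intro!: influence_cong[OF assms(1)] simp: conflict_def)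

lemma finite_range_class_matching:
  "finite E \<Longrightarrow> finite (range (\<lambda>\<omega>. class_matching E (d \<omega>) (\<pi> \<omega>)))"
  by (rule finite_subset[of _ "Pow E"]) (use class_matching_subset in auto)

lemma measurable_Pair_count_space:
  fixes X :: "'a \<Rightarrow> 'b" and Y :: "'a \<Rightarrow> 'c"
  assumes X: "X \<in> measurable M (count_space UNIV)" "finite (range X)"
    and Y: "Y \<in> measurable M (count_space UNIV)"
  shows "(\<lambda>\<omega>. (X \<omega>, Y \<omega>)) \<in> measurable M (count_space UNIV)"
proof (rule measurable_compose_countable'[where I = "range X" and f = "\<lambda>x \<omega>. (x, Y \<omega>)" and g = X])
  fix x :: 'b
  show "(\<lambda>\<omega>. (x, Y \<omega>)) \<in> measurable M (count_space UNIV)"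
    by (rule measurable_compose[OF Y]) simp
  show "X \<in> measurable M (count_space (range X))"
    using X by (subst measurable_count_space_eq2) (auto intro: measurable_sets)
  show "countable (range X)" using X(2) by (rule countable_finite)
qed

definition matching_change ::
    "'a set set \<Rightarrow> ('a set \<Rightarrow> real) \<Rightarrow> ('a set \<Rightarrow> nat) \<Rightarrow> ('a set \<Rightarrow> nat) \<Rightarrow> ('a set \<Rightarrow> real) \<Rightarrow> real" where
  "matching_change E m d d' \<pi> = sum m (sym_diff (class_matching E d \<pi>) (class_matching E d' \<pi>))"

lemma matching_change_eq_0:
  assumes "finite E" "\<And>e. e \<in> E \<Longrightarrow> d e = d' e"
  shows "matching_change E m d d' \<pi> = 0"
  using class_matching_cong[OF assms(1), of \<pi> \<pi> d d'] assms(2) by (simp add: matching_change_def)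

lemma matching_change_nonneg:
  assumes "finite E" "\<And>e. e \<in> E \<Longrightarrow> 0 \<le> m e"
  shows "0 \<le> matching_change E m d d' \<pi>"
  unfolding matching_change_def
  by (rule sum_nonneg) (use class_matching_subset[OF assms(1)] assms(2) in blast)

lemma matching_change_triangle:
  assumes "finite E" "\<And>e. e \<in> E \<Longrightarrow> 0 \<le> m e"
  shows "matching_change E m d1 d3 \<pi> \<le> matching_change E m d1 d2 \<pi> + matching_change E m d2 d3 \<pi>"
  unfolding matching_change_def
  by (rule sum_sym_diff_triangle)
    (use class_matching_subset[OF assms(1)] assms finite_subset in blast)+

lemma measurable_matching_change:
  assumes "finite E" "\<And>e. e \<in> E \<Longrightarrow> (\<lambda>u. \<delta> u e) \<in> measurable borel (count_space UNIV)"
    "\<And>e. e \<in> E \<Longrightarrow> (\<lambda>u. \<delta>' u e) \<in> measurable borel (count_space UNIV)"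
  shows "(\<lambda>\<omega>. ennreal (matching_change E m (\<delta> (\<omega> 0)) (\<delta>' (\<omega> 0)) (key idx \<omega>))) \<in>
      borel_measurable tape"
proof -
  let ?M = "\<lambda>\<delta> \<omega>. class_matching E (\<delta> (\<omega> 0)) (key idx \<omega>)"
  have "(\<lambda>\<omega>. (?M \<delta> \<omega>, ?M \<delta>' \<omega>)) \<in> measurable tape (count_space UNIV)"
    using assms
    by (intro measurable_Pair_count_space measurable_class_matching finite_range_class_matching)
  from measurable_compose[OF this, of "\<lambda>(M, M'). ennreal (sum m (sym_diff M M'))" borel]
  show ?thesis by (simp add: matching_change_def)
qed

definition reclassify_cost :: "real \<Rightarrow> nat \<Rightarrow> real \<Rightarrow> nat \<Rightarrow> nat \<Rightarrow> real" where
  "reclassify_cost q r c k k' = (if k = k' then 0 else (1 + dominance q r) * c * (q ^ k + q ^ k'))"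

definition edge_cost :: "real \<Rightarrow> nat \<Rightarrow> real \<Rightarrow> nat \<Rightarrow> nat \<Rightarrow> real" where
  "edge_cost q r c k k' = (if k = k' then 0 else (1 + dominance q r) * c * q ^ k)"

lemma reclassify_cost_eq: "reclassify_cost q r c k k' = edge_cost q r c k k' + edge_cost q r c k' k"
  by (simp add: reclassify_cost_def edge_cost_def distrib_left)

lemma edge_cost_nonneg: "0 < q \<Longrightarrow> q < 1 \<Longrightarrow> 0 \<le> c \<Longrightarrow> 0 \<le> edge_cost q r c k k'"
  by (simp add: edge_cost_def dominance_def)

lemma matching_change_edge_le:
  fixes q c :: real
  assumes q: "0 < q" "q < 1" and E: "finite E" "inj_on \<pi> E"
    and r: "edge_sizes_le r E"
    and m: "\<And>g. g \<in> E \<Longrightarrow> 0 \<le> m g" "\<And>g. g \<in> E \<Longrightarrow> m g \<le> c * q ^ d g"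
      "\<And>g. g \<in> E \<Longrightarrow> m g \<le> c * q ^ d' g"
    and c: "0 \<le> c" and agree: "\<And>g. g \<in> E \<Longrightarrow> g \<noteq> e \<Longrightarrow> d' g = d g"
  shows "matching_change E m d d' \<pi> \<le>
    edge_cost q r c (d e) (d' e) * real (influence E (conflict d) \<pi> e) +
    edge_cost q r c (d' e) (d e) * real (influence E (conflict d') \<pi> e)"
proof (cases "d e = d' e")
  case True
  have "d g = d' g" if "g \<in> E" for g using agree[OF that] True by (cases "g = e") simp_all
  then have "matching_change E m d d' \<pi> = 0" by (rule matching_change_eq_0[OF E(1)])
  then show ?thesis using True by (simp add: edge_cost_def)
next
  case False
  then show ?thesis
    using class_matching_reclassify_le[where d = d and d' = d' and m = m and e = e,
        OF q E r m c agree]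
    by (simp add: matching_change_def edge_cost_def)
qed

definition random_classes ::
    "real \<Rightarrow> (real \<Rightarrow> real) \<Rightarrow> 'a set set \<Rightarrow> ('a set \<Rightarrow> real) \<Rightarrow> (real \<Rightarrow> 'a set \<Rightarrow> nat) \<Rightarrow> bool" where
  "random_classes q c E m \<delta> \<longleftrightarrow>
     (\<forall>e\<in>E. (\<lambda>u. \<delta> u e) \<in> measurable borel (count_space UNIV)) \<and>
     (\<forall>u\<in>{0..1}. \<forall>e\<in>E. m e \<le> c u * q ^ \<delta> u e)"

lemma measurable_random_classes:
  "random_classes q c E m \<delta> \<Longrightarrow> e \<in> E \<Longrightarrow> (\<lambda>u. \<delta> u e) \<in> measurable borel (count_space UNIV)"
  by (simp add: random_classes_def)

lemma le_power_random_classes: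
  "random_classes q c E m \<delta> \<Longrightarrow> u \<in> {0..1} \<Longrightarrow> e \<in> E \<Longrightarrow> m e \<le> c u * q ^ \<delta> u e"
  by (simp add: random_classes_def)

lemma random_classes_override_on:
  assumes \<delta>: "random_classes q c E m \<delta>" "random_classes q c E m \<delta>'"
  shows "random_classes q c E m (\<lambda>u. override_on (\<delta> u) (\<delta>' u) A)"
  unfolding random_classes_def
proof (intro conjI ballI)
  fix e assume e: "e \<in> E"
  show "(\<lambda>u. override_on (\<delta> u) (\<delta>' u) A e) \<in> measurable borel (count_space UNIV)"
    using \<delta>[THEN measurable_random_classes, OF e] by (cases "e \<in> A") simp_all
  show "m e \<le> c u * q ^ override_on (\<delta> u) (\<delta>' u) A e" if "u \<in> {0..1}" for u
    using \<delta>[THEN le_power_random_classes, OF that e] by (cases "e \<in> A") simp_all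
qed

lemma expected_reclassify_edge_le:
  fixes q :: real and c :: "real \<Rightarrow> real"
  assumes q: "0 < q" "q < 1" and E: "finite E" "inj_on idx E" and e: "e \<in> E"
    and r: "edge_sizes_le r E"
    and c: "c \<in> borel_measurable borel" "\<And>u. u \<in> {0..1} \<Longrightarrow> 0 \<le> c u" and m: "\<And>g. g \<in> E \<Longrightarrow> 0 \<le> m g"
    and \<delta>: "random_classes q c E m \<delta>" and \<delta>': "random_classes q c E m \<delta>'"
    and agree: "\<And>u g. g \<in> E \<Longrightarrow> g \<noteq> e \<Longrightarrow> \<delta>' u g = \<delta> u g"
  shows "(\<integral>\<^sup>+\<omega>. ennreal (matching_change E m (\<delta> (\<omega> 0)) (\<delta>' (\<omega> 0)) (key idx \<omega>)) \<partial>tape) \<le>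
    (\<integral>\<^sup>+u. ennreal (reclassify_cost q r (c u) (\<delta> u e) (\<delta>' u e)) \<partial>unif)"
proof -
  let ?h = "\<lambda>u. ennreal (edge_cost q r (c u) (\<delta> u e) (\<delta>' u e))"
    and ?h' = "\<lambda>u. ennreal (edge_cost q r (c u) (\<delta>' u e) (\<delta> u e))"
  let ?I = "\<lambda>\<gamma> \<omega>. of_nat (influence E (conflict (\<gamma> (\<omega> 0))) (key idx \<omega>) e) :: ennreal"
  note m\<delta> = measurable_random_classes[OF \<delta>] and m\<delta>' = measurable_random_classes[OF \<delta>']
  note [measurable] = m\<delta>[OF e] m\<delta>'[OF e] c(1)
    measurable_eq_count_space[OF m\<delta>[OF e] m\<delta>'[OF e]]
        measurable_eq_count_space[OF m\<delta>'[OF e] m\<delta>[OF e]]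
  have h [measurable]: "?h \<in> borel_measurable borel" "?h' \<in> borel_measurable borel"
    unfolding edge_cost_def by measurable
  note [measurable] = measurable_tape_compose[OF h(1)] measurable_tape_compose[OF h(2)]
    measurable_influence[OF E(1) m\<delta>] measurable_influence[OF E(1) m\<delta>']
  have "(\<integral>\<^sup>+\<omega>. ennreal (matching_change E m (\<delta> (\<omega> 0)) (\<delta>' (\<omega> 0)) (key idx \<omega>)) \<partial>tape) \<le>
      (\<integral>\<^sup>+\<omega>. ?h (\<omega> 0) * ?I \<delta> \<omega> + ?h' (\<omega> 0) * ?I \<delta>' \<omega> \<partial>tape)"
  proof (rule nn_integral_mono_AE, use AE_inj_on_key[OF E] AE_tape_mem[of 0] in eventually_elim)
    case (elim \<omega>)
    note u = elim(2)
    note change = matching_change_edge_le[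
        where d = "\<delta> (\<omega> 0)" and d' = "\<delta>' (\<omega> 0)" and m = m and e = e,
        OF q E(1) elim(1) r m le_power_random_classes[OF \<delta> u] le_power_random_classes[OF \<delta>' u]
          c(2)[OF u] agree]
    show ?case
      using ennreal_leI[OF change] edge_cost_nonneg[OF q c(2)[OF u]]
      by (simp add: ennreal_mult ennreal_of_nat_eq_real_of_nat)
  qed
  also have "\<dots> = (\<integral>\<^sup>+\<omega>. ?h (\<omega> 0) * ?I \<delta> \<omega> \<partial>tape) + (\<integral>\<^sup>+\<omega>. ?h' (\<omega> 0) * ?I \<delta>' \<omega> \<partial>tape)"
    by (rule nn_integral_add) measurable
  also have "\<dots> \<le> (\<integral>\<^sup>+\<omega>. ?h (\<omega> 0) \<partial>tape) + (\<integral>\<^sup>+\<omega>. ?h' (\<omega> 0) \<partial>tape)"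
    by (intro add_mono expected_influence_le E e symp_conflict irreflp_conflict h
        measurable_influence m\<delta> m\<delta>')
  also have "\<dots> = (\<integral>\<^sup>+u. ?h u + ?h' u \<partial>unif)"
    by (simp only: nn_integral_tape_component[OF h(1)] nn_integral_tape_component[OF h(2)])
      (rule nn_integral_add[symmetric], measurable)
  also have "\<dots> = (\<integral>\<^sup>+u. ennreal (reclassify_cost q r (c u) (\<delta> u e) (\<delta>' u e)) \<partial>unif)"
  proof (rule nn_integral_cong_AE, use AE_unif_mem in eventually_elim)
    case (elim u)
    then show ?case by (simp add: reclassify_cost_eq edge_cost_nonneg[OF q c(2)])
  qed
  finally show ?thesis .
qed

lemma expected_matching_change_triangle:
  assumes E: "finite E" and m: "\<And>g. g \<in> E \<Longrightarrow> 0 \<le> m g"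
    and \<delta>: "random_classes q c E m \<delta>1" "random_classes q c E m \<delta>2" "random_classes q c E m \<delta>3"
  shows "(\<integral>\<^sup>+\<omega>. ennreal (matching_change E m (\<delta>1 (\<omega> 0)) (\<delta>3 (\<omega> 0)) (key idx \<omega>)) \<partial>tape) \<le>
    (\<integral>\<^sup>+\<omega>. ennreal (matching_change E m (\<delta>1 (\<omega> 0)) (\<delta>2 (\<omega> 0)) (key idx \<omega>)) \<partial>tape) +
    (\<integral>\<^sup>+\<omega>. ennreal (matching_change E m (\<delta>2 (\<omega> 0)) (\<delta>3 (\<omega> 0)) (key idx \<omega>)) \<partial>tape)"
proof -
  let ?change = "\<lambda>\<gamma> \<gamma>' \<omega>. ennreal (matching_change E m (\<gamma> (\<omega> 0)) (\<gamma>' (\<omega> 0)) (key idx \<omega>))"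
  have "(\<integral>\<^sup>+\<omega>. ?change \<delta>1 \<delta>3 \<omega> \<partial>tape) \<le> (\<integral>\<^sup>+\<omega>. ?change \<delta>1 \<delta>2 \<omega> + ?change \<delta>2 \<delta>3 \<omega> \<partial>tape)"
    using matching_change_triangle[OF E m] matching_change_nonneg[OF E m]
    by (intro nn_integral_mono) (simp add: ennreal_leI flip: ennreal_plus)
  also have "\<dots> = (\<integral>\<^sup>+\<omega>. ?change \<delta>1 \<delta>2 \<omega> \<partial>tape) + (\<integral>\<^sup>+\<omega>. ?change \<delta>2 \<delta>3 \<omega> \<partial>tape)"
    by (intro nn_integral_add measurable_matching_change E \<delta>[THEN measurable_random_classes])
  finally show ?thesis .
qed

text \<open>One edge after the other is moved from its class under \<open>\<delta>\<close> to its class under \<open>\<delta>'\<close>.\<close>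

lemma expected_matching_change_le:
  fixes q :: real and c :: "real \<Rightarrow> real"
  assumes q: "0 < q" "q < 1" and E: "finite E" "inj_on idx E" and r: "edge_sizes_le r E"
    and c: "c \<in> borel_measurable borel" "\<And>u. u \<in> {0..1} \<Longrightarrow> 0 \<le> c u" and m: "\<And>g. g \<in> E \<Longrightarrow> 0 \<le> m g"
    and \<delta>: "random_classes q c E m \<delta>" "random_classes q c E m \<delta>'"
  shows "(\<integral>\<^sup>+\<omega>. ennreal (matching_change E m (\<delta> (\<omega> 0)) (\<delta>' (\<omega> 0)) (key idx \<omega>)) \<partial>tape) \<le>
    (\<Sum>e\<in>E. \<integral>\<^sup>+u. ennreal (reclassify_cost q r (c u) (\<delta> u e) (\<delta>' u e)) \<partial>unif)"
proof -
  let ?mixed = "\<lambda>A u. override_on (\<delta> u) (\<delta>' u) A"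
  let ?change = "\<lambda>\<gamma> \<gamma>'. \<integral>\<^sup>+\<omega>. ennreal (matching_change E m (\<gamma> (\<omega> 0)) (\<gamma>' (\<omega> 0)) (key idx \<omega>)) \<partial>tape"
  let ?cost = "\<lambda>e. \<integral>\<^sup>+u. ennreal (reclassify_cost q r (c u) (\<delta> u e) (\<delta>' u e)) \<partial>unif"
  note mixed = random_classes_override_on[OF \<delta>]
  have "?change \<delta> (?mixed A) \<le> (\<Sum>e\<in>A. ?cost e)" if "A \<subseteq> E" for A
    using finite_subset[OF that E(1)] that
  proof (induction A rule: finite_induct)
    case empty
    then show ?case by (simp add: matching_change_def)
  next
    case (insert e A)
    have "?change (?mixed A) (?mixed (insert e A)) \<le>
        (\<integral>\<^sup>+u. ennreal (reclassify_cost q r (c u) (?mixed A u e) (?mixed (insert e A) u e)) \<partial>unif)"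
      by (rule expected_reclassify_edge_le[OF q E _ r c m mixed mixed])
        (use insert.prems in \<open>auto simp: override_on_def\<close>)
    then have "?change (?mixed A) (?mixed (insert e A)) \<le> ?cost e" using insert.hyps by simp
    moreover have "?change \<delta> (?mixed (insert e A)) \<le>
        ?change \<delta> (?mixed A) + ?change (?mixed A) (?mixed (insert e A))"
      by (rule expected_matching_change_triangle[OF E(1) m \<delta>(1) mixed mixed])
    moreover have "?change \<delta> (?mixed A) \<le> (\<Sum>e\<in>A. ?cost e)" using insert by simp
    ultimately have "?change \<delta> (?mixed (insert e A)) \<le> (\<Sum>e\<in>A. ?cost e) + ?cost e"
      by (meson add_mono order_trans)
    then show ?case using insert.hyps by (simp add: add.commute)
  qed
  moreover have "class_matching E (?mixed E u) \<pi> = class_matching E (\<delta>' u) \<pi>" for u \<pi>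
    by (rule class_matching_cong[OF E(1)]) simp_all
  then have "?change \<delta> (?mixed E) = ?change \<delta> \<delta>'" by (simp add: matching_change_def)
  ultimately show ?thesis by fastforce
qed

section \<open>Lipschitz continuity\<close>

lemma normalized_distance_le_ordered:
  fixes w w' :: "'a \<Rightarrow> real"
  assumes w: "\<And>e. e \<in> E \<Longrightarrow> 0 \<le> w e" and S: "0 < sum w E" "sum w E \<le> sum w' E"
  shows "sum w' E * (\<Sum>e\<in>E. \<bar>w e / sum w E - w' e / sum w' E\<bar>) \<le> 2 * (\<Sum>e\<in>E. \<bar>w e - w' e\<bar>)"
proof -
  define s s' where "s = sum w E" and "s' = sum w' E"
  have s: "0 < s" "s \<le> s'" using S by (auto simp: s_def s'_def)
  have edge: "s' * \<bar>w e / s - w' e / s'\<bar> \<le> \<bar>w e - w' e\<bar> + w e * ((s' - s) / s)" if "e \<in> E" for e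
  proof -
    have "s' * \<bar>w e / s - w' e / s'\<bar> = \<bar>s' * (w e / s - w' e / s')\<bar>" using s by (simp add: abs_mult)
    also have "s' * (w e / s - w' e / s') = (w e - w' e) + w e * ((s' - s) / s)"
      using s by (simp add: field_simps)
    also have "\<bar>\<dots>\<bar> \<le> \<bar>w e - w' e\<bar> + \<bar>w e * ((s' - s) / s)\<bar>" by (rule abs_triangle_ineq)
    also have "\<bar>w e * ((s' - s) / s)\<bar> = w e * ((s' - s) / s)" using s w[OF that] by simp
    finally show ?thesis .
  qed
  have "s' * (\<Sum>e\<in>E. \<bar>w e / s - w' e / s'\<bar>) \<le> (\<Sum>e\<in>E. \<bar>w e - w' e\<bar> + w e * ((s' - s) / s))"
    unfolding sum_distrib_left by (rule sum_mono[OF edge])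
  also have "\<dots> = (\<Sum>e\<in>E. \<bar>w e - w' e\<bar>) + s * ((s' - s) / s)"
    by (simp only: sum.distrib s_def flip: sum_distrib_right)
  also have "s * ((s' - s) / s) = (\<Sum>e\<in>E. w' e - w e)"
    using s by (simp add: s_def s'_def sum_subtractf)
  also have "\<dots> \<le> (\<Sum>e\<in>E. \<bar>w e - w' e\<bar>)" by (rule sum_mono) auto
  finally show ?thesis by (simp add: s_def s'_def)
qed

lemma normalized_distance_le:
  fixes w w' :: "'a \<Rightarrow> real"
  assumes w: "\<And>e. e \<in> E \<Longrightarrow> 0 \<le> w e" "\<And>e. e \<in> E \<Longrightarrow> 0 \<le> w' e" and S: "0 < sum w E" "0 < sum w' E"
  shows "max (sum w E) (sum w' E) * (\<Sum>e\<in>E. \<bar>w e / sum w E - w' e / sum w' E\<bar>) \<le>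
      2 * (\<Sum>e\<in>E. \<bar>w e - w' e\<bar>)"
proof (cases "sum w E \<le> sum w' E")
  case True
  then show ?thesis
    using normalized_distance_le_ordered[OF w(1) S(1) True] by (simp add: max_absorb2)
next
  case False
  then show ?thesis
    using normalized_distance_le_ordered[OF w(2) S(2), where w' = w]
    by (simp add: max_absorb1 abs_minus_commute)
qed

lemma weight_le_power_class:
  assumes q: "0 < q" "q < 1" and E: "finite E" and w: "\<And>e. e \<in> E \<Longrightarrow> 0 \<le> w e"
    and S: "sum w E \<le> S" and u: "u \<in> {0..1}" and e: "e \<in> E"
  shows "w e \<le> scale q u * (S / q) * q ^ classes q L E w u e"
proof -
  let ?t = "scale q u * sum w E"
  have bounds: "0 \<le> w e" "w e \<le> sum w E" "0 \<le> scale q u" "q \<le> scale q u"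
    using w e E q scale_bounds[OF q u] member_le_sum[of e E w] by auto
  then have "q * w e \<le> ?t" "0 \<le> ?t" using q by (auto intro!: mult_mono)
  then have "q * w e \<le> ?t * q ^ classes q L E w u e"
    unfolding classes_def by (intro weight_le_power_level q)
  also have "\<dots> \<le> scale q u * S * q ^ classes q L E w u e"
    using S bounds q by (intro mult_right_mono mult_left_mono) auto
  finally show ?thesis using q by (simp add: field_simps)
qed

lemma random_classes_classes:
  assumes "0 < q" "q < 1" "finite E" "\<And>e. e \<in> E \<Longrightarrow> 0 \<le> w e" "sum w E \<le> S" "\<And>e. e \<in> E \<Longrightarrow> m e \<le> w e"
  shows "random_classes q (\<lambda>u. scale q u * (S / q)) E m (classes q L E w)"
  unfolding random_classes_def
proof (intro conjI ballI measurable_classes)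
  fix u :: real and e assume "u \<in> {0..1}" "e \<in> E"
  then show "m e \<le> scale q u * (S / q) * q ^ classes q L E w u e"
    using assms(6) weight_le_power_class[OF assms(1-5)] by (meson order_trans)
qed

definition change_factor :: "real \<Rightarrow> nat \<Rightarrow> real" where
  "change_factor q r = 2 * ((1 + dominance q r) / q * ((1 + q) / (1 - q)))"

lemma expected_classes_change_le:
  assumes q: "0 < q" "q < 1" and S: "0 < sum w E" "0 < sum w' E" and s: "0 \<le> s"
  shows "(\<integral>\<^sup>+u. ennreal (reclassify_cost q r (scale q u * (s / q))
      (classes q L E w u e) (classes q L E w' u e)) \<partial>unif)
    \<le> ennreal ((1 + dominance q r) / q * ((1 + q) / (1 - q)) * s *
        \<bar>w e / sum w E - w' e / sum w' E\<bar>)"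
proof -
  let ?x = "w e / sum w E" and ?y = "w' e / sum w' E" and ?K = "(1 + dominance q r) / q * s"
  have K: "0 \<le> ?K" using q s by (simp add: dominance_def)
  have "(\<integral>\<^sup>+u. ennreal (reclassify_cost q r (scale q u * (s / q))
      (classes q L E w u e) (classes q L E w' u e)) \<partial>unif) =
    (\<integral>\<^sup>+u. ennreal ?K * ennreal (class_change q L ?x ?y u) \<partial>unif)"
    using K by (intro nn_integral_cong)
      (simp add: reclassify_cost_def class_change_def Let_def classes_normalize S mult_ac
          flip: ennreal_mult')
  also have "\<dots> = ennreal ?K * (\<integral>\<^sup>+u. ennreal (class_change q L ?x ?y u) \<partial>unif)"
    using measurable_class_change[measurable] by (intro nn_integral_cmult) measurable
  also have "\<dots> \<le> ennreal ?K * ennreal ((1 + q) / (1 - q) * \<bar>?x - ?y\<bar>)"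
    by (intro mult_left_mono expected_class_change_le q) simp
  also have "\<dots> = ennreal (?K * ((1 + q) / (1 - q) * \<bar>?x - ?y\<bar>))"
    by (rule ennreal_mult'[OF K, symmetric])
  finally show ?thesis by (simp add: mult_ac)
qed

lemma expected_class_matching_change_le:
  fixes w w' :: "'a set \<Rightarrow> real"
  assumes q: "0 < q" "q < 1" and E: "finite E" "inj_on idx E"
    and r: "edge_sizes_le r E"
    and w: "\<And>e. e \<in> E \<Longrightarrow> 0 \<le> w e" "\<And>e. e \<in> E \<Longrightarrow> 0 \<le> w' e"
  shows "(\<integral>\<^sup>+\<omega>. ennreal (matching_change E (\<lambda>g. min (w g) (w' g))
      (classes q L E w (\<omega> 0)) (classes q L E w' (\<omega> 0)) (key idx \<omega>)) \<partial>tape)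
    \<le> ennreal (change_factor q r * (\<Sum>e\<in>E. \<bar>w e - w' e\<bar>))"
    (is "?lhs \<le> _")
proof (cases "0 < sum w E \<and> 0 < sum w' E")
  case True
  then have S: "0 < sum w E" "0 < sum w' E" by auto
  define s where "s = max (sum w E) (sum w' E)"
  let ?c = "\<lambda>u. scale q u * (s / q)" and ?K = "(1 + dominance q r) / q * ((1 + q) / (1 - q))"
  have s: "0 \<le> s" "sum w E \<le> s" "sum w' E \<le> s" using S by (auto simp: s_def)
  have K: "0 \<le> ?K" using q by (simp add: dominance_def)
  have "?lhs \<le> (\<Sum>e\<in>E. \<integral>\<^sup>+u. ennreal (reclassify_cost q r (?c u)
      (classes q L E w u e) (classes q L E w' u e)) \<partial>unif)"
  proof (rule expected_matching_change_le[OF q E r])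
    show "0 \<le> ?c u" if "u \<in> {0..1}" for u using scale_bounds[OF q that] q s by simp
    show "random_classes q ?c E (\<lambda>g. min (w g) (w' g)) (classes q L E w)"
      by (intro random_classes_classes[OF q E(1) w(1) s(2)] min.cobounded1)
    show "random_classes q ?c E (\<lambda>g. min (w g) (w' g)) (classes q L E w')"
      by (intro random_classes_classes[OF q E(1) w(2) s(3)] min.cobounded2)
  qed (use w in simp_all)
  also have "\<dots> \<le> (\<Sum>e\<in>E. ennreal (?K * s * \<bar>w e / sum w E - w' e / sum w' E\<bar>))"
    by (intro sum_mono expected_classes_change_le q S s(1))
  also have "\<dots> = ennreal (\<Sum>e\<in>E. ?K * s * \<bar>w e / sum w E - w' e / sum w' E\<bar>)"
    by (intro sum_ennreal mult_nonneg_nonneg[OF mult_nonneg_nonneg[OF K s(1)]]) simp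
  also have "\<dots> = ennreal (?K * (s * (\<Sum>e\<in>E. \<bar>w e / sum w E - w' e / sum w' E\<bar>)))"
    by (simp only: sum_distrib_left mult.assoc)
  also have "\<dots> \<le> ennreal (?K * (2 * (\<Sum>e\<in>E. \<bar>w e - w' e\<bar>)))"
    unfolding s_def by (intro ennreal_leI mult_left_mono[OF _ K] normalized_distance_le w S)
  also have "?K * (2 * (\<Sum>e\<in>E. \<bar>w e - w' e\<bar>)) = change_factor q r * (\<Sum>e\<in>E. \<bar>w e - w' e\<bar>)"
    by (simp only: change_factor_def mult_ac)
  finally show ?thesis .
next
  case False
  have "sum w E = 0 \<or> sum w' E = 0"
    using False sum_nonneg[of E w] sum_nonneg[of E w'] w by force
  then have "min (w e) (w' e) = 0" if "e \<in> E" for e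
    using that w[OF that] sum_nonneg_eq_0_iff[OF E(1)] w by (metis min_absorb1 min_absorb2)
  then have "matching_change E (\<lambda>g. min (w g) (w' g)) d d' \<pi> = 0" for d d' \<pi>
    unfolding matching_change_def using class_matching_subset[OF E(1)] by (intro sum.neutral) blast
  then show ?thesis by simp
qed

section \<open>Approximation ratio\<close>

lemma card_disjoint_meeting_le:
  assumes A: "finite A" "disjoint A" and g: "finite g"
  shows "card {e \<in> A. e \<inter> g \<noteq> {}} \<le> card g"
proof -
  have "card {e \<in> A. x \<in> e} \<le> Suc 0" for x
    using A by (subst card_le_Suc0_iff_eq) (auto simp: disjoint_def)
  then have "(\<Sum>x\<in>g. card {e \<in> A. x \<in> e}) \<le> (\<Sum>x\<in>g. 1)" by (intro sum_mono) simp
  moreover have "{e \<in> A. e \<inter> g \<noteq> {}} = (\<Union>x\<in>g. {e \<in> A. x \<in> e})" by auto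
  ultimately show ?thesis
    using card_UN_le[OF g, of "\<lambda>x. {e \<in> A. x \<in> e}"] by simp
qed

lemma greedy_meets_class:
  assumes "finite E" "e \<in> E" "e \<noteq> {}"
  shows "\<exists>f\<in>greedy E (conflict d) \<pi>. e \<inter> f \<noteq> {} \<and> d e = d f"
proof (cases "e \<in> greedy E (conflict d) \<pi>")
  case True
  then show ?thesis using assms(3) by (intro bexI[of _ e]) auto
next
  case False
  then obtain f where "f \<in> greedy E (conflict d) \<pi>" "conflict d f e"
    using greedy_mem_iff[OF assms(1,2), of "conflict d" \<pi>] by blast
  then show ?thesis by (auto simp: conflict_def Int_commute)
qed

lemma greedy_class_weight_ge:
  fixes v :: "nat \<Rightarrow> real"
  assumes E: "finite E" "{} \<notin> E" and r: "edge_sizes_le r E"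
    and A: "A \<subseteq> E" "disjoint A" and v: "\<And>k. 0 \<le> v k"
  shows "(\<Sum>e\<in>A. v (d e)) \<le> real r * (\<Sum>f\<in>greedy E (conflict d) \<pi>. v (d f))"
proof -
  let ?M = "greedy E (conflict d) \<pi>"
  have fin: "finite ?M" "finite A"
    using finite_subset[OF greedy_subset[OF E(1)] E(1)] finite_subset[OF A(1) E(1)] by auto
  have "\<exists>f\<in>?M. e \<inter> f \<noteq> {} \<and> d e = d f" if "e \<in> A" for e
    by (rule greedy_meets_class[OF E(1)]) (use A(1) E(2) that in auto)
  then obtain \<phi> where \<phi>: "\<And>e. e \<in> A \<Longrightarrow> \<phi> e \<in> ?M \<and> e \<inter> \<phi> e \<noteq> {} \<and> d e = d (\<phi> e)" by metis
  have "(\<Sum>e\<in>A. v (d e)) = (\<Sum>f\<in>?M. \<Sum>e | e \<in> A \<and> \<phi> e = f. v (d e))"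
    by (rule sum.group[symmetric]) (use fin \<phi> in auto)
  also have "\<dots> \<le> (\<Sum>f\<in>?M. real r * v (d f))"
  proof (rule sum_mono)
    fix f assume f: "f \<in> ?M"
    have "card {e \<in> A. \<phi> e = f} \<le> card {e \<in> A. e \<inter> f \<noteq> {}}"
      using fin(2) \<phi> by (intro card_mono) auto
    also have "\<dots> \<le> r"
      using card_disjoint_meeting_le[OF fin(2) A(2), of f] r f greedy_subset[OF E(1)]
      by (fastforce simp: edge_sizes_le_def)
    finally have "real (card {e \<in> A. \<phi> e = f}) * v (d f) \<le> real r * v (d f)"
      using v by (intro mult_right_mono) auto
    moreover have "(\<Sum>e | e \<in> A \<and> \<phi> e = f. v (d e)) = (\<Sum>e | e \<in> A \<and> \<phi> e = f. v (d f))"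
      using \<phi> by (intro sum.cong) auto
    ultimately show "(\<Sum>e | e \<in> A \<and> \<phi> e = f. v (d e)) \<le> real r * v (d f)" by simp
  qed
  finally show ?thesis by (simp add: sum_distrib_left)
qed

lemma undominated_weight_ge:
  fixes q :: real
  assumes q: "0 < q" "q < 1" and M: "finite M" "conflict_free d M"
    and r: "edge_sizes_le r M"
  shows "(1 - dominance q r) * (\<Sum>e\<in>M. if d e < L then q ^ d e else 0) \<le>
    (\<Sum>e\<in>undominated d M. if d e < L then q ^ d e else 0)"
proof -
  let ?F = "undominated d M" and ?v = "\<lambda>e. if d e < L then q ^ d e else 0"
  have truncate: "sum ?v X = (\<Sum>e | e \<in> X \<and> d e < L. q ^ d e)" if "finite X" for X
    using that by (simp add: sum.inter_filter)
  have "(\<Sum>e | e \<in> M - ?F \<and> d e < L. q ^ d e) \<le> dominance q r * (\<Sum>e | e \<in> M \<and> d e < L. q ^ d e)"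
  proof (rule sum_dominated_le[OF q M])
    show "\<exists>f\<in>{e. e \<in> M \<and> d e < L}. g \<inter> f \<noteq> {} \<and> d f < d g" if "g \<in> {e. e \<in> M - ?F \<and> d e < L}" for g
      using that unfolding undominated_def by fastforce
    show "edge_sizes_le r {e. e \<in> M \<and> d e < L}" by (rule edge_sizes_le_subset[OF r]) auto
  qed (use M(1) in auto)
  then have "sum ?v (M - ?F) \<le> dominance q r * sum ?v M" using M(1) by (simp add: truncate)
  moreover have "sum ?v (M - ?F) = sum ?v M - sum ?v ?F"
    using M(1) undominated_subset[of d M] by (intro sum_diff)
  ultimately show ?thesis by (simp add: left_diff_distrib)
qed

lemma class_matching_rounded_weight_ge:
  assumes q: "0 < q" "q < 1" and E: "finite E" "inj_on \<pi> E" and dom: "dominance q r \<le> 1"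
    and r: "0 < r" "{} \<notin> E" "edge_sizes_le r E"
    and w: "\<And>e. e \<in> E \<Longrightarrow> 0 \<le> w e" and u: "u \<in> {0..1}"
    and A: "A \<subseteq> E" "disjoint A"
  shows "(1 - dominance q r) / real r * (\<Sum>e\<in>A. rounded q L (scale q u * sum w E) (w e)) \<le>
    sum w (class_matching E (classes q L E w u) \<pi>)"
proof -
  let ?d = "classes q L E w u" and ?t = "scale q u * sum w E"
  let ?M = "greedy E (conflict ?d) \<pi>" and ?v = "\<lambda>k. if k < L then q ^ k else 0"
  let ?F = "class_matching E ?d \<pi>"
  have t: "0 \<le> ?t" using scale_bounds[OF q u] q w by (simp add: sum_nonneg)
  have ME: "?M \<subseteq> E" by (rule greedy_subset[OF E(1)])
  have rounded_eq: "rounded q L ?t (w e) = ?t * ?v (?d e)" for e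
    by (simp add: rounded_def classes_def)
  have "(\<Sum>e\<in>A. ?v (?d e)) \<le> real r * (\<Sum>e\<in>?M. ?v (?d e))"
    by (rule greedy_class_weight_ge[OF E(1) r(2,3) A]) (use q in auto)
  then have "(1 - dominance q r) / real r * (\<Sum>e\<in>A. ?v (?d e)) \<le>
      (1 - dominance q r) / real r * (real r * (\<Sum>e\<in>?M. ?v (?d e)))"
    using dom by (intro mult_left_mono) auto
  also have "\<dots> = (1 - dominance q r) * (\<Sum>e\<in>?M. ?v (?d e))" using r(1) by simp
  also have "\<dots> \<le> (\<Sum>e\<in>?F. ?v (?d e))"
    unfolding class_matching_def
    by (rule undominated_weight_ge[OF q finite_subset[OF ME E(1)] conflict_free_greedy[OF E]
          edge_sizes_le_subset[OF r(3) ME]])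
  finally have "?t * ((1 - dominance q r) / real r * (\<Sum>e\<in>A. ?v (?d e))) \<le> ?t * (\<Sum>e\<in>?F. ?v (?d e))"
    by (rule mult_left_mono[OF _ t])
  then have "(1 - dominance q r) / real r * (\<Sum>e\<in>A. rounded q L ?t (w e)) \<le>
      (\<Sum>e\<in>?F. rounded q L ?t (w e))"
    unfolding rounded_eq by (simp only: sum_distrib_left mult_ac)
  also have "\<dots> \<le> sum w ?F"
    using class_matching_subset[OF E(1)] w by (intro sum_mono rounded_le q t) auto
  finally show ?thesis .
qed

lemma ennreal_sum_le: "ennreal (sum f A) \<le> (\<Sum>x\<in>A. ennreal (f x))"
proof -
  have "ennreal (sum f A) \<le> ennreal (\<Sum>x\<in>A. max 0 (f x))" by (intro ennreal_leI sum_mono) simp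
  also have "\<dots> = (\<Sum>x\<in>A. ennreal (max 0 (f x)))" by (rule sum_ennreal[symmetric]) simp
  also have "\<dots> = (\<Sum>x\<in>A. ennreal (f x))" by (intro sum.cong refl) (simp add: max_def ennreal_neg)
  finally show ?thesis .
qed

lemma expected_rounded_weight_ge:
  assumes q: "0 < q" "q < 1" and L: "2 \<le> L" and x: "0 \<le> x" "x \<le> S"
  shows "ennreal (sqrt q * (x - S * q ^ (L - 1))) \<le>
      (\<integral>\<^sup>+u. ennreal (rounded q L (scale q u * S) x) \<partial>unif)"
proof (cases "S = 0")
  case True
  then show ?thesis using x by simp
next
  case False
  then have S: "0 < S" using x by simp
  then have "sqrt q * (x - S * q ^ (L - 1)) = S * (sqrt q * (x / S - q ^ (L - 1)))"
    by (simp add: right_diff_distrib)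
  then have "ennreal (sqrt q * (x - S * q ^ (L - 1))) =
      ennreal S * ennreal (sqrt q * (x / S - q ^ (L - 1)))"
    using S by (simp only: ennreal_mult'[OF less_imp_le])
  also have "\<dots> \<le> ennreal S * (\<integral>\<^sup>+u. ennreal (rounded q L (scale q u) (x / S)) \<partial>unif)"
    by (intro mult_left_mono expected_rounded_ge q L) (use x(2) S in simp_all)
  also have "\<dots> = (\<integral>\<^sup>+u. ennreal S * ennreal (rounded q L (scale q u) (x / S)) \<partial>unif)"
    using measurable_rounded[measurable] by (intro nn_integral_cmult[symmetric]) measurable
  also have "\<dots> = (\<integral>\<^sup>+u. ennreal (rounded q L (scale q u * S) x) \<partial>unif)"
    by (simp only: rounded_scale[OF S] ennreal_mult'[OF less_imp_le[OF S]])
  finally show ?thesis .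
qed

lemma expected_class_matching_weight_ge:
  assumes q: "0 < q" "q < 1" and E: "finite E" "inj_on idx E" and dom: "dominance q r \<le> 1"
    and r: "0 < r" "{} \<notin> E" "edge_sizes_le r E"
    and w: "\<And>e. e \<in> E \<Longrightarrow> 0 \<le> w e" and L: "2 \<le> L"
    and A: "A \<subseteq> E" "disjoint A"
  shows "ennreal ((1 - dominance q r) / real r * sqrt q * (\<Sum>e\<in>A. w e - sum w E * q ^ (L - 1))) \<le>
    (\<integral>\<^sup>+\<omega>. ennreal (sum w (class_matching E (classes q L E w (\<omega> 0)) (key idx \<omega>))) \<partial>tape)"
proof -
  let ?K = "(1 - dominance q r) / real r"
  let ?R = "\<lambda>e u. rounded q L (scale q u * sum w E) (w e)"
  have K: "0 \<le> ?K" using dom by simp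
  have meas: "(\<lambda>u. ennreal (?R e u)) \<in> borel_measurable borel" for e
    using measurable_rounded[measurable] by measurable
  note [measurable] = measurable_tape_compose[OF meas]
  have "ennreal (?K * sqrt q * (\<Sum>e\<in>A. w e - sum w E * q ^ (L - 1))) =
      ennreal ?K * ennreal (\<Sum>e\<in>A. sqrt q * (w e - sum w E * q ^ (L - 1)))"
    by (simp only: mult.assoc ennreal_mult'[OF K, symmetric]
        sum_distrib_left[of "sqrt q", symmetric])
  also have "\<dots> \<le> ennreal ?K * (\<Sum>e\<in>A. ennreal (sqrt q * (w e - sum w E * q ^ (L - 1))))"
    by (intro mult_left_mono ennreal_sum_le) simp
  also have "\<dots> \<le> ennreal ?K * (\<Sum>e\<in>A. \<integral>\<^sup>+u. ennreal (?R e u) \<partial>unif)"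
    using A(1) w E(1)
    by (intro mult_left_mono sum_mono expected_rounded_weight_ge q L) (auto intro: member_le_sum)
  also have "\<dots> = ennreal ?K * (\<Sum>e\<in>A. \<integral>\<^sup>+\<omega>. ennreal (?R e (\<omega> 0)) \<partial>tape)"
    by (simp only: nn_integral_tape_component[OF meas])
  also have "\<dots> = (\<integral>\<^sup>+\<omega>. ennreal ?K * (\<Sum>e\<in>A. ennreal (?R e (\<omega> 0))) \<partial>tape)"
    by (subst nn_integral_cmult) (simp_all add: nn_integral_sum)
  also have "\<dots> \<le>
      (\<integral>\<^sup>+\<omega>. ennreal (sum w (class_matching E (classes q L E w (\<omega> 0)) (key idx \<omega>))) \<partial>tape)"
  proof (rule nn_integral_mono_AE, use AE_inj_on_key[OF E] AE_tape_mem[of 0] in eventually_elim)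
    case (elim \<omega>)
    have "0 \<le> scale q (\<omega> 0) * sum w E"
      using scale_bounds[OF q elim(2)] q w by (simp add: sum_nonneg)
    then have "0 \<le> ?R e (\<omega> 0)" for e by (rule rounded_nonneg[OF q(1)])
    then have "ennreal ?K * (\<Sum>e\<in>A. ennreal (?R e (\<omega> 0))) = ennreal (?K * (\<Sum>e\<in>A. ?R e (\<omega> 0)))"
      by (simp only: ennreal_mult'[OF K] sum_ennreal)
    also have "?K * (\<Sum>e\<in>A. ?R e (\<omega> 0)) \<le>
        sum w (class_matching E (classes q L E w (\<omega> 0)) (key idx \<omega>))"
      by (rule class_matching_rounded_weight_ge[OF q E(1) elim(1) dom r w elim(2) A])
    finally show ?case by (simp add: ennreal_leI)
  qed
  finally show ?thesis .
qed

section \<open>The program\<close>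

subsection \<open>Verification conditions\<close>

definition runs :: "(nat \<Rightarrow> real) \<Rightarrow> com \<Rightarrow> state \<Rightarrow> nat \<Rightarrow> (state \<Rightarrow> bool) \<Rightarrow> bool" where
  "runs \<omega> c s b Q \<longleftrightarrow> (\<exists>t s'. exec \<omega> c s t s' \<and> t \<le> b \<and> Q s')"

primrec wp :: "(nat \<Rightarrow> real) \<Rightarrow> com \<Rightarrow> (state \<Rightarrow> bool) \<Rightarrow> state \<Rightarrow> bool" where
  "wp \<omega> Skip Q s = Q s"
| "wp \<omega> (ISet a i e) Q s = Q (iupd a (ival i s) (ival e s) s)"
| "wp \<omega> (RSet a i e) Q s = Q (rupd a (ival i s) (rval e s) s)"
| "wp \<omega> (Sample a i) Q s = Q ((rupd a (ival i s) (\<omega> (drawn s)) s)\<lparr>drawn := Suc (drawn s)\<rparr>)"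
| "wp \<omega> (Seq c d) Q s = wp \<omega> c (wp \<omega> d Q) s"
| "wp \<omega> (Cond b c d) Q s = (if bval b s then wp \<omega> c Q s else wp \<omega> d Q s)"
| "wp \<omega> (While b c) Q s = False"

primrec cost :: "com \<Rightarrow> nat" where
  "cost Skip = 1"
| "cost (ISet a i e) = 1"
| "cost (RSet a i e) = 1"
| "cost (Sample a i) = 1"
| "cost (Seq c d) = cost c + cost d"
| "cost (Cond b c d) = Suc (max (cost c) (cost d))"
| "cost (While b c) = 0"

lemma ints_iupd [simp]: "ints (iupd a i x s) b j = (if b = a \<and> j = i then x else ints s b j)"
  and ints_iupd_other [simp]: "b \<noteq> a \<Longrightarrow> ints (iupd a i x s) b = ints s b"
  and ints_rupd [simp]: "ints (rupd a i y s) = ints s"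
  and reals_iupd [simp]: "reals (iupd a i x s) = reals s"
  and reals_rupd [simp]: "reals (rupd a i y s) b j = (if b = a \<and> j = i then y else reals s b j)"
  and drawn_iupd [simp]: "drawn (iupd a i x s) = drawn s"
  and drawn_rupd [simp]: "drawn (rupd a i y s) = drawn s"
  by (auto simp: iupd_def rupd_def)

lemma runs_mono:
  assumes "runs \<omega> c s b Q" "b \<le> b'" "\<And>s'. Q s' \<Longrightarrow> Q' s'"
  shows "runs \<omega> c s b' Q'"
  using assms unfolding runs_def by (meson order_trans)

lemma runs_Seq:
  assumes "runs \<omega> c s b P" "\<And>s'. P s' \<Longrightarrow> runs \<omega> d s' b' Q"
  shows "runs \<omega> (Seq c d) s (b + b') Q"
  using assms unfolding runs_def by (meson add_mono exec.Seq)

lemma runs_Cond: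
  assumes "bval b s \<Longrightarrow> runs \<omega> c s t Q" "\<not> bval b s \<Longrightarrow> runs \<omega> d s t Q"
  shows "runs \<omega> (Cond b c d) s (Suc t) Q"
  using assms unfolding runs_def by (meson Suc_le_mono exec.CondTrue exec.CondFalse)

lemma runs_wp: "wp \<omega> c Q s \<Longrightarrow> runs \<omega> c s (cost c) Q"
proof (induction c arbitrary: s Q)
  case (Seq c d)
  have "runs \<omega> c s (cost c) (wp \<omega> d Q)" by (rule Seq.IH(1)) (use Seq.prems in simp)
  from runs_Seq[OF this Seq.IH(2)] show ?case by simp
next
  case (Cond b c d)
  have "runs \<omega> c s (max (cost c) (cost d)) Q" if "bval b s"
    using Cond.prems that by (intro runs_mono[OF Cond.IH(1)]) auto
  moreover have "runs \<omega> d s (max (cost c) (cost d)) Q" if "\<not> bval b s"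
    using Cond.prems that by (intro runs_mono[OF Cond.IH(2)]) auto
  ultimately show ?case using runs_Cond[of b s \<omega> c "max (cost c) (cost d)" Q d] by simp
qed (simp_all add: runs_def, (use exec.intros(1-4)[unfolded One_nat_def] in blast)+)

abbreviation scalar :: "nat \<Rightarrow> iexp" where
  "scalar a \<equiv> IGet a (IConst 0)"

definition For :: "nat \<Rightarrow> iexp \<Rightarrow> com \<Rightarrow> com" where
  "For v m c = Seq (ISet v (IConst 0) (IConst 0))
     (While (ILess (scalar v) m) (Seq c (ISet v (IConst 0) (IAdd (scalar v) (IConst 1)))))"

definition for_time :: "nat \<Rightarrow> nat \<Rightarrow> nat" where
  "for_time N b = 2 + N * (b + 2)"

abbreviation advance :: "nat \<Rightarrow> (nat \<Rightarrow> state \<Rightarrow> bool) \<Rightarrow> nat \<Rightarrow> state \<Rightarrow> bool" where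
  "advance v Inv k s \<equiv> ints s v 0 = k \<and> Inv (Suc k) (iupd v 0 (Suc k) s)"

lemma runs_For:
  assumes init: "Inv 0 (iupd v 0 0 s)"
    and step: "\<And>k s. k < N \<Longrightarrow> ints s v 0 = k \<Longrightarrow> Inv k s \<Longrightarrow> runs \<omega> c s b (advance v Inv k)"
    and bound: "\<And>k s. Inv k s \<Longrightarrow> ival m s = N"
  shows "runs \<omega> (For v m c) s (for_time N b) (Inv N)"
proof -
  let ?inc = "ISet v (IConst 0) (IAdd (scalar v) (IConst 1))"
  let ?loop = "While (ILess (scalar v) m) (Seq c ?inc)"
  have loop: "runs \<omega> ?loop s (1 + j * (b + 2)) (Inv N)"
    if "ints s v 0 = k" "Inv k s" "k + j = N" for j k s
    using that
  proof (induction j arbitrary: k s)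
    case 0
    then have "\<not> bval (ILess (scalar v) m) s" using bound[of k s] by simp
    from exec.WhileFalse[OF this, of \<omega> "Seq c ?inc"] show ?case using 0 by (auto simp: runs_def)
  next
    case (Suc j)
    have test: "bval (ILess (scalar v) m) s" using bound[of k s] Suc.prems by simp
    obtain t s' where body: "exec \<omega> c s t s'" "t \<le> b"
      and s': "ints s' v 0 = k" "Inv (Suc k) (iupd v 0 (Suc k) s')"
      using step[of k s] Suc.prems by (auto simp: runs_def)
    have inc: "exec \<omega> ?inc s' 1 (iupd v 0 (Suc k) s')"
      using exec.ISet[of \<omega> v "IConst 0" "IAdd (scalar v) (IConst 1)" s'] s'(1) by simp
    obtain u s'' where
      rest: "exec \<omega> ?loop (iupd v 0 (Suc k) s') u s''" "u \<le> 1 + j * (b + 2)" "Inv N s''"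
      using Suc.IH[OF _ s'(2)] Suc.prems(3) by (auto simp: runs_def)
    have "exec \<omega> ?loop s (Suc (t + 1 + u)) s''"
      by (rule exec.WhileTrue[OF test exec.Seq[OF body(1) inc] rest(1)])
    moreover have "Suc (t + 1 + u) \<le> 1 + Suc j * (b + 2)" using body(2) rest(2) by simp
    ultimately show ?case using rest(3) unfolding runs_def by blast
  qed
  have "runs \<omega> (ISet v (IConst 0) (IConst 0)) s 1 (\<lambda>s'. s' = iupd v 0 0 s)"
    using runs_wp[of \<omega> "ISet v (IConst 0) (IConst 0)"] by simp
  then have "runs \<omega> (For v m c) s (1 + (1 + N * (b + 2))) (Inv N)"
    unfolding For_def by (rule runs_Seq) (use loop[of _ 0 N] init in simp)
  then show ?thesis by (simp add: for_time_def)
qed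

subsection \<open>The code\<close>

text \<open>Integer arrays; \<open>Cells\<close> counts the cells of the adjacency matrix, and \<open>Row\<close> and \<open>Col\<close> tabulate
  the coordinates of a cell because the machine does not divide integers.\<close>

abbreviation (input) Size :: nat where "Size \<equiv> 0"
abbreviation (input) Adj :: nat where "Adj \<equiv> 1"
abbreviation (input) Out :: nat where "Out \<equiv> 2"
abbreviation (input) Cells :: nat where "Cells \<equiv> 3"
abbreviation (input) Cur :: nat where "Cur \<equiv> 4"
abbreviation (input) Other :: nat where "Other \<equiv> 5"
abbreviation (input) Round :: nat where "Round \<equiv> 6"
abbreviation (input) Row :: nat where "Row \<equiv> 7"
abbreviation (input) Col :: nat where "Col \<equiv> 8"
abbreviation (input) Class :: nat where "Class \<equiv> 9"
abbreviation (input) Greedy :: nat where "Greedy \<equiv> 10"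
abbreviation (input) Edge :: nat where "Edge \<equiv> 11"
abbreviation (input) CurRow :: nat where "CurRow \<equiv> 12"
abbreviation (input) CurCol :: nat where "CurCol \<equiv> 13"

text \<open>Real arrays; the first entry of \<open>Threshold\<close> holds the sample \<open>u\<close> until the thresholds are
  computed from it.\<close>

abbreviation (input) Weight :: nat where "Weight \<equiv> 0"
abbreviation (input) Threshold :: nat where "Threshold \<equiv> 1"
abbreviation (input) Key :: nat where "Key \<equiv> 2"
abbreviation (input) Total :: nat where "Total \<equiv> 3"

abbreviation rscalar :: "nat \<Rightarrow> rexp" where
  "rscalar a \<equiv> RGet a (IConst 0)"

abbreviation iat :: "nat \<Rightarrow> nat \<Rightarrow> iexp" where
  "iat a v \<equiv> IGet a (scalar v)"

abbreviation rat :: "nat \<Rightarrow> nat \<Rightarrow> rexp" where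
  "rat a v \<equiv> RGet a (scalar v)"

abbreviation set_scalar :: "nat \<Rightarrow> iexp \<Rightarrow> com" where
  "set_scalar a e \<equiv> ISet a (IConst 0) e"

abbreviation set_at :: "nat \<Rightarrow> nat \<Rightarrow> iexp \<Rightarrow> com" where
  "set_at a v e \<equiv> ISet a (scalar v) e"

definition IEq :: "iexp \<Rightarrow> iexp \<Rightarrow> bexp" where
  "IEq i j = BAnd (BNot (ILess i j)) (BNot (ILess j i))"

definition IPos :: "iexp \<Rightarrow> bexp" where
  "IPos i = ILess (IConst 0) i"

definition BOr :: "bexp \<Rightarrow> bexp \<Rightarrow> bexp" where
  "BOr b c = BNot (BAnd (BNot b) (BNot c))"

lemma bval_simps [simp]:
  "bval (IEq i j) s \<longleftrightarrow> ival i s = ival j s"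
  "bval (IPos i) s \<longleftrightarrow> ival i s \<noteq> 0"
  "bval (BOr b c) s \<longleftrightarrow> bval b s \<or> bval c s"
  by (auto simp: IEq_def IPos_def BOr_def)

definition count_cells :: com where
  "count_cells = For Cur (scalar Size) (set_scalar Cells (IAdd (scalar Cells) (scalar Size)))"

definition scan_cell :: com where
  "scan_cell =
    Seq (set_at Row Cur (scalar CurRow)) (Seq (set_at Col Cur (scalar CurCol))
    (Seq (Sample Key (scalar Cur))
    (Seq (Cond (BAnd (IPos (iat Adj Cur)) (ILess (scalar CurRow) (scalar CurCol)))
            (Seq (set_at Edge Cur (IConst 1))
                 (RSet Total (IConst 0) (RAdd (rscalar Total) (rat Weight Cur))))
            (set_at Edge Cur (IConst 0)))
    (Seq (set_scalar CurCol (IAdd (scalar CurCol) (IConst 1)))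
         (Cond (ILess (scalar CurCol) (scalar Size)) Skip
            (Seq (set_scalar CurCol (IConst 0))
                 (set_scalar CurRow (IAdd (scalar CurRow) (IConst 1)))))))))"

definition first_threshold :: com where
  "first_threshold = RSet Threshold (IConst 0)
    (RDiv (RMul (RAdd (RConst 1) (RMul (RConst 8) (rscalar Threshold))) (rscalar Total))
      (RConst 9))"

definition classify_cell :: com where
  "classify_cell = Cond (RLess (rat Weight Cur) (rscalar Threshold))
    (set_at Class Cur (IAdd (iat Class Cur) (IConst 1))) Skip"

definition classify_round :: com where
  "classify_round = Seq (For Cur (scalar Cells) classify_cell)
    (RSet Threshold (IConst 0) (RDiv (rscalar Threshold) (RConst 9)))"

definition share_vertex :: bexp where
  "share_vertex = BOr (BOr (IEq (iat Row Other) (iat Row Cur)) (IEq (iat Row Other) (iat Col Cur)))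
                      (BOr (IEq (iat Col Other) (iat Row Cur)) (IEq (iat Col Other) (iat Col Cur)))"

definition blocked :: bexp where
  "blocked = BAnd (BAnd (IPos (iat Greedy Other)) (RLess (rat Key Other) (rat Key Cur)))
                  (BAnd (IEq (iat Class Other) (iat Class Cur)) share_vertex)"

definition dominated :: bexp where
  "dominated = BAnd (IPos (iat Greedy Other))
                    (BAnd (ILess (iat Class Other) (iat Class Cur)) share_vertex)"

definition mark_unless_any :: "nat \<Rightarrow> bexp \<Rightarrow> com" where
  "mark_unless_any a b = Seq (set_at a Cur (IConst 1))
    (For Other (scalar Cells) (Cond b (set_at a Cur (IConst 0)) Skip))"

definition sweep_cell :: com where
  "sweep_cell = Cond (IPos (iat Edge Cur)) (mark_unless_any Greedy blocked) Skip"

definition select_cell :: com where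
  "select_cell = Cond (IPos (iat Greedy Cur)) (mark_unless_any Out dominated) Skip"

definition prog :: "nat \<Rightarrow> com" where
  "prog K = Seq (Sample Threshold (IConst 0)) (Seq count_cells
    (Seq (For Cur (scalar Cells) scan_cell) (Seq first_threshold
    (Seq (For Round (IAdd (IAdd (scalar Size) (scalar Size)) (IConst K)) classify_round)
    (Seq (For Round (scalar Cells) (For Cur (scalar Cells) sweep_cell))
         (For Cur (scalar Cells) select_cell))))))"

subsection \<open>Cells and edges\<close>

definition cell :: "nat \<Rightarrow> nat \<Rightarrow> edge" where
  "cell n k = {k div n, k mod n}"

text \<open>The cells of the strict upper triangle represent the edges.\<close>

definition edge_cell :: "ugraph \<Rightarrow> nat \<Rightarrow> bool" where
  "edge_cell G k \<longleftrightarrow> cell (fst G) k \<in> edges G \<and> k div fst G < k mod fst G"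

definition cell_weight :: "ugraph \<Rightarrow> (edge \<Rightarrow> real) \<Rightarrow> nat \<Rightarrow> real" where
  "cell_weight G w k =
    (if k < fst G * fst G \<and> cell (fst G) k \<in> edges G then w (cell (fst G) k) else 0)"

definition edge_index :: "ugraph \<Rightarrow> edge \<Rightarrow> nat" where
  "edge_index G e = Min e * fst G + Max e"

lemma edge_cell_mem: "edge_cell G k \<Longrightarrow> cell (fst G) k \<in> edges G"
  by (simp add: edge_cell_def)

lemma edge_index_cell: "edge_cell G k \<Longrightarrow> edge_index G (cell (fst G) k) = k"
  by (auto simp: edge_index_def cell_def edge_cell_def)

lemma key_cell: "edge_cell G k \<Longrightarrow> key (edge_index G) \<omega> (cell (fst G) k) = \<omega> (Suc k)"
  by (simp add: key_def edge_index_cell)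

lemma row_major_less: "(u::nat) < n \<Longrightarrow> v < n \<Longrightarrow> u * n + v < n * n"
  using mult_le_mono1[of "Suc u" n n] by simp

lemma
  assumes "wf_ugraph G" "e \<in> edges G"
  shows edge_index_less: "edge_index G e < fst G * fst G"
    and cell_edge_index: "cell (fst G) (edge_index G e) = e"
    and edge_cell_edge_index: "edge_cell G (edge_index G e)"
proof -
  have e: "e \<subseteq> {..<fst G}" "card e = 2" using assms by (auto simp: wf_ugraph_def verts_def)
  then obtain a b where ab: "e = {a, b}" "a < b"
    by (metis card_2_iff insert_commute linorder_neqE_nat)
  then have bound: "a < fst G" "b < fst G" using e by auto
  have index: "edge_index G e = a * fst G + b" using ab by (simp add: edge_index_def)
  show "edge_index G e < fst G * fst G" unfolding index by (rule row_major_less[OF bound])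
  have coords: "(a * fst G + b) div fst G = a" "(a * fst G + b) mod fst G = b" using bound by auto
  show "cell (fst G) (edge_index G e) = e" unfolding index cell_def coords using ab by simp
  then show "edge_cell G (edge_index G e)"
    using assms(2) ab(2) unfolding edge_cell_def index coords by simp
qed

lemma inj_on_edge_index: "wf_ugraph G \<Longrightarrow> inj_on (edge_index G) (edges G)"
  by (rule inj_on_inverseI) (rule cell_edge_index)

lemma finite_edges: "wf_ugraph G \<Longrightarrow> finite (edges G)"
  by (rule finite_subset[of _ "Pow {..<fst G}"]) (auto simp: wf_ugraph_def verts_def)

lemma card_edges_le:
  assumes "wf_ugraph G"
  shows "card (edges G) \<le> fst G * fst G"
proof -
  have "card (edges G) \<le> card {..<fst G * fst G}"
    by (rule card_inj_on_le[OF inj_on_edge_index[OF assms]]) (use edge_index_less[OF assms] in auto)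
  then show ?thesis by simp
qed

lemma sum_cell_weight:
  assumes "wf_ugraph G"
  shows "(\<Sum>k<fst G * fst G. if edge_cell G k then cell_weight G w k else 0) = sum w (edges G)"
proof -
  have "(\<Sum>k | k \<in> {..<fst G * fst G} \<and> edge_cell G k. cell_weight G w k) = sum w (edges G)"
  proof (rule sum.reindex_bij_witness[where i = "edge_index G" and j = "cell (fst G)"])
    fix k assume "k \<in> {k. k \<in> {..<fst G * fst G} \<and> edge_cell G k}"
    then show "edge_index G (cell (fst G) k) = k" "cell (fst G) k \<in> edges G"
        "w (cell (fst G) k) = cell_weight G w k"
      using edge_index_cell by (auto simp: edge_cell_def cell_weight_def)
  qed (use assms edge_index_less cell_edge_index edge_cell_edge_index in auto)
  then show ?thesis by (simp only: sum.inter_filter finite_lessThan)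
qed

definition marks :: "ugraph \<Rightarrow> nat \<Rightarrow> edge set \<Rightarrow> state \<Rightarrow> bool" where
  "marks G a A s \<longleftrightarrow>
     (\<forall>k<fst G * fst G. ints s a k \<noteq> 0 \<longleftrightarrow> edge_cell G k \<and> cell (fst G) k \<in> A)"

lemma ex_marked_iff:
  assumes G: "wf_ugraph G" and A: "A \<subseteq> edges G"
    and s: "\<And>k. k < fst G * fst G \<Longrightarrow> P (cell (fst G) k) \<Longrightarrow>
      ints s a k \<noteq> 0 \<longleftrightarrow> edge_cell G k \<and> cell (fst G) k \<in> A"
  shows "(\<exists>k<fst G * fst G. ints s a k \<noteq> 0 \<and> P (cell (fst G) k)) \<longleftrightarrow> (\<exists>f\<in>A. P f)"
proof
  assume "\<exists>k<fst G * fst G. ints s a k \<noteq> 0 \<and> P (cell (fst G) k)"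
  then show "\<exists>f\<in>A. P f" using s by blast
next
  assume "\<exists>f\<in>A. P f"
  then obtain f where f: "f \<in> A" "P f" by blast
  then have "f \<in> edges G" using A by blast
  then show "\<exists>k<fst G * fst G. ints s a k \<noteq> 0 \<and> P (cell (fst G) k)"
    using f s[of "edge_index G f"] edge_index_less[OF G] cell_edge_index[OF G]
      edge_cell_edge_index[OF G]
    by (intro exI[of _ "edge_index G f"]) simp
qed

lemma output_edges_eq:
  assumes G: "wf_ugraph G" and A: "A \<subseteq> edges G" and s: "marks G Out A s"
  shows "output_edges G s = A"
proof (intro equalityI subsetI)
  let ?n = "fst G"
  fix e assume "e \<in> output_edges G s"
  then obtain u v where e: "e = {u, v}" and uv: "u < v" "v < ?n"
    and mark: "ints s Out (u * ?n + v) \<noteq> 0"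
    by (auto simp: output_edges_def)
  have "u * ?n + v < ?n * ?n" using uv by (intro row_major_less) auto
  then have "cell ?n (u * ?n + v) \<in> A" using s mark by (simp add: marks_def)
  moreover have "cell ?n (u * ?n + v) = e" using e uv by (simp add: cell_def)
  ultimately show "e \<in> A" by simp
next
  let ?n = "fst G"
  fix e assume e: "e \<in> A"
  define k where "k = edge_index G e"
  have "e \<in> edges G" using e A by blast
  then have k: "k < ?n * ?n" "cell ?n k = e" "edge_cell G k"
    unfolding k_def using edge_index_less[OF G] cell_edge_index[OF G] edge_cell_edge_index[OF G]
    by auto
  then have "0 < ?n" by (cases "?n = 0") auto
  then have "e = {k div ?n, k mod ?n}" "k div ?n < k mod ?n" "k mod ?n < ?n"
    using k(2,3) by (auto simp: cell_def edge_cell_def)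
  moreover have "ints s Out (k div ?n * ?n + k mod ?n) \<noteq> 0" using s k e by (simp add: marks_def)
  ultimately show "e \<in> output_edges G s" unfolding output_edges_def by blast
qed

subsection \<open>The phases of a run\<close>

locale run_on_graph =
  fixes G :: ugraph and w :: "edge \<Rightarrow> real" and \<omega> :: "nat \<Rightarrow> real" and K :: nat
  assumes wf: "wf_ugraph G"
begin

abbreviation (input) n where "n \<equiv> fst G"
abbreviation (input) E where "E \<equiv> edges G"
abbreviation (input) cls where "cls \<equiv> classes (1/9) (2 * n + K) E w (\<omega> 0)"
abbreviation (input) \<pi> where "\<pi> \<equiv> key (edge_index G) \<omega>"
abbreviation (input) greedy_set where "greedy_set \<equiv> greedy E (conflict cls) \<pi>"

definition cleared :: "state \<Rightarrow> bool" where
  "cleared s \<longleftrightarrow> (\<forall>k. ints s Out k = 0 \<and> ints s Class k = 0 \<and> ints s Greedy k = 0)"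

definition loaded :: "nat \<Rightarrow> state \<Rightarrow> bool" where
  "loaded c s \<longleftrightarrow> ints s Size 0 = n \<and> ints s Cells 0 = c \<and> ints s CurRow 0 = 0 \<and> ints s CurCol 0 = 0 \<and>
     reals s Threshold 0 = \<omega> 0 \<and> reals s Total 0 = 0 \<and> drawn s = 1 \<and> cleared s \<and>
     (\<forall>k<n * n. (ints s Adj k \<noteq> 0 \<longleftrightarrow> cell n k \<in> E) \<and> reals s Weight k = cell_weight G w k)"

lemma runs_sample: "runs \<omega> (Sample Threshold (IConst 0)) (init_state G w) 1 (loaded 0)"
  using runs_wp[of \<omega> "Sample Threshold (IConst 0)" "loaded 0"]
  by (auto simp: loaded_def cleared_def init_state_def Let_def cell_def cell_weight_def)

lemma runs_count_cells:
  assumes "loaded 0 s"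
  shows "runs \<omega> count_cells s (for_time n 1) (loaded (n * n))"
  unfolding count_cells_def
proof (rule runs_For[where Inv = "\<lambda>k. loaded (k * n)"])
  show "runs \<omega> (set_scalar Cells (IAdd (scalar Cells) (scalar Size))) s 1
      (advance Cur (\<lambda>k. loaded (k * n)) k)"
    if "ints s Cur 0 = k" "loaded (k * n) s" for k s
    using runs_wp[of \<omega> "set_scalar Cells (IAdd (scalar Cells) (scalar Size))"] that
    by (simp add: loaded_def cleared_def)
qed (use assms in \<open>simp_all add: loaded_def cleared_def\<close>)

definition cell_scanned :: "nat \<Rightarrow> state \<Rightarrow> bool" where
  "cell_scanned k s \<longleftrightarrow> ints s Row k = k div n \<and> ints s Col k = k mod n \<and>
     (ints s Edge k \<noteq> 0 \<longleftrightarrow> edge_cell G k) \<and> reals s Key k = \<omega> (Suc k)"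

definition scanned :: "state \<Rightarrow> bool" where
  "scanned s \<longleftrightarrow> ints s Size 0 = n \<and> ints s Cells 0 = n * n \<and>
     (\<forall>k<n * n. cell_scanned k s \<and> reals s Weight k = cell_weight G w k)"

definition scanned_to :: "nat \<Rightarrow> state \<Rightarrow> bool" where
  "scanned_to k s \<longleftrightarrow> ints s Size 0 = n \<and> ints s Cells 0 = n * n \<and> drawn s = Suc k \<and>
     ints s CurRow 0 = k div n \<and> ints s CurCol 0 = k mod n \<and>
     (\<forall>j<k. cell_scanned j s) \<and>
     reals s Total 0 = (\<Sum>j<k. if edge_cell G j then cell_weight G w j else 0) \<and>
     (\<forall>j<n * n. (ints s Adj j \<noteq> 0 \<longleftrightarrow> cell n j \<in> E) \<and> reals s Weight j = cell_weight G w j) \<and>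
     reals s Threshold 0 = \<omega> 0 \<and> cleared s"

lemma wp_scan_cell:
  assumes k: "k < n * n" "ints s Cur 0 = k" and s: "scanned_to k s"
  shows "wp \<omega> scan_cell (advance Cur scanned_to k) s"
proof -
  have n: "0 < n" using k by (cases "n = 0") auto
  have step: "Suc k div n = (if Suc (k mod n) < n then k div n else Suc (k div n))"
    "Suc k mod n = (if Suc (k mod n) < n then Suc (k mod n) else 0)"
    using n mod_less_divisor[OF n, of k] by (auto simp: div_Suc mod_Suc)
  have "edge_cell G k \<longleftrightarrow> ints s Adj k \<noteq> 0 \<and> k div n < k mod n"
    using s k by (auto simp: scanned_to_def edge_cell_def)
  then show ?thesis
    using s k unfolding scan_cell_def scanned_to_def cleared_def cell_scanned_def step
    by (auto simp: less_Suc_eq)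
qed

lemma runs_scan:
  assumes "loaded (n * n) s"
  shows "runs \<omega> (For Cur (scalar Cells) scan_cell) s (for_time (n * n) (cost scan_cell))
      (scanned_to (n * n))"
proof (rule runs_For)
  show "scanned_to 0 (iupd Cur 0 0 s)"
    using assms by (simp add: loaded_def scanned_to_def cleared_def)
  show "runs \<omega> scan_cell s (cost scan_cell) (advance Cur scanned_to k)"
    if "k < n * n" "ints s Cur 0 = k" "scanned_to k s" for k s
    by (rule runs_wp, rule wp_scan_cell[OF that])
qed (simp add: scanned_to_def)

definition threshold :: "nat \<Rightarrow> real" where
  "threshold i = scale (1/9) (\<omega> 0) * sum w E * (1/9) ^ i"

definition cell_level :: "nat \<Rightarrow> nat \<Rightarrow> nat" where
  "cell_level i k = level (1/9) i (scale (1/9) (\<omega> 0) * sum w E) (cell_weight G w k)"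

lemma cell_level_0: "cell_level 0 k = 0"
  and cell_level_Suc:
    "cell_level (Suc i) k = cell_level i k + of_bool (cell_weight G w k < threshold i)"
  by (simp_all add: cell_level_def level_def threshold_def)

lemma cell_level_eq_cls:
  assumes "k < n * n" "edge_cell G k"
  shows "cell_level (2 * n + K) k = cls (cell n k)"
  using assms by (simp add: cell_level_def classes_def cell_weight_def edge_cell_mem)

definition classified_by :: "(nat \<Rightarrow> nat) \<Rightarrow> nat \<Rightarrow> state \<Rightarrow> bool" where
  "classified_by l i s \<longleftrightarrow> scanned s \<and> reals s Threshold 0 = threshold i \<and>
     (\<forall>k<n * n. ints s Class k = l k) \<and> (\<forall>k. ints s Out k = 0 \<and> ints s Greedy k = 0)"

lemma runs_first_threshold:
  assumes "scanned_to (n * n) s"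
  shows "runs \<omega> first_threshold s 1 (classified_by (cell_level 0) 0)"
proof -
  have "reals s Total 0 = sum w E"
    using assms sum_cell_weight[OF wf, of w] by (simp add: scanned_to_def)
  then have "wp \<omega> first_threshold (classified_by (cell_level 0) 0) s"
    using assms
    by (simp add: first_threshold_def classified_by_def scanned_to_def scanned_def cell_scanned_def
        cleared_def cell_level_0 threshold_def scale_def field_simps)
  from runs_wp[OF this] show ?thesis by (simp add: first_threshold_def)
qed

lemma runs_classify_cells:
  assumes s: "classified_by (cell_level i) i s"
  shows "runs \<omega> (For Cur (scalar Cells) classify_cell) s (for_time (n * n) 2)
    (\<lambda>s'. classified_by (cell_level (Suc i)) i s' \<and> ints s' Round 0 = ints s Round 0)"
proof -
  define Inv where "Inv k s' \<longleftrightarrow> classified_by (\<lambda>j. cell_level (if j < k then Suc i else i) j) i s' \<and>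
    ints s' Round 0 = ints s Round 0" for k s'
  have "runs \<omega> (For Cur (scalar Cells) classify_cell) s (for_time (n * n) 2) (Inv (n * n))"
  proof (rule runs_For)
    show "Inv 0 (iupd Cur 0 0 s)"
      using s by (simp add: Inv_def classified_by_def scanned_def cell_scanned_def)
    show "runs \<omega> classify_cell s 2 (advance Cur Inv k)"
      if "k < n * n" "ints s Cur 0 = k" "Inv k s" for k s
    proof -
      have "wp \<omega> classify_cell (advance Cur Inv k) s"
        using that
        unfolding Inv_def classify_cell_def classified_by_def scanned_def cell_scanned_def
        by (auto simp: less_Suc_eq cell_level_Suc)
      from runs_wp[OF this] show ?thesis by (simp add: classify_cell_def numeral_2_eq_2)
    qed
  qed (simp add: Inv_def classified_by_def scanned_def)
  then show ?thesis by (rule runs_mono) (auto simp: Inv_def classified_by_def)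
qed

lemma runs_classify:
  assumes "classified_by (cell_level 0) 0 s"
  shows "runs \<omega> (For Round (IAdd (IAdd (scalar Size) (scalar Size)) (IConst K)) classify_round) s
    (for_time (2 * n + K) (for_time (n * n) 2 + 1))
    (classified_by (cell_level (2 * n + K)) (2 * n + K))"
proof (rule runs_For[where Inv = "\<lambda>i. classified_by (cell_level i) i"])
  show "classified_by (cell_level 0) 0 (iupd Round 0 0 s)"
    using assms by (simp add: classified_by_def scanned_def cell_scanned_def)
  fix i s assume s: "ints s Round 0 = i" "classified_by (cell_level i) i s"
  show "runs \<omega> classify_round s (for_time (n * n) 2 + 1)
      (advance Round (\<lambda>i. classified_by (cell_level i) i) i)"
    unfolding classify_round_def
  proof (rule runs_Seq[OF runs_classify_cells[OF s(2)]])
    fix s' assume "classified_by (cell_level (Suc i)) i s' \<and> ints s' Round 0 = ints s Round 0"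
    then show "runs \<omega> (RSet Threshold (IConst 0) (RDiv (rscalar Threshold) (RConst 9))) s' 1
        (advance Round (\<lambda>i. classified_by (cell_level i) i) i)"
      using runs_wp[of \<omega> "RSet Threshold (IConst 0) (RDiv (rscalar Threshold) (RConst 9))"] s(1)
      by (simp add: classified_by_def scanned_def cell_scanned_def threshold_def)
  qed
qed (simp add: classified_by_def scanned_def)

subsection \<open>Greedy matching and selection\<close>

definition classified :: "state \<Rightarrow> bool" where
  "classified s \<longleftrightarrow> scanned s \<and> (\<forall>k<n * n. edge_cell G k \<longrightarrow> ints s Class k = cls (cell n k))"

lemma bval_share_vertex:
  assumes "scanned s" "j < n * n" "k < n * n" "ints s Other 0 = j" "ints s Cur 0 = k"
  shows "bval share_vertex s \<longleftrightarrow> cell n j \<inter> cell n k \<noteq> {}"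
  using assms by (auto simp: share_vertex_def scanned_def cell_scanned_def cell_def)

definition blocker :: "state \<Rightarrow> nat \<Rightarrow> nat \<Rightarrow> bool" where
  "blocker s k j \<longleftrightarrow>
     ints s Greedy j \<noteq> 0 \<and> conflict cls (cell n j) (cell n k) \<and> \<pi> (cell n j) < \<pi> (cell n k)"

definition dominator :: "state \<Rightarrow> nat \<Rightarrow> nat \<Rightarrow> bool" where
  "dominator s k j \<longleftrightarrow>
     ints s Greedy j \<noteq> 0 \<and> cell n k \<inter> cell n j \<noteq> {} \<and> cls (cell n j) < cls (cell n k)"

lemma bval_blocked:
  assumes s: "classified s" "ints s Other 0 = j" "ints s Cur 0 = k" and j: "j < n * n"
    and k: "k < n * n" "edge_cell G k" and marked: "ints s Greedy j \<noteq> 0 \<Longrightarrow> edge_cell G j"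
  shows "bval blocked s \<longleftrightarrow> blocker s k j"
proof (cases "ints s Greedy j \<noteq> 0")
  case True
  have "reals s Key j = \<pi> (cell n j)" "reals s Key k = \<pi> (cell n k)"
    using s j k marked[OF True]
    by (simp_all add: classified_def scanned_def cell_scanned_def key_cell)
  then show ?thesis
    using s j k marked[OF True] bval_share_vertex[of s j k]
    by (auto simp: blocked_def blocker_def classified_def conflict_def)
qed (use s in \<open>simp add: blocked_def blocker_def\<close>)

lemma bval_dominated:
  assumes s: "classified s" "ints s Other 0 = j" "ints s Cur 0 = k" and j: "j < n * n"
    and k: "k < n * n" "edge_cell G k" and marked: "ints s Greedy j \<noteq> 0 \<Longrightarrow> edge_cell G j"
  shows "bval dominated s \<longleftrightarrow> dominator s k j"
  using s j k marked bval_share_vertex[of s j k]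
  by (auto simp: dominated_def dominator_def classified_def)

definition same_outside :: "(nat \<times> nat) set \<Rightarrow> state \<Rightarrow> state \<Rightarrow> bool" where
  "same_outside C s s' \<longleftrightarrow> reals s' = reals s \<and> (\<forall>a j. (a, j) \<notin> C \<longrightarrow> ints s' a j = ints s a j)"

lemma classified_same_outside:
  assumes "classified s" "same_outside {(Other, 0), (a, k)} s s'" "a = Greedy \<or> a = Out"
  shows "classified s'"
  using assms by (auto simp: classified_def scanned_def cell_scanned_def same_outside_def)

lemma runs_mark_unless_any:
  assumes s: "classified s" "ints s Cur 0 = k" and a: "a = Greedy \<or> a = Out"
    and test: "\<And>j s'. j < n * n \<Longrightarrow> classified s' \<Longrightarrow> ints s' Other 0 = j \<Longrightarrow> ints s' Cur 0 = k \<Longrightarrow>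
      same_outside {(Other, 0), (a, k)} s s' \<Longrightarrow> bval b s' \<longleftrightarrow> B j"
  shows "runs \<omega> (mark_unless_any a b) s (1 + for_time (n * n) 2)
    (\<lambda>s'. (ints s' a k \<noteq> 0 \<longleftrightarrow> (\<forall>j<n * n. \<not> B j)) \<and> same_outside {(Other, 0), (a, k)} s s')"
  unfolding mark_unless_any_def
proof (rule runs_Seq)
  let ?c = "Cond b (set_at a Cur (IConst 0)) Skip"
  define Inv where "Inv j s' \<longleftrightarrow>
    (ints s' a k \<noteq> 0 \<longleftrightarrow> (\<forall>i<j. \<not> B i)) \<and> same_outside {(Other, 0), (a, k)} s s'" for j s'
  show "runs \<omega> (set_at a Cur (IConst 1)) s 1 (\<lambda>s'. s' = iupd a k 1 s)"
    using runs_wp[of \<omega> "set_at a Cur (IConst 1)"] s(2) by simp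
  fix s' assume s': "s' = iupd a k 1 s"
  have "runs \<omega> (For Other (scalar Cells) ?c) s' (for_time (n * n) 2) (Inv (n * n))"
  proof (rule runs_For)
    show "Inv 0 (iupd Other 0 0 s')" using a by (auto simp: Inv_def s' same_outside_def)
    show "ival (scalar Cells) s' = n * n" if "Inv j s'" for j s'
      using that s a by (auto simp: Inv_def same_outside_def classified_def scanned_def)
    show "runs \<omega> ?c s' 2 (advance Other Inv j)"
      if j: "j < n * n" "ints s' Other 0 = j" and I: "Inv j s'" for j s'
    proof -
      have same: "same_outside {(Other, 0), (a, k)} s s'" using I by (simp add: Inv_def)
      then have k: "ints s' Cur 0 = k" using s(2) a by (auto simp: same_outside_def)
      have "bval b s' \<longleftrightarrow> B j"
        by (rule test[OF j(1) classified_same_outside[OF s(1) same a] j(2) k same])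
      then have "wp \<omega> ?c (advance Other Inv j) s'"
        using I j(2) k a by (auto simp: Inv_def same_outside_def less_Suc_eq)
      from runs_wp[OF this] show ?thesis by (simp add: numeral_2_eq_2)
    qed
  qed
  then show "runs \<omega> (For Other (scalar Cells) ?c) s' (for_time (n * n) 2)
      (\<lambda>s'. (ints s' a k \<noteq> 0 \<longleftrightarrow> (\<forall>j<n * n. \<not> B j)) \<and> same_outside {(Other, 0), (a, k)} s s')"
    by (rule runs_mono) (simp_all add: Inv_def)
qed

text \<open>The greedy set is computed by repeated in-place sweeps: after \<open>t\<close> sweeps the marks of the
  \<open>t\<close> edges with the smallest keys are final.\<close>

definition rank :: "nat \<Rightarrow> nat" where
  "rank k = card {f \<in> E. \<pi> f < \<pi> (cell n k)}"

definition settled :: "nat \<Rightarrow> nat \<Rightarrow> (nat \<Rightarrow> nat) \<Rightarrow> bool" where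
  "settled t k mark \<longleftrightarrow> (\<forall>j<n * n. mark j \<noteq> 0 \<longrightarrow> edge_cell G j) \<and>
     (\<forall>j<n * n. edge_cell G j \<and> (rank j < t \<or> rank j = t \<and> j < k) \<longrightarrow>
        (mark j \<noteq> 0 \<longleftrightarrow> cell n j \<in> greedy_set))"

definition swept :: "nat \<Rightarrow> nat \<Rightarrow> state \<Rightarrow> bool" where
  "swept t k s \<longleftrightarrow> classified s \<and> ints s Round 0 = t \<and> (\<forall>j. ints s Out j = 0) \<and>
     settled t k (ints s Greedy)"

lemma rank_less:
  assumes "edge_cell G j" "\<pi> (cell n j) < \<pi> (cell n k)"
  shows "rank j < rank k"
  unfolding rank_def
proof (rule psubset_card_mono)
  show "finite {f \<in> E. \<pi> f < \<pi> (cell n k)}" using finite_edges[OF wf] by simp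
  show "{f \<in> E. \<pi> f < \<pi> (cell n j)} \<subset> {f \<in> E. \<pi> f < \<pi> (cell n k)}"
    using assms(2) edge_cell_mem[OF assms(1)] by force
qed

lemma rank_less_cells:
  assumes "edge_cell G k"
  shows "rank k < n * n"
proof -
  have "rank k < card E"
    unfolding rank_def using finite_edges[OF wf] edge_cell_mem[OF assms]
    by (intro psubset_card_mono) auto
  then show ?thesis using card_edges_le[OF wf] by simp
qed

lemma greedy_mem_iff_unblocked:
  assumes s: "settled t k (ints s Greedy)" and k: "edge_cell G k" "rank k \<le> t"
  shows "cell n k \<in> greedy_set \<longleftrightarrow> (\<forall>j<n * n. \<not> blocker s k j)"
proof -
  let ?P = "\<lambda>f. conflict cls f (cell n k) \<and> \<pi> f < \<pi> (cell n k)"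
  have "ints s Greedy j \<noteq> 0 \<longleftrightarrow> edge_cell G j \<and> cell n j \<in> greedy_set"
    if "j < n * n" "?P (cell n j)" for j
  proof (cases "edge_cell G j")
    case True
    then have "rank j < t" using rank_less[OF True] that(2) k(2) by fastforce
    then show ?thesis using s that(1) True unfolding settled_def by blast
  next
    case False
    then show ?thesis using s that(1) unfolding settled_def by blast
  qed
  then have "(\<exists>j<n * n. ints s Greedy j \<noteq> 0 \<and> ?P (cell n j)) \<longleftrightarrow> (\<exists>f\<in>greedy_set. ?P f)"
    by (intro ex_marked_iff[OF wf greedy_subset[OF finite_edges[OF wf]]])
  then show ?thesis
    using greedy_mem_iff[OF finite_edges[OF wf] edge_cell_mem[OF k(1)], of "conflict cls" \<pi>]
    unfolding blocker_def by blast
qed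

lemma settled_update:
  assumes mark: "settled t k mark" and k: "edge_cell G k"
    and x: "rank k \<le> t \<Longrightarrow> x \<noteq> 0 \<longleftrightarrow> cell n k \<in> greedy_set"
  shows "settled t (Suc k) (mark(k := x))"
  using mark k x unfolding settled_def by (auto simp: less_Suc_eq)

lemma settled_skip: "settled t k mark \<Longrightarrow> \<not> edge_cell G k \<Longrightarrow> settled t (Suc k) mark"
  unfolding settled_def by (auto simp: less_Suc_eq)

lemma settled_next_round: "settled t (n * n) mark \<Longrightarrow> settled (Suc t) 0 mark"
  unfolding settled_def by (auto simp: less_Suc_eq)

lemma marks_of_settled: "settled (n * n) 0 (ints s Greedy) \<Longrightarrow> marks G Greedy greedy_set s"
  unfolding settled_def marks_def using rank_less_cells by blast

lemma swept_advance:
  assumes s: "swept t k s" and k: "ints s Cur 0 = k" "edge_cell G k"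
    and same: "same_outside {(Other, 0), (Greedy, k)} s s'"
    and mark: "rank k \<le> t \<Longrightarrow> ints s' Greedy k \<noteq> 0 \<longleftrightarrow> cell n k \<in> greedy_set"
  shows "advance Cur (swept t) k s'"
proof -
  have "classified s'"
    by (rule classified_same_outside[OF _ same]) (use s in \<open>simp_all add: swept_def\<close>)
  then have "classified (iupd Cur 0 (Suc k) s')"
    by (simp add: classified_def scanned_def cell_scanned_def)
  moreover have "ints s' Greedy = (ints s Greedy)(k := ints s' Greedy k)"
    using same by (auto simp: same_outside_def fun_eq_iff)
  then have "settled t (Suc k) (ints s' Greedy)"
    using settled_update[OF _ k(2) mark] s unfolding swept_def by metis
  ultimately show ?thesis using s k(1) same by (simp add: swept_def same_outside_def)
qed

lemma runs_mark_unless_blocked: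
  assumes k: "k < n * n" "ints s Cur 0 = k" "edge_cell G k" and s: "swept t k s"
  shows "runs \<omega> (mark_unless_any Greedy blocked) s (1 + for_time (n * n) 2)
      (advance Cur (swept t) k)"
proof -
  have classified: "classified s" and settled: "settled t k (ints s Greedy)"
    using s by (simp_all add: swept_def)
  have "runs \<omega> (mark_unless_any Greedy blocked) s (1 + for_time (n * n) 2)
    (\<lambda>s'. (ints s' Greedy k \<noteq> 0 \<longleftrightarrow> (\<forall>j<n * n. \<not> blocker s k j)) \<and>
      same_outside {(Other, 0), (Greedy, k)} s s')"
  proof (rule runs_mark_unless_any[OF classified k(2)])
    fix j s' assume s': "j < n * n" "classified s'" "ints s' Other 0 = j" "ints s' Cur 0 = k"
      and same: "same_outside {(Other, 0), (Greedy, k)} s s'"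
    have "edge_cell G j" if "ints s Greedy j \<noteq> 0"
      using settled that s'(1) unfolding settled_def by blast
    then have "edge_cell G j" if "ints s' Greedy j \<noteq> 0"
      using that same k(3) by (cases "j = k") (simp_all add: same_outside_def)
    then have "bval blocked s' \<longleftrightarrow> blocker s' k j" by (rule bval_blocked[OF s'(2-4,1) k(1,3)])
    also have "\<dots> \<longleftrightarrow> blocker s k j"
      using same by (cases "j = k") (simp_all add: same_outside_def blocker_def)
    finally show "bval blocked s' \<longleftrightarrow> blocker s k j" .
  qed simp
  then show ?thesis
    by (rule runs_mono)
      (simp, intro swept_advance[OF s k(2,3)],
        simp_all add: greedy_mem_iff_unblocked[OF settled k(3)])
qed

lemma runs_sweep_cell:
  assumes k: "k < n * n" "ints s Cur 0 = k" and s: "swept t k s"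
  shows "runs \<omega> sweep_cell s (2 + for_time (n * n) 2) (advance Cur (swept t) k)"
proof -
  have test: "bval (IPos (iat Edge Cur)) s \<longleftrightarrow> edge_cell G k"
    using s k by (simp add: swept_def classified_def scanned_def cell_scanned_def)
  have "runs \<omega> sweep_cell s (Suc (1 + for_time (n * n) 2)) (advance Cur (swept t) k)"
    unfolding sweep_cell_def
  proof (rule runs_Cond)
    assume "bval (IPos (iat Edge Cur)) s"
    then show "runs \<omega> (mark_unless_any Greedy blocked) s (1 + for_time (n * n) 2)
        (advance Cur (swept t) k)"
      using test by (intro runs_mark_unless_blocked k s) simp
  next
    assume "\<not> bval (IPos (iat Edge Cur)) s"
    then show "runs \<omega> Skip s (1 + for_time (n * n) 2) (advance Cur (swept t) k)"
      using test s k by (intro runs_mono[OF runs_wp[where Q = "advance Cur (swept t) k"]])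
        (auto simp: swept_def classified_def scanned_def cell_scanned_def settled_skip)
  qed
  then show ?thesis by simp
qed

lemma runs_sweeps:
  assumes "classified_by (cell_level (2 * n + K)) (2 * n + K) s"
  shows "runs \<omega> (For Round (scalar Cells) (For Cur (scalar Cells) sweep_cell)) s
    (for_time (n * n) (for_time (n * n) (2 + for_time (n * n) 2)))
    (\<lambda>s'. classified s' \<and> (\<forall>k. ints s' Out k = 0) \<and> marks G Greedy greedy_set s')"
proof -
  define Inv where "Inv t s' \<longleftrightarrow> swept t 0 (iupd Round 0 t s')" for t s'
  have "runs \<omega> (For Round (scalar Cells) (For Cur (scalar Cells) sweep_cell)) s
    (for_time (n * n) (for_time (n * n) (2 + for_time (n * n) 2))) (Inv (n * n))"
  proof (rule runs_For)
    show "Inv 0 (iupd Round 0 0 s)"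
      using assms by (auto simp: Inv_def swept_def classified_def classified_by_def scanned_def
          cell_scanned_def cell_level_eq_cls settled_def)
    show "ival (scalar Cells) s' = n * n" if "Inv t s'" for t s'
      using that by (simp add: Inv_def swept_def classified_def scanned_def)
    fix t s assume t: "ints s Round 0 = t" and I: "Inv t s"
    have "runs \<omega> (For Cur (scalar Cells) sweep_cell) s (for_time (n * n) (2 + for_time (n * n) 2))
        (swept t (n * n))"
    proof (rule runs_For[OF _ runs_sweep_cell])
      show "swept t 0 (iupd Cur 0 0 s)"
        using t I by (simp add: Inv_def swept_def classified_def scanned_def cell_scanned_def)
      show "ival (scalar Cells) s' = n * n" if "swept t k s'" for k s'
        using that by (simp add: swept_def classified_def scanned_def)
    qed
    then show "runs \<omega> (For Cur (scalar Cells) sweep_cell) s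
        (for_time (n * n) (2 + for_time (n * n) 2))
        (advance Round Inv t)"
      by (rule runs_mono)
        (auto simp: Inv_def swept_def classified_def scanned_def cell_scanned_def
          settled_next_round)
  qed
  then show ?thesis
    by (rule runs_mono)
      (auto simp: Inv_def swept_def classified_def scanned_def cell_scanned_def marks_of_settled)
qed

lemma class_matching_mem_iff_undominated:
  assumes s: "marks G Greedy greedy_set s" and k: "cell n k \<in> greedy_set"
  shows "cell n k \<in> class_matching E cls \<pi> \<longleftrightarrow> (\<forall>j<n * n. \<not> dominator s k j)"
proof -
  let ?P = "\<lambda>f. cell n k \<inter> f \<noteq> {} \<and> cls f < cls (cell n k)"
  have "(\<exists>j<n * n. ints s Greedy j \<noteq> 0 \<and> ?P (cell n j)) \<longleftrightarrow> (\<exists>f\<in>greedy_set. ?P f)"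
    by (rule ex_marked_iff[OF wf greedy_subset[OF finite_edges[OF wf]]])
      (use s in \<open>simp add: marks_def\<close>)
  then show ?thesis
    using k unfolding class_matching_def undominated_def dominator_def by blast
qed

definition selected :: "nat \<Rightarrow> state \<Rightarrow> bool" where
  "selected k s \<longleftrightarrow> classified s \<and> marks G Greedy greedy_set s \<and>
     (\<forall>j<n * n. ints s Out j \<noteq> 0 \<longleftrightarrow> j < k \<and> edge_cell G j \<and> cell n j \<in> class_matching E cls \<pi>)"

lemma selected_advance:
  assumes s: "selected k s" and k: "ints s Cur 0 = k" "edge_cell G k"
    and same: "same_outside {(Other, 0), (Out, k)} s s'"
    and mark: "ints s' Out k \<noteq> 0 \<longleftrightarrow> cell n k \<in> class_matching E cls \<pi>"
  shows "advance Cur selected k s'"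
proof -
  have "classified s'"
    by (rule classified_same_outside[OF _ same]) (use s in \<open>simp_all add: selected_def\<close>)
  then have "classified (iupd Cur 0 (Suc k) s')"
    by (simp add: classified_def scanned_def cell_scanned_def)
  moreover have "ints s' Out j \<noteq> 0 \<longleftrightarrow> j < Suc k \<and> edge_cell G j \<and> cell n j \<in> class_matching E cls \<pi>"
    if "j < n * n" for j
  proof (cases "j = k")
    case False
    then have "ints s' Out j = ints s Out j" using same by (simp add: same_outside_def)
    then show ?thesis using s that False by (simp add: selected_def less_Suc_eq)
  qed (use mark k(2) in simp)
  ultimately show ?thesis using s k(1) same by (simp add: selected_def same_outside_def marks_def)
qed

lemma runs_mark_unless_dominated:
  assumes k: "k < n * n" "ints s Cur 0 = k" "edge_cell G k" "cell n k \<in> greedy_set"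
    and s: "selected k s"
  shows "runs \<omega> (mark_unless_any Out dominated) s (1 + for_time (n * n) 2) (advance Cur selected k)"
proof -
  have classified: "classified s" and marks: "marks G Greedy greedy_set s"
    using s by (simp_all add: selected_def)
  have "runs \<omega> (mark_unless_any Out dominated) s (1 + for_time (n * n) 2)
    (\<lambda>s'. (ints s' Out k \<noteq> 0 \<longleftrightarrow> (\<forall>j<n * n. \<not> dominator s k j)) \<and>
      same_outside {(Other, 0), (Out, k)} s s')"
  proof (rule runs_mark_unless_any[OF classified k(2)])
    fix j s' assume s': "j < n * n" "classified s'" "ints s' Other 0 = j" "ints s' Cur 0 = k"
      and same: "same_outside {(Other, 0), (Out, k)} s s'"
    show "bval dominated s' \<longleftrightarrow> dominator s k j"
      using bval_dominated[OF s'(2-4,1) k(1,3)] same marks s'(1)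
      by (auto simp: same_outside_def marks_def dominator_def)
  qed simp
  then show ?thesis
    by (rule runs_mono)
      (simp, intro selected_advance[OF s k(2,3)],
        simp_all add: class_matching_mem_iff_undominated[OF marks k(4)])
qed

lemma runs_select_cell:
  assumes k: "k < n * n" "ints s Cur 0 = k" and s: "selected k s"
  shows "runs \<omega> select_cell s (2 + for_time (n * n) 2) (advance Cur selected k)"
proof -
  have test: "bval (IPos (iat Greedy Cur)) s \<longleftrightarrow> edge_cell G k \<and> cell n k \<in> greedy_set"
    using s k by (simp add: selected_def marks_def)
  have "runs \<omega> select_cell s (Suc (1 + for_time (n * n) 2)) (advance Cur selected k)"
    unfolding select_cell_def
  proof (rule runs_Cond)
    assume "bval (IPos (iat Greedy Cur)) s"
    then show "runs \<omega> (mark_unless_any Out dominated) s (1 + for_time (n * n) 2)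
        (advance Cur selected k)"
      using test by (intro runs_mark_unless_dominated k s) simp_all
  next
    assume "\<not> bval (IPos (iat Greedy Cur)) s"
    moreover have "class_matching E cls \<pi> \<subseteq> greedy_set"
      unfolding class_matching_def by (rule undominated_subset)
    ultimately show "runs \<omega> Skip s (1 + for_time (n * n) 2) (advance Cur selected k)"
      using test s k by (intro runs_mono[OF runs_wp[where Q = "advance Cur selected k"]])
        (auto simp: selected_def marks_def classified_def scanned_def cell_scanned_def less_Suc_eq)
  qed
  then show ?thesis by simp
qed

lemma runs_select:
  assumes "classified s \<and> (\<forall>k. ints s Out k = 0) \<and> marks G Greedy greedy_set s"
  shows "runs \<omega> (For Cur (scalar Cells) select_cell) s (for_time (n * n) (2 + for_time (n * n) 2))
    (marks G Out (class_matching E cls \<pi>))"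
proof -
  have "runs \<omega> (For Cur (scalar Cells) select_cell) s (for_time (n * n) (2 + for_time (n * n) 2))
      (selected (n * n))"
  proof (rule runs_For[OF _ runs_select_cell])
    show "selected 0 (iupd Cur 0 0 s)"
      using assms by (simp add: selected_def marks_def classified_def scanned_def cell_scanned_def)
  qed (simp_all add: selected_def classified_def scanned_def)
  then show ?thesis by (rule runs_mono) (simp_all add: selected_def marks_def)
qed

end

subsection \<open>Correctness and running time\<close>

definition rand_matching :: "nat \<Rightarrow> ugraph \<Rightarrow> (edge \<Rightarrow> real) \<Rightarrow> (nat \<Rightarrow> real) \<Rightarrow> edge set" where
  "rand_matching K G w \<omega> = class_matching (edges G)
     (classes (1/9) (2 * fst G + K) (edges G) w (\<omega> 0)) (key (edge_index G) \<omega>)"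

definition prog_time :: "nat \<Rightarrow> nat \<Rightarrow> nat" where
  "prog_time K n = 1 + (for_time n 1 + (for_time (n * n) (cost scan_cell) + (1 +
     (for_time (2 * n + K) (for_time (n * n) 2 + 1) +
     (for_time (n * n) (for_time (n * n) (2 + for_time (n * n) 2)) +
      for_time (n * n) (2 + for_time (n * n) 2))))))"

lemma rand_matching_subset: "wf_ugraph G \<Longrightarrow> rand_matching K G w \<omega> \<subseteq> edges G"
  unfolding rand_matching_def by (rule class_matching_subset[OF finite_edges])

lemma (in run_on_graph) runs_prog:
  "runs \<omega> (prog K) (init_state G w) (prog_time K n) (\<lambda>s. output_edges G s = rand_matching K G w \<omega>)"
proof -
  have "runs \<omega> (prog K) (init_state G w) (prog_time K n) (marks G Out (rand_matching K G w \<omega>))"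
    unfolding prog_def prog_time_def rand_matching_def
    by (rule runs_Seq[OF runs_sample runs_Seq[OF runs_count_cells runs_Seq[OF runs_scan
          runs_Seq[OF runs_first_threshold
              runs_Seq[OF runs_classify runs_Seq[OF runs_sweeps runs_select]]]]]])
  then show ?thesis
    by (rule runs_mono) (simp_all add: output_edges_eq[OF wf rand_matching_subset[OF wf]])
qed

lemma prog_time_poly: "\<exists>p :: nat poly. \<forall>n. prog_time K n = poly p n"
proof -
  let ?P = "\<lambda>f :: nat \<Rightarrow> nat. \<exists>p. \<forall>n. f n = poly p n"
  have const: "?P (\<lambda>_. c)" for c by (rule exI[of _ "[:c:]"]) simp
  have id: "?P (\<lambda>n. n)" by (rule exI[of _ "[:0, 1:]"]) simp
  have add: "?P (\<lambda>n. f n + g n)" if "?P f" "?P g" for f g using that by (metis poly_add)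
  have mult: "?P (\<lambda>n. f n * g n)" if "?P f" "?P g" for f g using that by (metis poly_mult)
  show ?thesis
    unfolding prog_time_def for_time_def by (intro add mult const id)
qed

section \<open>The algorithm as a distribution\<close>

definition tape_pmf :: "((nat \<Rightarrow> real) \<Rightarrow> 'a) \<Rightarrow> 'a pmf" where
  "tape_pmf X = Abs_pmf (distr tape (count_space UNIV) X)"

lemma measure_tape_pmf:
  assumes X: "X \<in> measurable tape (count_space UNIV)" and fin: "finite (range X)"
  shows "measure_pmf (tape_pmf X) = distr tape (count_space UNIV) X"
  unfolding tape_pmf_def
proof (rule Abs_pmf_inverse, intro CollectI conjI)
  let ?D = "distr tape (count_space UNIV) X"
  interpret D: prob_space ?D by (rule tape.prob_space_distr[OF X])
  show "prob_space ?D" by (rule tape.prob_space_distr[OF X])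
  show "sets ?D = UNIV" by simp
  have "AE x in ?D. x \<in> range X" using X by (subst AE_distr_iff) auto
  then show "AE x in ?D. measure ?D {x} \<noteq> 0"
    using countable_finite[OF fin] by (subst D.AE_support_countable) auto
qed

lemma map_tape_pmf:
  assumes X: "X \<in> measurable tape (count_space UNIV)" "finite (range X)"
  shows "map_pmf f (tape_pmf X) = tape_pmf (\<lambda>\<omega>. f (X \<omega>))"
proof -
  have fX: "(\<lambda>\<omega>. f (X \<omega>)) \<in> measurable tape (count_space UNIV)"
    by (rule measurable_compose[OF X(1)]) simp
  have "finite (range (\<lambda>\<omega>. f (X \<omega>)))" using finite_imageI[OF X(2), of f] by (simp add: image_image)
  then have "measure_pmf (tape_pmf (\<lambda>\<omega>. f (X \<omega>))) = measure_pmf (map_pmf f (tape_pmf X))"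
    using X fX by (simp add: measure_tape_pmf map_pmf_rep_eq distr_distr comp_def)
  then show ?thesis by (simp add: measure_pmf_inject)
qed

lemma EM_w_tape_pmf_le:
  assumes X: "X \<in> measurable tape (count_space UNIV)" "finite (range X)"
    and Y: "Y \<in> measurable tape (count_space UNIV)" "finite (range Y)"
  shows "EM_w G (tape_pmf X, w) (tape_pmf Y, w') \<le>
      (\<integral>\<^sup>+\<omega>. ennreal (dist_w G (X \<omega>, w) (Y \<omega>, w')) \<partial>tape)"
proof -
  let ?Z = "\<lambda>\<omega>. (X \<omega>, Y \<omega>)"
  have Z: "?Z \<in> measurable tape (count_space UNIV)"
    by (rule measurable_Pair_count_space[OF X Y(1)])
  have finZ: "finite (range ?Z)"
    by (rule finite_subset[OF _ finite_cartesian_product[OF X(2) Y(2)]]) auto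
  have "tape_pmf ?Z \<in> couplings (tape_pmf X) (tape_pmf Y)"
    by (simp add: couplings_def map_tape_pmf[OF Z finZ])
  then have "EM_w G (tape_pmf X, w) (tape_pmf Y, w') \<le>
      (\<integral>\<^sup>+ (F, F'). ennreal (dist_w G (F, w) (F', w')) \<partial>measure_pmf (tape_pmf ?Z))"
    unfolding EM_w_def prod.case by (rule INF_lower)
  also have "\<dots> = (\<integral>\<^sup>+\<omega>. ennreal (dist_w G (X \<omega>, w) (Y \<omega>, w')) \<partial>tape)"
    unfolding measure_tape_pmf[OF Z finZ] by (subst nn_integral_distr[OF Z]) auto
  finally show ?thesis .
qed

definition alg :: "nat \<Rightarrow> rand_alg" where
  "alg K G w = tape_pmf (rand_matching K G w)"

lemma measurable_rand_matching:
  "wf_ugraph G \<Longrightarrow> rand_matching K G w \<in> measurable tape (count_space UNIV)"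
  unfolding rand_matching_def[abs_def]
  by (rule measurable_class_matching[OF finite_edges measurable_classes])

lemma finite_range_rand_matching: "wf_ugraph G \<Longrightarrow> finite (range (rand_matching K G w))"
  unfolding rand_matching_def[abs_def] by (rule finite_range_class_matching[OF finite_edges])

lemma measure_alg:
  "wf_ugraph G \<Longrightarrow> measure_pmf (alg K G w) = distr tape (count_space UNIV) (rand_matching K G w)"
  unfolding alg_def
  by (rule measure_tape_pmf[OF measurable_rand_matching finite_range_rand_matching])

lemma polytime_alg: "polytime_randomized (alg K)"
proof -
  obtain p :: "nat poly" where p: "\<And>n. prog_time K n = poly p n" using prog_time_poly by metis
  show ?thesis
    unfolding polytime_randomized_def
  proof (intro exI[of _ "prog K"] exI[of _ p] allI impI)
    fix G w assume G: "wf_ugraph G"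
    show "\<exists>X. X \<in> measurable tape (count_space UNIV) \<and>
        measure_pmf (alg K G w) = distr tape (count_space UNIV) X \<and>
        (\<forall>\<omega>. (\<forall>i. \<omega> i \<in> {0..1}) \<longrightarrow> (\<exists>t s. exec \<omega> (prog K) (init_state G w) t s \<and>
          t \<le> poly p (fst G) \<and> X \<omega> = output_edges G s))"
    proof (intro exI[of _ "rand_matching K G w"] conjI allI impI)
      show "\<exists>t s. exec \<omega> (prog K) (init_state G w) t s \<and> t \<le> poly p (fst G) \<and>
          rand_matching K G w \<omega> = output_edges G s" for \<omega>
        using run_on_graph.runs_prog[OF run_on_graph.intro[OF G], of \<omega> K w]
        unfolding runs_def p by metis
    qed (rule measurable_rand_matching[OF G] measure_alg[OF G])+
  qed
qed

lemma matching_iff_disjoint: "matching G M \<longleftrightarrow> M \<subseteq> edges G \<and> disjoint M"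
  by (simp add: matching_def disjoint_def)

lemma matching_alg:
  assumes G: "wf_ugraph G" and M: "M \<in> set_pmf (alg K G w)"
  shows "matching G M"
proof -
  have "AE \<omega> in tape. matching G (rand_matching K G w \<omega>)"
    using AE_inj_on_key[OF finite_edges[OF G] inj_on_edge_index[OF G]]
  proof eventually_elim
    case (elim \<omega>)
    then show ?case
      using rand_matching_subset[OF G] disjoint_class_matching[OF finite_edges[OF G] elim]
      by (simp add: matching_iff_disjoint rand_matching_def)
  qed
  then have "AE M in measure_pmf (alg K G w). matching G M"
    unfolding measure_alg[OF G] by (subst AE_distr_iff[OF measurable_rand_matching[OF G]]) auto
  then show ?thesis using M by (simp add: AE_measure_pmf_iff)
qed

lemma weightings_nonneg: "w \<in> weightings G \<Longrightarrow> e \<in> edges G \<Longrightarrow> 0 \<le> w e"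
  by (auto simp: weightings_def)

lemma empty_not_edge: "wf_ugraph G \<Longrightarrow> {} \<notin> edges G"
  by (auto simp: wf_ugraph_def)

lemma edge_sizes_le_edges: "wf_ugraph G \<Longrightarrow> edge_sizes_le 2 (edges G)"
  by (auto simp: wf_ugraph_def edge_sizes_le_def intro: card_ge_0_finite)

subsection \<open>Approximation\<close>

lemma finite_matchings: "wf_ugraph G \<Longrightarrow> finite {M. matching G M}"
  by (rule finite_subset[of _ "Pow (edges G)"]) (use finite_edges in \<open>auto simp: matching_def\<close>)

lemma weight_le_max: "wf_ugraph G \<Longrightarrow> matching G M \<Longrightarrow> weight w M \<le> max_matching_weight G w"
  unfolding max_matching_weight_def using finite_matchings by (intro Max_ge) auto

lemma max_matching_attained:
  assumes "wf_ugraph G"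
  shows "\<exists>M. matching G M \<and> weight w M = max_matching_weight G w"
proof -
  have "matching G {}" by (simp add: matching_def)
  then have "max_matching_weight G w \<in> weight w ` {M. matching G M}"
    unfolding max_matching_weight_def using finite_matchings[OF assms] by (intro Max_in) auto
  then show ?thesis by auto
qed

lemma sum_weights_le_max:
  assumes G: "wf_ugraph G" and w: "w \<in> weightings G"
  shows "sum w (edges G) \<le> real (fst G * fst G) * max_matching_weight G w"
proof -
  have "matching G {}" by (simp add: matching_def)
  from weight_le_max[OF G this] have opt: "0 \<le> max_matching_weight G w" by (simp add: weight_def)
  have "w e \<le> max_matching_weight G w" if "e \<in> edges G" for e
    using weight_le_max[OF G, of "{e}" w] that by (simp add: weight_def matching_def)
  then have "sum w (edges G) \<le> real (card (edges G)) * max_matching_weight G w"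
    by (rule sum_bounded_above)
  also have "\<dots> \<le> real (fst G * fst G) * max_matching_weight G w"
    by (intro mult_right_mono of_nat_mono card_edges_le G opt)
  finally show ?thesis .
qed

lemma fourth_power_le: "real n ^ 4 \<le> 9 ^ (2 * n)"
proof -
  have "real n \<le> 2 ^ n"
    using less_exp[of n] by (metis less_imp_le of_nat_le_iff of_nat_numeral of_nat_power)
  also have "\<dots> \<le> 3 ^ n" by (rule power_mono) simp_all
  finally have "real n ^ 4 \<le> (3 ^ n) ^ 4" by (rule power_mono) simp
  also have "\<dots> = (3 ^ 2) ^ (2 * n)" by (simp only: power_mult[symmetric]) (simp add: mult.commute)
  finally show ?thesis by simp
qed

lemma truncation_loss_le:
  assumes G: "wf_ugraph G" and w: "w \<in> weightings G" and M: "M \<subseteq> edges G" and K: "1 \<le> K"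
  shows "real (card M) * (sum w (edges G) * (1/9) ^ (2 * fst G + K - 1)) \<le>
    (1/9) ^ (K - 1) * max_matching_weight G w"
proof -
  let ?n = "fst G" and ?opt = "max_matching_weight G w"
  have S: "0 \<le> sum w (edges G)" using weightings_nonneg[OF w] by (intro sum_nonneg)
  have opt: "0 \<le> ?opt"
    using weight_le_max[OF G, of "{}" w] by (simp add: weight_def matching_def)
  have "card M \<le> ?n * ?n" using card_mono[OF finite_edges[OF G] M] card_edges_le[OF G] by simp
  then have "real (card M) * sum w (edges G) \<le> real (?n * ?n) * (real (?n * ?n) * ?opt)"
    using sum_weights_le_max[OF G w] S by (intro mult_mono) (simp_all flip: of_nat_mult)
  also have "\<dots> = real ?n ^ 4 * ?opt" by (simp add: power4_eq_xxxx)
  also have "\<dots> \<le> 9 ^ (2 * ?n) * ?opt" by (intro mult_right_mono fourth_power_le opt)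
  finally have "real (card M) * sum w (edges G) * (1/9) ^ (2 * ?n + K - 1) \<le>
      9 ^ (2 * ?n) * ?opt * (1/9) ^ (2 * ?n + K - 1)"
    by (rule mult_right_mono) simp
  also have "2 * ?n + K - 1 = 2 * ?n + (K - 1)" using K by simp
  also have "9 ^ (2 * ?n) * ?opt * (1/9) ^ (2 * ?n + (K - 1)) = (1/9) ^ (K - 1) * ?opt"
    by (simp add: power_add power_one_over)
  finally show ?thesis using K by (simp add: mult.assoc)
qed

lemma weight_alg_nonneg:
  "wf_ugraph G \<Longrightarrow> w \<in> weightings G \<Longrightarrow> M \<in> set_pmf (alg K G w) \<Longrightarrow> 0 \<le> weight w M"
  unfolding weight_def
  by (rule sum_nonneg) (metis matching_alg matching_def weightings_nonneg subsetD)

lemma ennreal_expected_weight_alg: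
  assumes G: "wf_ugraph G" and w: "w \<in> weightings G"
  shows "ennreal (measure_pmf.expectation (alg K G w) (weight w)) =
    (\<integral>\<^sup>+\<omega>. ennreal (sum w (rand_matching K G w \<omega>)) \<partial>tape)"
proof -
  have "set_pmf (alg K G w) \<subseteq> {M. matching G M}" using matching_alg[OF G] by blast
  then have fin: "finite (set_pmf (alg K G w))" by (rule finite_subset[OF _ finite_matchings[OF G]])
  have "ennreal (measure_pmf.expectation (alg K G w) (weight w)) =
      (\<integral>\<^sup>+M. ennreal (weight w M) \<partial>measure_pmf (alg K G w))"
    using fin by (intro nn_integral_eq_integral[symmetric] integrable_measure_pmf_finite)
      (simp_all add: AE_measure_pmf_iff weight_alg_nonneg[OF G w])
  also have "\<dots> = (\<integral>\<^sup>+\<omega>. ennreal (sum w (rand_matching K G w \<omega>)) \<partial>tape)"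
    unfolding measure_alg[OF G]
    by (simp add: nn_integral_distr measurable_rand_matching[OF G] weight_def)
  finally show ?thesis .
qed

text \<open>For \<open>q = 1/9\<close> and edges with two vertices the ratio
  \<open>(1 - dominance q 2) / 2 * sqrt q\<close> is \<open>(1 - 1/4) / 2 * 1/3 = 1/8\<close>.\<close>

lemma expected_weight_alg_ge:
  assumes G: "wf_ugraph G" and w: "w \<in> weightings G" and K: "2 \<le> K" and \<epsilon>: "(1/9) ^ (K - 1) \<le> \<epsilon>"
  shows "(1 / 8 - \<epsilon>) * max_matching_weight G w \<le> measure_pmf.expectation (alg K G w) (weight w)"
proof -
  let ?opt = "max_matching_weight G w" and ?L = "2 * fst G + K"
  let ?loss = "sum w (edges G) * (1/9) ^ (?L - 1)"
  obtain A where A: "matching G A" "weight w A = ?opt" using max_matching_attained[OF G] by blast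
  have opt: "0 \<le> ?opt"
    using weight_le_max[OF G, of "{}" w] by (simp add: weight_def matching_def)
  have constants: "dominance (1/9) 2 = 1/4" "sqrt (1/9) = 1/3"
    by (simp_all add: dominance_def real_sqrt_divide)
  have "ennreal ((1 - dominance (1/9) 2) / real 2 * sqrt (1/9) * (\<Sum>e\<in>A. w e - ?loss)) \<le>
      ennreal (measure_pmf.expectation (alg K G w) (weight w))"
    unfolding ennreal_expected_weight_alg[OF G w] rand_matching_def
    by (rule expected_class_matching_weight_ge[OF _ _ finite_edges[OF G] inj_on_edge_index[OF G]])
      (use A(1) K weightings_nonneg[OF w] empty_not_edge[OF G] edge_sizes_le_edges[OF G] constants
        in \<open>auto simp: matching_iff_disjoint\<close>)
  moreover have "0 \<le> measure_pmf.expectation (alg K G w) (weight w)"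
    by (intro integral_nonneg_AE) (simp add: AE_measure_pmf_iff weight_alg_nonneg[OF G w])
  ultimately have "(\<Sum>e\<in>A. w e - ?loss) / 8 \<le> measure_pmf.expectation (alg K G w) (weight w)"
    by (simp add: constants)
  moreover have "(\<Sum>e\<in>A. w e - ?loss) = ?opt - real (card A) * ?loss"
    using A(2) by (simp add: sum_subtractf weight_def)
  moreover have "real (card A) * ?loss \<le> \<epsilon> * ?opt"
  proof -
    have "real (card A) * ?loss \<le> (1/9) ^ (K - 1) * ?opt"
      by (rule truncation_loss_le[OF G w]) (use A(1) K in \<open>auto simp: matching_def\<close>)
    also have "\<dots> \<le> \<epsilon> * ?opt" by (rule mult_right_mono[OF \<epsilon> opt])
    finally show ?thesis .
  qed
  moreover have "0 \<le> \<epsilon> * ?opt"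
    using order_trans[OF _ \<epsilon>, of 0] opt by simp
  ultimately show ?thesis by (simp add: left_diff_distrib)
qed

subsection \<open>Lipschitz constant\<close>

lemma dist_w_le:
  assumes G: "wf_ugraph G" and w: "w \<in> weightings G" "w' \<in> weightings G"
    and F: "F \<subseteq> edges G" "F' \<subseteq> edges G"
  shows "dist_w G (F, w) (F', w') \<le>
    l1_norm G (\<lambda>e. w e - w' e) + (\<Sum>g\<in>sym_diff F F'. min (w g) (w' g))"
proof -
  let ?E = "edges G" and ?d = "\<lambda>g. if g \<in> sym_diff F F' then min (w g) (w' g) else 0"
  have fin: "finite ?E" by (rule finite_edges[OF G])
  have ind: "weighted_indicator A v g = (if g \<in> A then v g else 0)" if "A \<subseteq> ?E" for A v g
    using finite_subset[OF that fin]
    by (simp add: weighted_indicator_def indicator_def if_distrib cong: if_cong)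
  have "dist_w G (F, w) (F', w') =
      (\<Sum>g\<in>?E. \<bar>(if g \<in> F then w g else 0) - (if g \<in> F' then w' g else 0)\<bar>)"
    by (simp add: dist_w_def l1_norm_def ind[OF F(1)] ind[OF F(2)])
  also have "\<dots> \<le> (\<Sum>g\<in>?E. \<bar>w g - w' g\<bar> + ?d g)"
    using weightings_nonneg[OF w(1)] weightings_nonneg[OF w(2)]
    by (intro sum_mono) (fastforce simp: min_def)
  also have "\<dots> = l1_norm G (\<lambda>e. w e - w' e) + sum ?d ?E"
    by (simp add: sum.distrib l1_norm_def)
  also have "sum ?d ?E = (\<Sum>g\<in>sym_diff F F'. min (w g) (w' g))"
    using fin F by (intro sum.mono_neutral_cong_right) auto
  finally show ?thesis .
qed

lemma EM_w_alg_le: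
  assumes G: "wf_ugraph G" and w: "w \<in> weightings G" "w' \<in> weightings G"
  shows "EM_w G (alg K G w, w) (alg K G w', w') \<le> ennreal (30 * l1_norm G (\<lambda>e. w e - w' e))"
proof -
  let ?E = "edges G" and ?L = "2 * fst G + K"
  let ?change = "\<lambda>\<omega>. matching_change ?E (\<lambda>g. min (w g) (w' g))
    (classes (1/9) ?L ?E w (\<omega> 0)) (classes (1/9) ?L ?E w' (\<omega> 0)) (key (edge_index G) \<omega>)"
  define D where "D = l1_norm G (\<lambda>e. w e - w' e)"
  have D: "0 \<le> D" by (simp add: D_def l1_norm_def sum_nonneg)
  have nonneg: "0 \<le> ?change \<omega>" for \<omega>
    by (rule matching_change_nonneg[OF finite_edges[OF G]]) (use weightings_nonneg w in auto)
  have "EM_w G (alg K G w, w) (alg K G w', w') \<le>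
      (\<integral>\<^sup>+\<omega>. ennreal (dist_w G (rand_matching K G w \<omega>, w) (rand_matching K G w' \<omega>, w')) \<partial>tape)"
    unfolding alg_def
    by (intro EM_w_tape_pmf_le measurable_rand_matching finite_range_rand_matching G)
  also have "\<dots> \<le> (\<integral>\<^sup>+\<omega>. ennreal D + ennreal (?change \<omega>) \<partial>tape)"
    using dist_w_le[OF G w rand_matching_subset[OF G] rand_matching_subset[OF G]] D nonneg
    by (intro nn_integral_mono)
      (simp add: ennreal_leI D_def matching_change_def rand_matching_def flip: ennreal_plus)
  also have "\<dots> = ennreal D + (\<integral>\<^sup>+\<omega>. ennreal (?change \<omega>) \<partial>tape)"
    using tape.emeasure_space_1
    by (subst nn_integral_add)
      (simp_all add: measurable_matching_change finite_edges[OF G] measurable_classes)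
  also have "\<dots> \<le> ennreal D + ennreal (change_factor (1/9) 2 * D)"
    unfolding D_def l1_norm_def
    by (intro add_left_mono expected_class_matching_change_le finite_edges[OF G]
        inj_on_edge_index[OF G] edge_sizes_le_edges[OF G]) (use weightings_nonneg w in auto)
  also have "\<dots> \<le> ennreal (30 * D)"
    using D by (simp add: change_factor_def dominance_def ennreal_leI flip: ennreal_plus)
  finally show ?thesis unfolding D_def .
qed

lemma lipschitz_constant_alg_le:
  assumes G: "wf_ugraph G"
  shows "lipschitz_constant (alg K) G \<le> ennreal 30"
  unfolding lipschitz_constant_def
proof (rule SUP_least, clarify)
  fix w w' assume w: "w \<in> weightings G" "w' \<in> weightings G" and "w \<noteq> w'"
  let ?D = "l1_norm G (\<lambda>e. w e - w' e)"
  obtain e where e: "e \<in> edges G" "w e \<noteq> w' e"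
    using w \<open>w \<noteq> w'\<close> unfolding weightings_def by (meson PiE_ext)
  have D: "0 < ?D"
    unfolding l1_norm_def using e finite_edges[OF G] by (intro sum_pos2[of _ e]) auto
  then have "EM_w G (alg K G w, w) (alg K G w', w') \<le> ennreal ?D * ennreal 30"
    using EM_w_alg_le[OF G w, of K] ennreal_mult[of ?D 30]
    by (metis ennreal_mult less_imp_le mult.commute zero_le_numeral)
  then show "EM_w G (alg K G w, w) (alg K G w', w') / ennreal ?D \<le> ennreal 30"
    using D by (intro divide_le_posI_ennreal) auto
qed

theorem theorem5p1:
  "\<exists>C::real. C > 0 \<and>
     (\<forall>\<epsilon>::real. 0 < \<epsilon> \<and> \<epsilon> < 1 / 8 \<longrightarrow>
        (\<exists>A. polytime_randomized A \<and>
             approx_max_weight_matching (1 / 8 - \<epsilon>) A \<and>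
             (\<forall>G. wf_ugraph G \<longrightarrow> lipschitz_constant A G \<le> ennreal (C / \<epsilon>))))"
proof (intro exI[of _ 30] conjI allI impI)
  fix \<epsilon> :: real assume \<epsilon>: "0 < \<epsilon> \<and> \<epsilon> < 1 / 8"
  obtain k where "(1/9) ^ k < \<epsilon>" using real_arch_pow_inv[of \<epsilon> "1/9"] \<epsilon> by auto
  moreover have "(1/9) ^ (k + 2 - 1) \<le> (1/9 :: real) ^ k" by (rule power_decreasing) auto
  ultimately have K: "(1/9) ^ (k + 2 - 1) \<le> \<epsilon>" by linarith
  show "\<exists>A. polytime_randomized A \<and> approx_max_weight_matching (1 / 8 - \<epsilon>) A \<and>
      (\<forall>G. wf_ugraph G \<longrightarrow> lipschitz_constant A G \<le> ennreal (30 / \<epsilon>))"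
  proof (intro exI[of _ "alg (k + 2)"] conjI allI impI)
    show "polytime_randomized (alg (k + 2))" by (rule polytime_alg)
    show "approx_max_weight_matching (1 / 8 - \<epsilon>) (alg (k + 2))"
      unfolding approx_max_weight_matching_def
      using matching_alg expected_weight_alg_ge[OF _ _ le_add2 K] by blast
    fix G assume "wf_ugraph G"
    then have "lipschitz_constant (alg (k + 2)) G \<le> ennreal 30" by (rule lipschitz_constant_alg_le)
    also have "\<dots> \<le> ennreal (30 / \<epsilon>)" using \<epsilon> by (intro ennreal_leI) (simp add: field_simps)
    finally show "lipschitz_constant (alg (k + 2)) G \<le> ennreal (30 / \<epsilon>)" .
  qed
qed simp

end
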